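(* Consider either of the following two cases, with a convex compact set $\mathcal K\subseteq[0,1]^d$ and objective functions $f_{t,i}:[0,1]^d\to\mathbb R$ ($t\in[T]$, $i\in[N]$): (Case A.2) $\mathbf 0\in\mathcal K$, the $f_{t,i}$ are non-negative, monotone and $\gamma$-weakly up-concave for some $0<\gamma\le1$, and $\alpha=1-e^{-\gamma}$; (Case A.3) the $f_{t,i}$ are non-negative and up-concave (not necessarily monotone), $\underline{\mathbf u}\in\mathcal K$ is a fixed point, and $\alpha=\frac{1-\|\underline{\mathbf u}\|_\infty}{4}$. Suppose the $f_{t,i}$ are continuous, differentiable, Lipschitz continuous and smooth (with common constants), that the first-order query oracle is bounded (responses of norm at most $G$), and that the weight matrix $A$ is symmetric and doubly stochastic with second largest eigenvalue $\lambda_2<1$. Run the semi-bandit algorithm described in the context with parameters $K,L,\eta$ and error tolerance $\epsilon=K^2\eta^2G^2$. Then for every agent $i$ $$\mathbb E[\mathcal R_\alpha^i]=O\left(\frac L\eta+\eta TKG^2+\frac TL\right),$$ with at most $O\left(\frac{T}{\epsilon KL}\right)$ linear optimization oracle (LOO) calls and $O\left(\frac{T}{KL}\right)$ communication complexity. In particular, if $0\le\theta\le2/3$ and $K=T^{1-3\theta/2}$, $L=T^{\theta/2}$, $\eta=T^{\theta-1}$, then $\mathbb E[\mathcal R_\alpha^i]=O(T^{1-\theta/2})$ with at most $O(T^{2\theta})$ LOO calls and $O(T^\theta)$ communication complexity.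
   Context: **Functions.** Inequalities between vectors are coordinatewise. A differentiable $f$ is $\gamma$-weakly up-concave if for all $\mathbf x\le\mathbf y$: $\gamma\langle\nabla f(\mathbf y),\mathbf y-\mathbf x\rangle\le f(\mathbf y)-f(\mathbf x)\le\frac1\gamma\langle\nabla f(\mathbf x),\mathbf y-\mathbf x\rangle$; up-concave means $\gamma=1$. Monotone means $\mathbf x\le\mathbf y$ implies $f(\mathbf x)\le f(\mathbf y)$. **Network.** $N$ agents are the nodes of an undirected graph $([N],E)$; $\mathcal N_i=\{j:(i,j)\in E\}\cup\{i\}$. $A=[a_{ij}]\in\mathbb R_+^{N\times N}$ has $a_{ij}>0$ only if $(i,j)\in E$ or $i=j$; its largest eigenvalue is $1$ and $\lambda_2$ is its second largest eigenvalue ($\lambda_2=1$ corresponds to a disconnected network). In one communication, agent $i$ receives $\sum_{j\in\mathcal N_i}a_{ij}\mathbf s^j$ from its neighbors' state vectors $\mathbf s^j$. Communication complexity is the total number of communications over the horizon. **Problem.** An adversary chooses the sequence $f_{t,i}$. At round $t$ agent $i$ plays $\mathbf z_t^i\in\mathcal K$ and may query a first-order oracle $\mathcal Q$ only at the played point (semi-bandit feedback); the response is a random vector with mean $\nabla f_{t,i}(\mathbf z_t^i)$ and norm at most $G$. The $\alpha$-regret is $$\mathcal R_\alpha^i=\alpha\max_{\mathbf u\in\mathcal K}\frac1N\sum_{t=1}^T\sum_{j=1}^Nf_{t,j}(\mathbf u)-\frac1N\sum_{t=1}^T\sum_{j=1}^Nf_{t,j}(\mathbf z_t^i).$$ **LOO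 and infeasible projection oracle.** Let $R=\max_{\mathbf x\in\mathcal K}\|\mathbf x\|$. An LOO returns $\arg\max_{\mathbf u\in\mathcal K}\langle\mathbf x,\mathbf u\rangle$. The infeasible projection oracle $\mathcal O_{IP}(\mathcal K,\mathbf x_0,\mathbf y_0,\epsilon)$ takes $\mathbf x_0\in\mathcal K$, $\mathbf y_0\in\mathbb R^d$ and returns $(\mathbf x,\tilde{\mathbf y})$ with $\mathbf x\in\mathcal K$, $\|\tilde{\mathbf y}\|\le R$, $\|\mathbf x-\tilde{\mathbf y}\|^2\le3\epsilon$ and $\|\tilde{\mathbf y}-\mathbf z\|^2\le\|\mathbf y_0-\mathbf z\|^2$ for all $\mathbf z\in\mathcal K$. It is a known fact (used as given) that it can be implemented with at most $\lceil27R^2/\epsilon-2\rceil\max\big(1,\frac{\|\mathbf x_0-\mathbf y_0\|^2(\|\mathbf x_0-\mathbf y_0\|^2-\epsilon)}{4\epsilon^2}+1\big)$ LOO calls; this implementation is used. **Case-dependent maps.** Case A.2: $h(\mathbf x)=\mathbf x$; the random $z\in[0,1]$ has law $\mathbb P(z\le s)=\int_0^s\frac{\gamma e^{\gamma(u-1)}}{1-e^{-\gamma}}du$; query point $\mathbf w(\mathbf x,z)=z\mathbf x$. Case A.3: $h(\mathbf x)=\frac{\mathbf x+\underline{\mathbf u}}2$; $z\in[0,1]$ has law $\mathbb P(z\le s)=\int_0^s\frac{du}{3(1-u/2)^3}$; $\mathbf w(\mathbf x,z)=\frac z2(\mathbf x-\underline{\mathbf u})+\underline{\mathbf u}$. **Algorithm.**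 Set $\mathbf x_1^i=\tilde{\mathbf y}_1^i=\mathbf c\in\mathcal K$ for all $i$. For $m=1,\dots,\frac T{LK}$, each agent $i$ in parallel: for each $q=(m-1)K+1,\dots,mK$, lets $\hat{\mathbf x}_q^i=h(\mathbf x_m^i)$, samples $z$ from its law and lets $\mathbf w_q^i=\mathbf w(\mathbf x_m^i,z)$, samples $t'_q$ uniformly from $\{(q-1)L+1,\dots,qL\}$; for $t=(q-1)L+1,\dots,qL$: if $t=t'_q$, plays $\mathbf z_t^i=\mathbf w_q^i$ and queries $\mathcal Q$ at $\mathbf w_q^i$, receiving $\mathbf o_q^i$; otherwise plays $\mathbf z_t^i=\hat{\mathbf x}_q^i$. Then (once per $m$) it communicates $(\mathbf x_m^i,\tilde{\mathbf y}_m^i)$ with its neighbors and sets $$\mathbf y_{m+1}^i=\sum_{j\in\mathcal N_i}a_{ij}\tilde{\mathbf y}_m^j+\eta\sum_{q=(m-1)K+1}^{mK}\mathbf o_q^i,\qquad(\mathbf x_{m+1}^i,\tilde{\mathbf y}_{m+1}^i)=\mathcal O_{IP}\Big(\mathcal K,\sum_{j\in\mathcal N_i}a_{ij}\mathbf x_m^j,\mathbf y_{m+1}^i,\epsilon\Big).$$ **Conventions.** $K,L$ are positive integers with $KL$ dividing $T$. Constants implied by $O(\cdot)$ may depend on the fixed problem parameters ($\gamma,d,R,N,\lambda_2,G$, the Lipschitz and smoothness constants) but not on $T,K,L,\eta,\epsilon$. LOO calls are counted per agent over the whole horizon.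
   Formalization: The second largest eigenvalue is taken in modulus (with the signed order the claim fails, e.g. for two agents that swap states), and the constant is chosen for a fixed type of sample points. *)

theory Defs
  imports "HOL-Probability.Probability"
begin

section \<open>Objective functions on the unit cube\<close>

text \<open>The derivative is taken within the closed cube, where it is still unique; on the boundary
  it is the one-sided derivative.\<close>

definition grad :: "(real^'d \<Rightarrow> real) \<Rightarrow> real^'d \<Rightarrow> real^'d" where
  "grad f x = (\<chi> k. frechet_derivative f (at x within {0..1}) (axis k 1))"

definition weakly_up_concave :: "real \<Rightarrow> (real^'d \<Rightarrow> real) \<Rightarrow> bool" where
  "weakly_up_concave \<gamma> f \<longleftrightarrow>
     (\<forall>x\<in>{0..1}. \<forall>y\<in>{0..1}. x \<le> y \<longrightarrow>
        \<gamma> * (grad f y \<bullet> (y - x)) \<le> f y - f x \<and>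
        f y - f x \<le> (1 / \<gamma>) * (grad f x \<bullet> (y - x)))"

abbreviation up_concave :: "(real^'d \<Rightarrow> real) \<Rightarrow> bool" where
  "up_concave \<equiv> weakly_up_concave 1"

definition regular_objective :: "real \<Rightarrow> real \<Rightarrow> (real^'d \<Rightarrow> real) \<Rightarrow> bool" where
  "regular_objective M1 M2 f \<longleftrightarrow>
     continuous_on {0..1} f \<and> f differentiable_on {0..1} \<and>
     M1-lipschitz_on {0..1} f \<and> M2-lipschitz_on {0..1} (grad f)"

definition regret ::
  "real \<Rightarrow> (real^'d) set \<Rightarrow> nat \<Rightarrow> (nat \<Rightarrow> 'n::finite \<Rightarrow> real^'d \<Rightarrow> real) \<Rightarrow>
   (nat \<Rightarrow> 'n \<Rightarrow> real^'d) \<Rightarrow> 'n \<Rightarrow> real" where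
  "regret \<alpha> \<K> T f z i =
     \<alpha> * (SUP u\<in>\<K>. 1 / real CARD('n) * (\<Sum>t<T. \<Sum>j\<in>UNIV. f t j u))
     - 1 / real CARD('n) * (\<Sum>t<T. \<Sum>j\<in>UNIV. f t j (z t i))"

section \<open>The two cases\<close>

record ('d::finite) scheme =
  ratio :: real
  out_map :: "real^'d \<Rightarrow> real^'d"
  query_map :: "real^'d \<Rightarrow> real \<Rightarrow> real^'d"
  z_density :: "real \<Rightarrow> real"

definition z_law :: "'d::finite scheme \<Rightarrow> real measure" where
  "z_law \<sigma> = density lborel (\<lambda>s. ennreal (z_density \<sigma> s) * indicator {0..1} s)"

definition monotone_scheme :: "real \<Rightarrow> 'd::finite scheme" where
  "monotone_scheme \<gamma> =
     \<lparr> ratio = 1 - exp (-\<gamma>),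
       out_map = (\<lambda>x. x),
       query_map = (\<lambda>x z. z *\<^sub>R x),
       z_density = (\<lambda>u. \<gamma> * exp (\<gamma> * (u - 1)) / (1 - exp (-\<gamma>))) \<rparr>"

definition nonmonotone_scheme :: "real^'d \<Rightarrow> 'd scheme" where
  "nonmonotone_scheme l =
     \<lparr> ratio = (1 - infnorm l) / 4,
       out_map = (\<lambda>x. (1/2) *\<^sub>R (x + l)),
       query_map = (\<lambda>x z. (z/2) *\<^sub>R (x - l) + l),
       z_density = (\<lambda>u. 1 / (3 * (1 - u/2)^3)) \<rparr>"

definition monotone_case ::
  "real \<Rightarrow> (real^'d) set \<Rightarrow> nat \<Rightarrow> (nat \<Rightarrow> 'n \<Rightarrow> real^'d \<Rightarrow> real) \<Rightarrow> 'd scheme \<Rightarrow> bool" where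
  "monotone_case \<gamma> \<K> T f \<sigma> \<longleftrightarrow>
     0 \<in> \<K> \<and>
     (\<forall>t<T. \<forall>i. (\<forall>x\<in>{0..1}. 0 \<le> f t i x) \<and> mono_on {0..1} (f t i) \<and>
                 weakly_up_concave \<gamma> (f t i)) \<and>
     \<sigma> = monotone_scheme \<gamma>"

definition nonmonotone_case ::
  "(real^'d) set \<Rightarrow> nat \<Rightarrow> (nat \<Rightarrow> 'n \<Rightarrow> real^'d \<Rightarrow> real) \<Rightarrow> 'd scheme \<Rightarrow> bool" where
  "nonmonotone_case \<K> T f \<sigma> \<longleftrightarrow>
     (\<forall>t<T. \<forall>i. (\<forall>x\<in>{0..1}. 0 \<le> f t i x) \<and> up_concave (f t i)) \<and>
     (\<exists>l\<in>\<K>. \<sigma> = nonmonotone_scheme l)"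

section \<open>Network\<close>

definition neighbours :: "('n \<times> 'n) set \<Rightarrow> 'n \<Rightarrow> 'n set" where
  "neighbours E i = {j. (i, j) \<in> E} \<union> {i}"

definition weight_matrix :: "('n \<times> 'n) set \<Rightarrow> real^'n^'n \<Rightarrow> bool" where
  "weight_matrix E A \<longleftrightarrow>
     sym E \<and> (\<forall>i j. 0 \<le> A$i$j) \<and> (\<forall>i j. 0 < A$i$j \<longrightarrow> (i, j) \<in> E \<or> i = j)"

definition doubly_stochastic :: "real^'n^'n \<Rightarrow> bool" where
  "doubly_stochastic A \<longleftrightarrow>
     (\<forall>i j. 0 \<le> A$i$j) \<and> (\<forall>i. (\<Sum>j\<in>UNIV. A$i$j) = 1) \<and> (\<forall>j. (\<Sum>i\<in>UNIV. A$i$j) = 1)"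

text \<open>The eigenvalues are listed with multiplicity (as the roots of the characteristic
  polynomial) and ordered by modulus, as is usual for gossip matrices. The signed order would
  admit the eigenvalue \<open>-1\<close> (two agents that merely swap their states), for which there is no
  consensus. A single agent has no second eigenvalue; the value is then \<open>0\<close>.\<close>

definition second_eigenvalue :: "real^'n^'n \<Rightarrow> real \<Rightarrow> bool" where
  "second_eigenvalue A l \<longleftrightarrow>
     (\<exists>ls. (\<forall>x. det (mat x - A) = (\<Prod>a\<leftarrow>ls. x - a)) \<and>
           sorted_wrt (\<lambda>a b. \<bar>b\<bar> \<le> \<bar>a\<bar>) ls \<and>
           l = (if 2 \<le> length ls then \<bar>ls ! 1\<bar> else 0))"

definition received ::
  "('n \<times> 'n) set \<Rightarrow> real^'n^'n \<Rightarrow> ('n::finite \<Rightarrow> real^'d) \<Rightarrow> 'n \<Rightarrow> real^'d" where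
  "received E A s i = (\<Sum>j\<in>neighbours E i. A$i$j *\<^sub>R s j)"

section \<open>Linear optimization oracle and infeasible projection\<close>

definition linear_opt_oracle :: "(real^'d) set \<Rightarrow> (real^'d \<Rightarrow> real^'d) \<Rightarrow> bool" where
  "linear_opt_oracle \<K> lo \<longleftrightarrow> (\<forall>x. lo x \<in> \<K> \<and> (\<forall>u\<in>\<K>. x \<bullet> u \<le> x \<bullet> lo x))"

text \<open>A computation that may call a linear optimization oracle adaptively, so that the number of
  calls is the number of query nodes met along the execution.\<close>

datatype ('v, 'r) loo_program = Return 'r | Query 'v "'v \<Rightarrow> ('v, 'r) loo_program"

primrec loo_result :: "('v \<Rightarrow> 'v) \<Rightarrow> ('v, 'r) loo_program \<Rightarrow> 'r" where
  "loo_result lo (Return r) = r"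
| "loo_result lo (Query v k) = loo_result lo (k (lo v))"

primrec loo_calls :: "('v \<Rightarrow> 'v) \<Rightarrow> ('v, 'r) loo_program \<Rightarrow> nat" where
  "loo_calls lo (Return r) = 0"
| "loo_calls lo (Query v k) = Suc (loo_calls lo (k (lo v)))"

definition infeasible_projection ::
  "(real^'d) set \<Rightarrow> real \<Rightarrow> real \<Rightarrow> real^'d \<Rightarrow> (real^'d) \<times> (real^'d) \<Rightarrow> bool" where
  "infeasible_projection \<K> R \<epsilon> y0 = (\<lambda>(x, y).
     x \<in> \<K> \<and> norm y \<le> R \<and> (norm (x - y))\<^sup>2 \<le> 3 * \<epsilon> \<and>
     (\<forall>z\<in>\<K>. (norm (y - z))\<^sup>2 \<le> (norm (y0 - z))\<^sup>2))"

text \<open>For \<open>\<epsilon> \<ge> 27/2 * R\<^sup>2\<close> the rounded-up factor is not positive and the bound means that no call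
  is made, which is why it is truncated at \<open>0\<close>.\<close>

definition projection_budget :: "real \<Rightarrow> real \<Rightarrow> real^'d \<Rightarrow> real^'d \<Rightarrow> real" where
  "projection_budget R \<epsilon> x0 y0 =
     real (nat \<lceil>27 * R\<^sup>2 / \<epsilon> - 2\<rceil>) *
     max 1 ((norm (x0 - y0))\<^sup>2 * ((norm (x0 - y0))\<^sup>2 - \<epsilon>) / (4 * \<epsilon>\<^sup>2) + 1)"

definition implements_projection ::
  "(real^'d) set \<Rightarrow> real \<Rightarrow> real \<Rightarrow> (real^'d \<Rightarrow> real^'d) \<Rightarrow>
   (real^'d \<Rightarrow> real^'d \<Rightarrow> (real^'d, (real^'d) \<times> (real^'d)) loo_program) \<Rightarrow> bool" where
  "implements_projection \<K> R \<epsilon> lo P \<longleftrightarrow>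
     (\<forall>x0\<in>\<K>. \<forall>y0. infeasible_projection \<K> R \<epsilon> y0 (loo_result lo (P x0 y0)) \<and>
        real (loo_calls lo (P x0 y0)) \<le> projection_budget R \<epsilon> x0 y0) \<and>
     (\<lambda>(x0, y0). loo_result lo (P x0 y0)) \<in> borel_measurable (restrict_space borel (\<K> \<times> UNIV))"

section \<open>A run of the semi-bandit algorithm\<close>

text \<open>Rounds \<open>t < T\<close>, blocks \<open>q < T div L\<close> and phases \<open>m < T div (L * K)\<close> are numbered from \<open>0\<close>:
  block \<open>q\<close> consists of the rounds \<open>{q * L..<Suc q * L}\<close>, and phase \<open>m\<close> of the blocks
  \<open>{m * K..<Suc m * K}\<close>.

  The sigma-algebra \<open>F q\<close> is the information available before block \<open>q\<close>, and \<open>H q\<close> contains in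
  addition the draws \<open>Z q i\<close> (parameter of the query point) and \<open>S q i\<close> (query round) of all
  agents in block \<open>q\<close>, but not the oracle responses \<open>resp q i\<close>. The objectives \<open>f\<close> are fixed in
  advance (oblivious adversary). \<open>n_loo\<close> and \<open>n_comm\<close> count, per agent, the oracle calls and the
  communications made in the first \<open>m\<close> phases.\<close>

locale semi_bandit_run = prob_space M
  for M :: "'w measure" +
  fixes F H :: "nat \<Rightarrow> 'w measure"
    and \<K> :: "(real^'d) set"
    and G :: real
    and T :: nat
    and f :: "nat \<Rightarrow> 'n::finite \<Rightarrow> real^'d \<Rightarrow> real"
    and E :: "('n \<times> 'n) set"
    and A :: "real^'n^'n"
    and \<sigma> :: "'d scheme"
    and lo :: "real^'d \<Rightarrow> real^'d"
    and P :: "real^'d \<Rightarrow> real^'d \<Rightarrow> (real^'d, (real^'d) \<times> (real^'d)) loo_program"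
    and K L :: nat
    and \<eta> :: real
    and c :: "real^'d"
    and Z :: "nat \<Rightarrow> 'n \<Rightarrow> 'w \<Rightarrow> real"
    and S :: "nat \<Rightarrow> 'n \<Rightarrow> 'w \<Rightarrow> nat"
    and resp :: "nat \<Rightarrow> 'n \<Rightarrow> 'w \<Rightarrow> real^'d"
    and x y y_tilde :: "nat \<Rightarrow> 'n \<Rightarrow> 'w \<Rightarrow> real^'d"
    and play :: "nat \<Rightarrow> 'n \<Rightarrow> 'w \<Rightarrow> real^'d"
    and n_loo :: "nat \<Rightarrow> 'n \<Rightarrow> 'w \<Rightarrow> nat"
    and n_comm :: "nat \<Rightarrow> 'n \<Rightarrow> nat"
  assumes subalgebras: "\<And>q. subalgebra M (F q)" "\<And>q. subalgebra M (H q)"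
    and filtration: "\<And>q. sets (F q) \<subseteq> sets (H q)" "\<And>q. sets (H q) \<subseteq> sets (F (Suc q))"
    and Z_measurable: "\<And>q i. q < T div L \<Longrightarrow> Z q i \<in> borel_measurable (H q)"
    and S_measurable: "\<And>q i. q < T div L \<Longrightarrow> S q i \<in> measurable (H q) (count_space UNIV)"
    and resp_measurable: "\<And>q i. q < T div L \<Longrightarrow> resp q i \<in> borel_measurable (F (Suc q))"
    and Z_range: "\<And>q i \<omega>. q < T div L \<Longrightarrow> \<omega> \<in> space M \<Longrightarrow> Z q i \<omega> \<in> {0..1}"
    and S_range: "\<And>q i \<omega>. q < T div L \<Longrightarrow> \<omega> \<in> space M \<Longrightarrow> S q i \<omega> \<in> {q * L..<Suc q * L}"
    \<comment> \<open>given the past, all draws of a block are independent, with the prescribed laws\<close>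
    and sampling: "\<And>q D U V. q < T div L \<Longrightarrow> D \<in> sets (F q) \<Longrightarrow> (\<And>i. U i \<in> sets borel) \<Longrightarrow>
        prob (D \<inter> {\<omega> \<in> space M. \<forall>i. Z q i \<omega> \<in> U i \<and> S q i \<omega> \<in> V i}) =
        prob D * (\<Prod>i\<in>UNIV. measure (z_law \<sigma>) (U i) *
                              measure_pmf.prob (pmf_of_set {q * L..<Suc q * L}) (V i))"
    and oracle_mean: "\<And>q i k. q < T div L \<Longrightarrow>
        AE \<omega> in M. real_cond_exp M (H q) (\<lambda>\<omega>. resp q i \<omega> $ k) \<omega> =
          grad (f (S q i \<omega>) i) (play (S q i \<omega>) i \<omega>) $ k"
    and oracle_bound: "\<And>q i \<omega>. q < T div L \<Longrightarrow> \<omega> \<in> space M \<Longrightarrow> norm (resp q i \<omega>) \<le> G"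
    and start: "c \<in> \<K>"
      "\<And>i \<omega>. \<omega> \<in> space M \<Longrightarrow> x 0 i \<omega> = c"
      "\<And>i \<omega>. \<omega> \<in> space M \<Longrightarrow> y_tilde 0 i \<omega> = c"
    and play: "\<And>t i \<omega>. t < T \<Longrightarrow> \<omega> \<in> space M \<Longrightarrow>
        play t i \<omega> = (let q = t div L; m = q div K in
          if t = S q i \<omega> then query_map \<sigma> (x m i \<omega>) (Z q i \<omega>) else out_map \<sigma> (x m i \<omega>))"
    and y_step: "\<And>m i \<omega>. m < T div (L * K) \<Longrightarrow> \<omega> \<in> space M \<Longrightarrow>
        y (Suc m) i \<omega> = received E A (\<lambda>j. y_tilde m j \<omega>) i
          + \<eta> *\<^sub>R (\<Sum>q\<in>{m * K..<Suc m * K}. resp q i \<omega>)"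
    and projection_step: "\<And>m i \<omega>. m < T div (L * K) \<Longrightarrow> \<omega> \<in> space M \<Longrightarrow>
        (x (Suc m) i \<omega>, y_tilde (Suc m) i \<omega>) =
          loo_result lo (P (received E A (\<lambda>j. x m j \<omega>) i) (y (Suc m) i \<omega>))"
    and loo_count: "\<And>i \<omega>. \<omega> \<in> space M \<Longrightarrow> n_loo 0 i \<omega> = 0"
      "\<And>m i \<omega>. m < T div (L * K) \<Longrightarrow> \<omega> \<in> space M \<Longrightarrow>
        n_loo (Suc m) i \<omega> = n_loo m i \<omega>
          + loo_calls lo (P (received E A (\<lambda>j. x m j \<omega>) i) (y (Suc m) i \<omega>))"
    and comm_count: "\<And>i. n_comm 0 i = 0"
      "\<And>m i. m < T div (L * K) \<Longrightarrow> n_comm (Suc m) i = n_comm m i + 1"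

end

theory Submission
  imports Defs
begin

text \<open>The algorithm is decentralized online gradient ascent with infeasible projections, run on linear
  surrogates of the objectives.

  In each case the law of the random parameter \<open>z\<close> is chosen such that
  \<open>ratio * f u - f (out_map x)\<close> is at most \<open>\<beta>\<close> times the mean of
  \<open>\<nabla>f (query_map x z) \<bullet> (u - x)\<close>, with \<open>\<beta> = (1 - exp (-\<gamma>)) / \<gamma>\<close> and \<open>\<beta> = 3/8\<close>. Up-concavity bounds
  the part of the inner product that points towards \<open>u\<close>; the rest is the derivative of \<open>f\<close> along the
  segment of query points, and the density is the integrating factor that turns the sum of both into
  an exact derivative in \<open>z\<close>. The comparison with \<open>f u\<close> is thereby reduced to the fundamental theorem
  of calculus (\<open>monotone_scheme_linearizable\<close>, \<open>nonmonotone_scheme_linearizable\<close>).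

  The estimates are unbiased on the scale of a block: among its \<open>L\<close> rounds the queried one is uniform
  and independent of the past, so the response of the oracle has conditional mean \<open>1/L\<close> times the sum
  over the block of the averaged gradients. Hence the regret of the block is at most \<open>\<beta> * L\<close> times the
  expected inner product of the response with \<open>u - x\<close> (\<open>block_linearization\<close>).

  For the regret of gradient ascent let \<open>s = K * \<eta> * G\<close>, so that \<open>\<epsilon> = s\<^sup>2\<close>. Testing the projection
  inequality at its own starting point shows that everything moves by \<open>O(s)\<close> in a phase: the input
  of the projection is within \<open>3 * s\<close> of the feasible starting point, and the result within \<open>5 * s\<close> of
  the gossip average. The spectral gap contracts disagreement by the factor \<open>lam2\<close> per phase, so the
  agents stay within \<open>O(s / (1 - lam2))\<close> of each other. Telescoping the squared distances to \<open>u\<close> then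
  gives a linear regret of \<open>O(R\<^sup>2 / \<eta> + phases * \<eta> * K\<^sup>2 * G\<^sup>2)\<close> per agent
  (\<open>online_gradient_regret\<close>), which \<open>L\<close> turns into the first two terms of the bound. Playing an
  exploratory point once per block costs \<open>O(T / L)\<close>, and evaluating the objectives of the other
  agents at the own iterate costs \<open>O(T * s)\<close>, which is of the order of the second term.

  The same estimate limits the oracle calls. Since the input of every projection is within \<open>3 * s\<close> of
  the starting point and the tolerance is \<open>s\<^sup>2\<close>, the second factor of the budget is bounded by a
  constant, and each of the \<open>T / (K * L)\<close> phases costs \<open>O(R\<^sup>2 / \<epsilon>)\<close> calls.\<close>

section \<open>Spectral gap and consensus\<close>

text \<open>Jensen's inequality for the squared norm: the weighted variance around the mean is nonnegative.\<close>

lemma norm_weighted_sum_le: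
  fixes v :: "'n::finite \<Rightarrow> 'v::real_inner"
  assumes "\<And>j. 0 \<le> w j" and "(\<Sum>j\<in>UNIV. w j) = 1"
  shows "(norm (\<Sum>j\<in>UNIV. w j *\<^sub>R v j))\<^sup>2 \<le> (\<Sum>j\<in>UNIV. w j * (norm (v j))\<^sup>2)"
proof -
  define m where "m = (\<Sum>j\<in>UNIV. w j *\<^sub>R v j)"
  have "0 \<le> (\<Sum>j\<in>UNIV. w j * (norm (v j - m))\<^sup>2)"
    by (intro sum_nonneg mult_nonneg_nonneg assms) auto
  also have "\<dots> = (\<Sum>j\<in>UNIV. w j * (norm (v j))\<^sup>2 - 2 * ((w j *\<^sub>R v j) \<bullet> m) + w j * (norm m)\<^sup>2)"
    by (intro sum.cong refl)
       (simp add: power2_norm_eq_inner inner_diff_left inner_diff_right inner_commute algebra_simps)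
  also have "\<dots> = (\<Sum>j\<in>UNIV. w j * (norm (v j))\<^sup>2) - 2 * (m \<bullet> m) + (\<Sum>j\<in>UNIV. w j) * (norm m)\<^sup>2"
    unfolding sum.distrib sum_subtractf sum_distrib_left[symmetric] sum_distrib_right[symmetric]
      inner_sum_left[symmetric] m_def[symmetric] by simp
  finally show ?thesis
    by (simp add: m_def[symmetric] assms power2_norm_eq_inner)
qed

text \<open>Unit row sums give Jensen's inequality in each row; unit column sums then make the total weight
  of every \<open>v j\<close> equal to one.\<close>

lemma doubly_stochastic_sum_norm_le:
  fixes A :: "real^'n^'n" and v :: "'n \<Rightarrow> 'v::real_inner"
  assumes "doubly_stochastic A"
  shows "(\<Sum>i\<in>UNIV. (norm (\<Sum>j\<in>UNIV. A$i$j *\<^sub>R v j))\<^sup>2) \<le> (\<Sum>j\<in>UNIV. (norm (v j))\<^sup>2)"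
proof -
  have "(\<Sum>i\<in>UNIV. (norm (\<Sum>j\<in>UNIV. A$i$j *\<^sub>R v j))\<^sup>2)
      \<le> (\<Sum>i\<in>UNIV. \<Sum>j\<in>UNIV. A$i$j * (norm (v j))\<^sup>2)"
    using assms by (intro sum_mono norm_weighted_sum_le) (auto simp: doubly_stochastic_def)
  also have "\<dots> = (\<Sum>j\<in>UNIV. (\<Sum>i\<in>UNIV. A$i$j) * (norm (v j))\<^sup>2)"
    by (subst sum.swap) (simp add: sum_distrib_right)
  also have "\<dots> = (\<Sum>j\<in>UNIV. (norm (v j))\<^sup>2)"
    using assms by (simp add: doubly_stochastic_def)
  finally show ?thesis .
qed

lemma norm_vec_squared: "(norm (v :: real^'n))\<^sup>2 = (\<Sum>i\<in>UNIV. (v$i)\<^sup>2)"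
  by (simp add: norm_vec_def L2_set_def sum_nonneg)

lemma doubly_stochastic_nonexpansive:
  fixes A :: "real^'n^'n"
  assumes "doubly_stochastic A"
  shows "norm (A *v v) \<le> norm v"
proof -
  have "(norm (A *v v))\<^sup>2 \<le> (norm v)\<^sup>2"
    using doubly_stochastic_sum_norm_le[OF assms, of "\<lambda>j. v$j"]
    by (simp add: norm_vec_squared matrix_vector_mult_def)
  then show ?thesis by (simp add: abs_le_square_iff[symmetric])
qed

text \<open>In an orthonormal basis that contains \<open>v\<close> the matrix is diagonal, with the entry \<open>1 + s\<close> at \<open>v\<close>
  and ones elsewhere.\<close>

lemma det_identity_plus_rank_one:
  fixes v :: "real^'n"
  assumes "norm v = 1"
  shows "det (mat 1 + s *\<^sub>R (\<chi> i j. v$i * v$j)) = 1 + s"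
proof -
  define k :: 'n where "k = undefined"
  obtain Q where Q: "orthogonal_matrix Q" "Q *v (axis k 1) = v"
    using orthogonal_matrix_exists_basis[OF assms] by metis
  \<comment> \<open>\<open>Q\<close> diagonalizes the matrix; its column \<open>k\<close> is \<open>v\<close>\<close>
  define D :: "real^'n^'n" where "D = (\<chi> i j. if i = j then (if i = k then 1 + s else 1) else 0)"
  have v: "v $ i = Q $ i $ k" for i
    using Q(2) by (auto simp: matrix_vector_mult_basis column_def)
  have QQ: "Q ** transpose Q = mat 1"
    using Q(1) by (simp add: orthogonal_matrix_def)
  have "(\<Sum>l\<in>UNIV. Q$i$l * Q$j$l) = (if i = j then 1 else 0)" for i j
    using arg_cong[OF QQ, of "\<lambda>M. M $ i $ j"]
    by (simp add: matrix_matrix_mult_def transpose_def mat_def)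
  moreover have "(\<Sum>l\<in>UNIV. Q$i$l * (if l = k then 1 + s else 1) * Q$j$l)
      = (\<Sum>l\<in>UNIV. Q$i$l * Q$j$l) + s * (Q$i$k * Q$j$k)" for i j
  proof -
    have "(\<Sum>l\<in>UNIV. Q$i$l * (if l = k then 1 + s else 1) * Q$j$l)
      = (\<Sum>l\<in>UNIV. Q$i$l * Q$j$l + (if l = k then s * (Q$i$k * Q$j$k) else 0))"
      by (intro sum.cong) (auto simp: algebra_simps)
    then show ?thesis by (simp add: sum.distrib)
  qed
  ultimately have "Q ** D ** transpose Q = mat 1 + s *\<^sub>R (\<chi> i j. v$i * v$j)"
    by (simp add: vec_eq_iff matrix_matrix_mult_def transpose_def mat_def D_def v if_distrib[of "\<lambda>x. _ * x"]
        cong: if_cong)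
  then have "det (mat 1 + s *\<^sub>R (\<chi> i j. v$i * v$j)) = det Q * det D * det (transpose Q)"
    by (metis det_mul)
  also have "\<dots> = det (Q ** transpose Q) * det D"
    by (simp add: det_mul)
  also have "det D = (\<Prod>i\<in>UNIV. D$i$i)"
    by (rule det_diagonal) (simp add: D_def)
  also have "\<dots> = 1 + s"
    by (simp add: D_def prod.delta)
  finally show ?thesis by (simp add: QQ)
qed

definition averaging :: "real^'n^'n" where
  "averaging = (\<chi> i j. 1 / real CARD('n))"

lemma averaging_apply: "averaging *v (v :: real^'n) = (\<chi> i. (\<Sum>j\<in>UNIV. v$j) / real CARD('n))"
  by (simp add: averaging_def matrix_vector_mult_def sum_divide_distrib vec_eq_iff)

lemma continuous_det_char:
  fixes A :: "real^'n^'n"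
  shows "continuous_on UNIV (\<lambda>x::real. det (mat x - A))"
proof -
  have "continuous_on UNIV (\<lambda>x::real. (mat x - A) $ i $ j)" for i j
    by (cases "i = j") (auto simp: mat_def intro!: continuous_intros)
  then show ?thesis
    unfolding det_def
    by (intro continuous_on_sum continuous_on_mult continuous_on_const continuous_on_prod)
qed

text \<open>Removing the projection onto the constant vectors replaces the eigenvalue \<open>1\<close> by \<open>0\<close>. The factor
  \<open>mat 1 + 1 / (x - 1) * averaging\<close> maps \<open>mat x - A\<close> to \<open>mat x - (A - averaging)\<close> and has determinant
  \<open>x / (x - 1)\<close>. Working with characteristic polynomials rather than with eigenvectors keeps
  track of multiplicities: a second eigenvalue \<open>1\<close> of \<open>A\<close> survives the deflation.\<close>

lemma deflated_char_poly:
  fixes A :: "real^'n^'n"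
  assumes ds: "doubly_stochastic A" and "x \<noteq> 1"
  shows "(x - 1) * det (mat x - (A - averaging)) = x * det (mat x - A)"
proof -
  define v :: "real^'n" where "v = (\<chi> i. 1 / sqrt (real CARD('n)))"
  have v: "norm v = 1"
    by (simp add: v_def norm_vec_def L2_set_def power_divide)
  have J: "averaging = (\<chi> i j. v$i * v$j)"
    by (simp add: v_def averaging_def)
  have XJ: "(mat x - A) ** averaging = (x - 1) *\<^sub>R averaging"
  proof -
    have "(\<Sum>k\<in>UNIV. (mat x - A) $ i $ k) = x - 1" for i
      using ds by (simp add: doubly_stochastic_def mat_def sum_subtractf)
    then show ?thesis
      by (simp add: matrix_matrix_mult_def averaging_def vec_eq_iff flip: sum_divide_distrib)
  qed
  have "(mat x - A) ** (mat 1 + (1/(x-1)) *\<^sub>R averaging)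
      = (mat x - A) + (1/(x-1)) *\<^sub>R ((mat x - A) ** averaging)"
    by (simp add: matrix_add_ldistrib)
       (simp add: matrix_matrix_mult_def vec_eq_iff sum_divide_distrib)
  also have "\<dots> = mat x - (A - averaging)"
    using assms(2) by (simp add: XJ)
  finally have "det (mat x - (A - averaging)) = det (mat x - A) * (1 + 1/(x-1))"
    by (metis det_mul det_identity_plus_rank_one[OF v] J)
  then show ?thesis using assms(2) by (simp add: field_simps)
qed

text \<open>The first-order condition at an interior minimum of a quadratic, used for the variational
  characterization of the top eigenvector below.\<close>

lemma quadratic_nonneg_imp_linear_zero:
  fixes b c :: real
  assumes "\<And>t. 0 \<le> 2 * t * b + t\<^sup>2 * c"
  shows "b = 0"
proof (rule ccontr)
  assume "b \<noteq> 0"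
  define t where "t = - b / (\<bar>c\<bar> + 1)"
  have "2 * t * b + t\<^sup>2 * c \<le> 2 * t * b + t\<^sup>2 * (\<bar>c\<bar> + 1)"
    by (intro add_left_mono mult_left_mono) auto
  also have "\<dots> = - b\<^sup>2 / (\<bar>c\<bar> + 1)"
  proof -
    have s: "2 * (- b / s) * b + (- b / s)\<^sup>2 * s = - b\<^sup>2 / s" if "s \<noteq> 0" for s
      using that by (simp add: power2_eq_square field_simps)
    show ?thesis unfolding t_def by (rule s) linarith
  qed
  also have "\<dots> < 0"
    using \<open>b \<noteq> 0\<close> by (simp add: add_pos_nonneg)
  finally show False using assms[of t] by simp
qed

text \<open>A maximizer \<open>w\<close> of \<open>norm (B *v w)\<close> on the unit sphere satisfies \<open>B *v (B *v w) = \<mu>\<^sup>2 *\<^sub>R w\<close> by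
  the first-order condition. This factors as \<open>(B - \<mu>) (B + \<mu>) w = 0\<close>, so that \<open>w\<close> or
  \<open>B *v w + \<mu> *\<^sub>R w\<close> is an eigenvector of \<open>B\<close>.\<close>

lemma symmetric_matrix_top_eigenvector:
  fixes B :: "real^'n^'n"
  assumes sym: "transpose B = B"
  obtains \<mu> w where "w \<noteq> 0" "B *v w = \<mu> *\<^sub>R w" "\<And>v. norm (B *v v) \<le> \<bar>\<mu>\<bar> * norm v"
proof -
  have adj: "(B *v a) \<bullet> b = a \<bullet> (B *v b)" for a b
    using dot_lmul_matrix[of a B b] sym by (metis vector_transpose_matrix)
  have "continuous_on (sphere (0::real^'n) 1) (\<lambda>v. norm (B *v v))"
    by (intro continuous_intros linear_continuous_on) (simp add: matrix_vector_mul_bounded_linear)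
  moreover have "sphere (0::real^'n) 1 \<noteq> {}" by simp
  ultimately obtain w where w: "norm w = 1" and max: "\<And>v. norm v = 1 \<Longrightarrow> norm (B *v v) \<le> norm (B *v w)"
    using continuous_attains_sup[OF compact_sphere, of "0::real^'n" 1 "\<lambda>v. norm (B *v v)"]
    by (metis mem_sphere_0)
  define \<mu> where "\<mu> = norm (B *v w)"
  have bound: "norm (B *v v) \<le> \<mu> * norm v" for v
  proof (cases "v = 0")
    case False
    then have "norm (B *v ((1 / norm v) *\<^sub>R v)) \<le> \<mu>"
      unfolding \<mu>_def by (intro max) simp
    with False show ?thesis
      by (simp add: matrix_vector_mult_scaleR field_simps)
  qed simp
  define u where "u = \<mu>\<^sup>2 *\<^sub>R w - B *v (B *v w)"
  have "0 \<le> 2 * t * (\<mu>\<^sup>2 * (w \<bullet> u) - (B *v w) \<bullet> (B *v u)) + t\<^sup>2 * (\<mu>\<^sup>2 * (u \<bullet> u) - (B *v u) \<bullet> (B *v u))" for t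
  proof -
    have "(norm (B *v (w + t *\<^sub>R u)))\<^sup>2 \<le> (\<mu> * norm (w + t *\<^sub>R u))\<^sup>2"
      by (intro power_mono bound) auto
    moreover have "(B *v w) \<bullet> (B *v w) = \<mu>\<^sup>2 * (w \<bullet> w)"
      using w by (simp add: \<mu>_def power2_norm_eq_inner flip: power2_norm_eq_inner)
    ultimately show ?thesis
      unfolding power_mult_distrib power2_norm_eq_inner
      by (simp add: matrix_vector_right_distrib matrix_vector_mult_scaleR
          inner_add_left inner_add_right inner_commute algebra_simps power2_eq_square)
  qed
  then have "\<mu>\<^sup>2 * (w \<bullet> u) - (B *v w) \<bullet> (B *v u) = 0"
    by (rule quadratic_nonneg_imp_linear_zero)
  then have "u \<bullet> u = 0"
    by (metis adj inner_diff_left inner_scaleR_left u_def)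
  then have BB: "B *v (B *v w) = \<mu>\<^sup>2 *\<^sub>R w"
    by (simp add: u_def)
  show ?thesis
  proof (cases "B *v w = - (\<mu> *\<^sub>R w)")
    case True
    then show ?thesis
      using w bound by (intro that[of w "-\<mu>"]) (auto simp: \<mu>_def)
  next
    case False
    define w' where "w' = B *v w + \<mu> *\<^sub>R w"
    have "w' \<noteq> 0" using False by (simp add: w'_def eq_neg_iff_add_eq_0)
    moreover have "B *v w' = \<mu> *\<^sub>R w'"
      by (simp add: w'_def matrix_vector_right_distrib matrix_vector_mult_scaleR BB scaleR_add_right power2_eq_square)
    ultimately show ?thesis
      using bound by (intro that[of w' \<mu>]) (auto simp: \<mu>_def)
  qed
qed

lemma singular_char_matrix_iff_eigenvector:
  fixes B :: "real^'n^'n"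
  assumes "w \<noteq> 0" "B *v w = \<mu> *\<^sub>R w"
  shows "det (mat \<mu> - B) = 0"
proof -
  have "mat \<mu> *v w = \<mu> *\<^sub>R w"
    by (simp add: matrix_vector_mult_def mat_def vec_eq_iff if_distrib[of "\<lambda>t. t * _"] cong: if_cong)
  then have "(mat \<mu> - B) *v w = 0"
    by (simp add: matrix_vector_mult_diff_rdistrib assms)
  then show ?thesis
    using assms(1) by (metis invertible_det_nz inj_matrix_vector_mult injD matrix_vector_mult_0_right)
qed

lemma second_eigenvalue_nonneg: "second_eigenvalue A l \<Longrightarrow> 0 \<le> l"
  by (auto simp: second_eigenvalue_def)

text \<open>By the identity for the characteristic polynomials a nonzero eigenvalue \<open>\<mu>\<close> of the deflated
  matrix remains in the list of eigenvalues of \<open>A\<close> after one entry \<open>1\<close> has been deleted. So \<open>1\<close> and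
  \<open>\<mu>\<close> occupy two different positions of the list, and since \<open>\<bar>\<mu>\<bar> \<le> 1\<close> the second largest modulus is
  at least \<open>\<bar>\<mu>\<bar>\<close>, whether or not \<open>\<mu>\<close> itself is \<open>1\<close>.\<close>

lemma deflated_eigenvalue_le_second:
  fixes A :: "real^'n^'n"
  assumes ds: "doubly_stochastic A" and l: "second_eigenvalue A l"
    and w: "w \<noteq> 0" "(A - averaging) *v w = \<mu> *\<^sub>R w"
  shows "\<bar>\<mu>\<bar> \<le> l"
proof (cases "\<mu> = 0")
  case True
  then show ?thesis using second_eigenvalue_nonneg[OF l] by simp
next
  case False
  obtain ls where ls: "\<And>x. det (mat x - A) = (\<Prod>a\<leftarrow>ls. x - a)"
    and sorted: "sorted_wrt (\<lambda>a b. \<bar>b\<bar> \<le> \<bar>a\<bar>) ls"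
    and ldef: "l = (if 2 \<le> length ls then \<bar>ls ! 1\<bar> else 0)"
    using l unfolding second_eigenvalue_def by blast
  have cont: "continuous_on UNIV (\<lambda>x. (\<Prod>a\<leftarrow>xs. x - a))" for xs :: "real list"
    by (induction xs) (auto intro!: continuous_intros)
  have A1: "A *v 1 = 1 *\<^sub>R 1"
    using ds by (simp add: matrix_vector_mult_def doubly_stochastic_def vec_eq_iff)
  have "(1 :: real^'n) \<noteq> 0" by simp
  then have "(\<Prod>a\<leftarrow>ls. 1 - a) = 0"
    using singular_char_matrix_iff_eigenvector[OF _ A1] by (simp add: ls)
  then have one: "1 \<in> set ls"
    by (auto simp: prod_list_zero_iff)
  define rest where "rest = remove1 1 ls"
  have split: "(\<Prod>a\<leftarrow>ls. x - a) = (x - 1) * (\<Prod>a\<leftarrow>rest. x - a)" for x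
    unfolding rest_def using one by (induction ls) auto
  have eq: "det (mat x - (A - averaging)) = x * (\<Prod>a\<leftarrow>rest. x - a)" if "x \<noteq> 1" for x
  proof -
    have "(x - 1) * det (mat x - (A - averaging)) = (x - 1) * (x * (\<Prod>a\<leftarrow>rest. x - a))"
      using deflated_char_poly[OF ds that] unfolding ls split by (simp only: mult.left_commute)
    then show ?thesis using that by simp
  qed
  \<comment> \<open>the factor \<open>x - 1\<close> was cancelled; the identity extends to \<open>x = 1\<close> by continuity\<close>
  have "det (mat x - (A - averaging)) = x * (\<Prod>a\<leftarrow>rest. x - a)" for x
  proof -
    let ?h = "\<lambda>x. det (mat x - (A - averaging)) - x * (\<Prod>a\<leftarrow>rest. x - a)"
    have c: "continuous_on UNIV ?h"
      by (intro continuous_intros continuous_det_char cont)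
    have "(?h \<longlongrightarrow> ?h 1) (at 1)"
      using c unfolding continuous_on_def by blast
    moreover have "(?h \<longlongrightarrow> 0) (at 1)"
      by (rule tendsto_eventually) (auto simp: eventually_at_filter eq)
    ultimately have "?h 1 = 0"
      by (rule LIM_unique)
    then show ?thesis using eq by (cases "x = 1") auto
  qed
  then have "(\<Prod>a\<leftarrow>rest. \<mu> - a) = 0"
    using singular_char_matrix_iff_eigenvector[OF w] False by simp
  then have rest: "\<mu> \<in> set rest"
    by (auto simp: prod_list_zero_iff)
  have "\<bar>\<mu>\<bar> \<le> 1"
  proof -
    have "(\<Sum>i\<in>UNIV. ((A - averaging) *v w) $ i) = 0"
    proof -
      have "(\<Sum>i\<in>UNIV. (A *v w) $ i) = (\<Sum>j\<in>UNIV. (\<Sum>i\<in>UNIV. A$i$j) * w$j)"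
        unfolding matrix_vector_mult_def by (simp add: sum_distrib_right) (rule sum.swap)
      also have "\<dots> = (\<Sum>j\<in>UNIV. w$j)"
        using ds by (simp add: doubly_stochastic_def)
      finally show ?thesis
        by (simp add: matrix_vector_mult_diff_rdistrib sum_subtractf averaging_apply)
    qed
    then have "(\<Sum>i\<in>UNIV. w $ i) = 0"
      using False by (simp add: w(2) flip: sum_distrib_left)
    then have "A *v w = \<mu> *\<^sub>R w"
      using w(2) by (simp add: matrix_vector_mult_diff_rdistrib averaging_apply flip: zero_vec_def)
    then show ?thesis
      using doubly_stochastic_nonexpansive[OF ds, of w] w(1) by simp
  qed
  obtain i j where ij: "i < length ls" "j < length ls" "i \<noteq> j" "ls ! i = 1" "ls ! j = \<mu>"
  proof -
    obtain xs ys where xy: "ls = xs @ 1 # ys" "rest = xs @ ys"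
      using one split_list_first[OF one] unfolding rest_def by (auto simp: remove1_append)
    from rest obtain k where k: "k < length (xs @ ys)" "(xs @ ys) ! k = \<mu>"
      unfolding xy(2) by (auto simp only: in_set_conv_nth)
    show thesis
    proof (cases "k < length xs")
      case True
      then show ?thesis
        using k by (intro that[of "length xs" k]) (auto simp: xy nth_append)
    next
      case False
      then show ?thesis
        using k by (intro that[of "length xs" "Suc k"]) (auto simp: xy nth_append nth_Cons' Suc_diff_le)
    qed
  qed
  define k where "k = max i j"
  have k: "1 \<le> k" "k < length ls" "\<bar>\<mu>\<bar> \<le> \<bar>ls ! k\<bar>"
    using ij \<open>\<bar>\<mu>\<bar> \<le> 1\<close> unfolding k_def max_def by auto
  have "\<bar>ls ! k\<bar> \<le> \<bar>ls ! 1\<bar>"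
    using sorted_wrt_nth_less[OF sorted, of 1 k] k by (cases "k = 1") auto
  then show ?thesis using k ldef by auto
qed

text \<open>On vectors of zero sum \<open>A\<close> agrees with the deflated matrix, whose norm is the modulus of an
  eigenvalue.\<close>

lemma gossip_contraction:
  fixes A :: "real^'n^'n"
  assumes sym: "transpose A = A" and ds: "doubly_stochastic A" and l: "second_eigenvalue A l"
    and v: "(\<Sum>i\<in>UNIV. v $ i) = 0"
  shows "norm (A *v v) \<le> l * norm v"
proof -
  have "transpose (A - averaging) = A - averaging"
    using sym by (simp add: transpose_def averaging_def vec_eq_iff)
  then obtain \<mu> w where w: "w \<noteq> 0" "(A - averaging) *v w = \<mu> *\<^sub>R w"
    and bound: "\<And>v. norm ((A - averaging) *v v) \<le> \<bar>\<mu>\<bar> * norm v"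
    using symmetric_matrix_top_eigenvector[of "A - averaging"] by blast
  have "A *v v = (A - averaging) *v v"
    using v by (simp add: matrix_vector_mult_diff_rdistrib averaging_apply flip: zero_vec_def)
  also have "norm \<dots> \<le> \<bar>\<mu>\<bar> * norm v" by (rule bound)
  also have "\<dots> \<le> l * norm v"
    by (intro mult_right_mono deflated_eigenvalue_le_second[OF ds l w]) simp
  finally show ?thesis .
qed

text \<open>The scalar contraction, applied to each coordinate of the agents' states.\<close>

lemma gossip_contraction_vectors:
  fixes A :: "real^'n^'n" and v :: "'n \<Rightarrow> real^'d"
  assumes A: "transpose A = A" "doubly_stochastic A" "second_eigenvalue A l"
    and v: "(\<Sum>i\<in>UNIV. v i) = 0"
  shows "L2_set (\<lambda>i. norm (\<Sum>j\<in>UNIV. A$i$j *\<^sub>R v j)) UNIV \<le> l * L2_set (\<lambda>i. norm (v i)) UNIV"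
proof -
  have comp: "(\<Sum>i\<in>UNIV. (norm (u i))\<^sup>2) = (\<Sum>k\<in>UNIV. (norm (\<chi> i. u i $ k))\<^sup>2)" for u :: "'n \<Rightarrow> real^'d"
    unfolding norm_vec_squared by (subst sum.swap) simp
  have l0: "0 \<le> l" by (rule second_eigenvalue_nonneg) fact
  have "(\<Sum>i\<in>UNIV. (norm (\<Sum>j\<in>UNIV. A$i$j *\<^sub>R v j))\<^sup>2)
      = (\<Sum>k\<in>UNIV. (norm (A *v (\<chi> j. v j $ k)))\<^sup>2)"
    unfolding comp by (simp add: matrix_vector_mult_def)
  also have "\<dots> \<le> (\<Sum>k\<in>UNIV. (l * norm (\<chi> j. v j $ k))\<^sup>2)"
  proof (intro sum_mono power_mono gossip_contraction[OF A])
    fix k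
    show "(\<Sum>i\<in>UNIV. (\<chi> j. v j $ k) $ i) = 0"
      using arg_cong[OF v, of "\<lambda>x. x $ k"] by simp
  qed simp
  also have "\<dots> = l\<^sup>2 * (\<Sum>i\<in>UNIV. (norm (v i))\<^sup>2)"
    unfolding comp by (simp add: power_mult_distrib sum_distrib_left)
  finally have "(L2_set (\<lambda>i. norm (\<Sum>j\<in>UNIV. A$i$j *\<^sub>R v j)) UNIV)\<^sup>2 \<le> (l * L2_set (\<lambda>i. norm (v i)) UNIV)\<^sup>2"
    by (simp add: L2_set_def sum_nonneg power_mult_distrib)
  then show ?thesis
    using l0 by (simp add: power2_le_iff_abs_le L2_set_nonneg)
qed

text \<open>The deviations from the average contract by \<open>l\<close> in each step and are perturbed by at most
  \<open>sqrt CARD('n) * D\<close> in the Euclidean norm over all agents; centring the perturbations does not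
  increase their norm. So each agent stays within the sum of a geometric series of the average.\<close>

lemma gossip_consensus:
  fixes A :: "real^'n^'n" and s :: "nat \<Rightarrow> 'n \<Rightarrow> real^'d"
  assumes A: "transpose A = A" "doubly_stochastic A" "second_eigenvalue A l" and "l < 1"
    and start: "\<And>i. s 0 i = c"
    and step: "\<And>m i. m < n \<Longrightarrow> norm (s (Suc m) i - (\<Sum>j\<in>UNIV. A$i$j *\<^sub>R s m j)) \<le> D"
    and "0 \<le> D" and "m \<le> n"
  shows "norm (s m i - s m j) \<le> 2 * (sqrt (real CARD('n)) * D / (1 - l))"
proof -
  define avg where "avg m = (1 / real CARD('n)) *\<^sub>R (\<Sum>i\<in>UNIV. s m i)" for m
  define e where "e m i = s m i - avg m" for m i
  define B where "B = sqrt (real CARD('n)) * D / (1 - l)"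
  have l0: "0 \<le> l" by (rule second_eigenvalue_nonneg) fact
  have rows: "(\<Sum>j\<in>UNIV. A$i$j) = 1" and cols: "(\<Sum>j\<in>UNIV. A$j$i) = 1" for i
    using A(2) by (auto simp: doubly_stochastic_def)
  have e0: "(\<Sum>i\<in>UNIV. e m i) = 0" for m
    by (simp add: e_def avg_def sum_subtractf sum_constant_scaleR del: sum_constant)
  have centre: "L2_set (\<lambda>i. norm (u i - (1 / real CARD('n)) *\<^sub>R (\<Sum>j\<in>UNIV. u j))) UNIV
      \<le> L2_set (\<lambda>i. norm (u i)) UNIV" for u :: "'n \<Rightarrow> real^'d"
  proof -
    define m where "m = (1 / real CARD('n)) *\<^sub>R (\<Sum>j\<in>UNIV. u j)"
    have "(\<Sum>i\<in>UNIV. (norm (u i - m))\<^sup>2)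
        = (\<Sum>i\<in>UNIV. (norm (u i))\<^sup>2 - 2 * (u i \<bullet> m) + (norm m)\<^sup>2)"
      by (intro sum.cong refl)
         (simp add: power2_norm_eq_inner inner_diff_left inner_diff_right inner_commute)
    also have "\<dots> = (\<Sum>i\<in>UNIV. (norm (u i))\<^sup>2) - 2 * ((\<Sum>i\<in>UNIV. u i) \<bullet> m) + real CARD('n) * (norm m)\<^sup>2"
      by (simp add: sum.distrib sum_subtractf inner_sum_left sum_distrib_left)
    also have "(\<Sum>i\<in>UNIV. u i) = real CARD('n) *\<^sub>R m"
      by (simp add: m_def)
    finally have "(\<Sum>i\<in>UNIV. (norm (u i - m))\<^sup>2) \<le> (\<Sum>i\<in>UNIV. (norm (u i))\<^sup>2)"
      by (simp add: power2_norm_eq_inner)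
    then show ?thesis
      unfolding L2_set_def m_def by (rule real_sqrt_le_mono)
  qed
  have "L2_set (\<lambda>i. norm (e m i)) UNIV \<le> B" using \<open>m \<le> n\<close>
  proof (induction m)
    case 0
    have "e 0 i = 0" for i
      by (simp add: e_def avg_def start sum_constant_scaleR del: sum_constant)
    then show ?case
      using \<open>l < 1\<close> \<open>0 \<le> D\<close> by (simp add: B_def L2_set_def)
  next
    case (Suc m)
    define d where "d i = s (Suc m) i - (\<Sum>j\<in>UNIV. A$i$j *\<^sub>R s m j)" for i
    have dn: "norm (d i) \<le> D" for i
      using step Suc.prems by (simp add: d_def)
    have sum_gossip: "(\<Sum>i\<in>UNIV. \<Sum>j\<in>UNIV. A$i$j *\<^sub>R s m j) = (\<Sum>j\<in>UNIV. s m j)"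
      by (subst sum.swap) (simp add: scaleR_left.sum[symmetric] cols)
    have avg: "avg (Suc m) = avg m + (1 / real CARD('n)) *\<^sub>R (\<Sum>i\<in>UNIV. d i)"
      by (simp add: avg_def d_def sum_subtractf sum_gossip scaleR_diff_right)
    have "e (Suc m) i = (\<Sum>j\<in>UNIV. A$i$j *\<^sub>R e m j)
        + (d i - (1 / real CARD('n)) *\<^sub>R (\<Sum>j\<in>UNIV. d j))" for i
    proof -
      have "(\<Sum>j\<in>UNIV. A$i$j *\<^sub>R e m j) = (\<Sum>j\<in>UNIV. A$i$j *\<^sub>R s m j) - avg m"
        by (simp add: e_def scaleR_diff_right sum_subtractf scaleR_left.sum[symmetric] rows)
      then show ?thesis
        by (simp add: e_def[of "Suc m"] avg d_def[of i])
    qed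
    then have "L2_set (\<lambda>i. norm (e (Suc m) i)) UNIV
        \<le> L2_set (\<lambda>i. norm (\<Sum>j\<in>UNIV. A$i$j *\<^sub>R e m j)
               + norm (d i - (1 / real CARD('n)) *\<^sub>R (\<Sum>j\<in>UNIV. d j))) UNIV"
      by (intro L2_set_mono) (auto intro: norm_triangle_ineq)
    also have "\<dots> \<le> L2_set (\<lambda>i. norm (\<Sum>j\<in>UNIV. A$i$j *\<^sub>R e m j)) UNIV
        + L2_set (\<lambda>i. norm (d i - (1 / real CARD('n)) *\<^sub>R (\<Sum>j\<in>UNIV. d j))) UNIV"
      by (rule L2_set_triangle_ineq)
    also have "\<dots> \<le> l * B + sqrt (real CARD('n)) * D"
    proof (rule add_mono)
      show "L2_set (\<lambda>i. norm (\<Sum>j\<in>UNIV. A$i$j *\<^sub>R e m j)) UNIV \<le> l * B"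
        using gossip_contraction_vectors[OF A e0, of m] Suc l0
        by (meson Suc_leD mult_left_mono order_trans)
      have "L2_set (\<lambda>i. norm (d i)) UNIV \<le> L2_set (\<lambda>i::'n. D) UNIV"
        by (intro L2_set_mono dn) simp
      also have "\<dots> = sqrt (real CARD('n)) * D"
        using \<open>0 \<le> D\<close> by (simp add: L2_set_def real_sqrt_mult)
      finally show "L2_set (\<lambda>i. norm (d i - (1 / real CARD('n)) *\<^sub>R (\<Sum>j\<in>UNIV. d j))) UNIV
          \<le> sqrt (real CARD('n)) * D"
        using centre[of d] by linarith
    qed
    also have "\<dots> = B"
      using \<open>l < 1\<close> by (simp add: B_def field_simps)
    finally show ?case .
  qed
  then have "norm (e m i) \<le> B" for i
    using member_le_L2_set[of UNIV i "\<lambda>i. norm (e m i)"] by simp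
  from this[of i] this[of j] have "norm (e m i - e m j) \<le> 2 * B"
    using norm_triangle_ineq4[of "e m i" "e m j"] by linarith
  then show ?thesis by (simp add: e_def B_def)
qed

section \<open>Linear upper bounds for the two cases\<close>

lemma cube_cbox: "{0..1::real^'d} = cbox 0 1"
  by (rule interval_cbox_cart)

lemma mem_cube: "x \<in> {0..1::real^'d} \<longleftrightarrow> (\<forall>k. 0 \<le> x$k \<and> x$k \<le> 1)"
  by (auto simp: less_eq_vec_def)

lemma clamp_cube: "x \<in> {0..1::real^'d} \<Longrightarrow> clamp 0 1 x = x"
  by (simp add: cube_cbox)

lemma has_derivative_grad:
  fixes f :: "real^'d \<Rightarrow> real"
  assumes "f differentiable_on {0..1}" "x \<in> {0..1}"
  shows "(f has_derivative (\<lambda>h. grad f x \<bullet> h)) (at x within {0..1})"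
proof -
  let ?D = "frechet_derivative f (at x within {0..1})"
  have D: "(f has_derivative ?D) (at x within {0..1})"
    using assms by (simp add: differentiable_on_def frechet_derivative_works)
  then have lin: "linear ?D" by (rule has_derivative_linear)
  have "?D h = grad f x \<bullet> h" for h
  proof -
    have "?D h = ?D (\<Sum>k\<in>UNIV. (h$k) *\<^sub>R axis k 1)"
      by (simp add: basis_expansion flip: scalar_mult_eq_scaleR)
    also have "\<dots> = (\<Sum>k\<in>UNIV. (h$k) *\<^sub>R ?D (axis k 1))"
      by (simp add: linear_sum[OF lin] linear_cmul[OF lin])
    also have "\<dots> = grad f x \<bullet> h"
      by (simp add: grad_def inner_vec_def mult.commute)
    finally show ?thesis .
  qed
  then have "?D = (\<lambda>h. grad f x \<bullet> h)" by blast
  with D show ?thesis by simp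
qed

lemma segment_in_cube:
  fixes p v :: "real^'d"
  assumes "p \<in> {0..1}" "p + v \<in> {0..1}" "z \<in> {0..1::real}"
  shows "p + z *\<^sub>R v \<in> {0..1}"
proof -
  have "(1 - z) *\<^sub>R p + z *\<^sub>R (p + v) \<in> {0..1}"
    using assms convex_box(1)[of "0::real^'d" 1] unfolding cube_cbox
    by (intro convexD) auto
  then show ?thesis by (simp add: algebra_simps)
qed

lemma has_derivative_along_segment:
  fixes f :: "real^'d \<Rightarrow> real"
  assumes f: "f differentiable_on {0..1}" and p: "p \<in> {0..1}" "p + v \<in> {0..1}" and z: "z \<in> {0..1::real}"
  shows "((\<lambda>z. f (p + z *\<^sub>R v)) has_real_derivative (grad f (p + z *\<^sub>R v) \<bullet> v)) (at z within {0..1})"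
proof -
  have "((\<lambda>z. p + z *\<^sub>R v) has_derivative (\<lambda>h. h *\<^sub>R v)) (at z within {0..1})"
    by (auto intro!: derivative_eq_intros)
  moreover have "(f has_derivative (\<lambda>h. grad f (p + z *\<^sub>R v) \<bullet> h))
      (at (p + z *\<^sub>R v) within (\<lambda>z. p + z *\<^sub>R v) ` {0..1})"
    by (intro has_derivative_subset[OF has_derivative_grad[OF f]] image_subsetI segment_in_cube[OF p] z)
  ultimately have "((\<lambda>z. f (p + z *\<^sub>R v)) has_derivative (\<lambda>h. grad f (p + z *\<^sub>R v) \<bullet> (h *\<^sub>R v)))
      (at z within {0..1})"
    by (rule has_derivative_in_compose)
  then show ?thesis
    by (simp add: has_field_derivative_def) (simp add: mult_commute_abs mult.commute)
qed

text \<open>The derivative within the cube is one-sided at the boundary, so the sign is read off on the segment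
  from \<open>p - v\<close> to \<open>p\<close>, which stays in the cube.\<close>

lemma grad_nonneg_if_mono:
  fixes f :: "real^'d \<Rightarrow> real"
  assumes f: "f differentiable_on {0..1}" and mono: "mono_on {0..1} f"
    and p: "p \<in> {0..1}" "p - v \<in> {0..1}" and v: "0 \<le> v"
  shows "0 \<le> grad f p \<bullet> v"
proof (rule ccontr)
  assume neg: "\<not> 0 \<le> grad f p \<bullet> v"
  have p': "(p - v) + v \<in> {0..1}" using p(1) by simp
  have "((\<lambda>z. f ((p - v) + z *\<^sub>R v)) has_real_derivative (grad f p \<bullet> v)) (at 1 within {0..1})"
    using has_derivative_along_segment[OF f p(2) p', of 1] by simp
  from has_real_derivative_neg_dec_left[OF this] neg obtain d where d: "d > 0"
    and dec: "\<And>h. h > 0 \<Longrightarrow> 1 - h \<in> {0..1} \<Longrightarrow> h < d \<Longrightarrow> f p < f ((p - v) + (1 - h) *\<^sub>R v)"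
    by auto
  \<comment> \<open>a step back that is short enough for the decrease and stays on the segment\<close>
  define h where "h = min 1 (d / 2)"
  have h: "0 < h" "h \<le> 1" "h < d" using d by (auto simp: h_def)
  have "f p < f ((p - v) + (1 - h) *\<^sub>R v)"
    using h by (intro dec) auto
  moreover have "f ((p - v) + (1 - h) *\<^sub>R v) \<le> f p"
  proof (rule mono_onD[OF mono])
    show "(p - v) + (1 - h) *\<^sub>R v \<in> {0..1}"
      using h by (intro segment_in_cube p p') auto
    show "(p - v) + (1 - h) *\<^sub>R v \<le> p"
      using h v by (auto simp: less_eq_vec_def algebra_simps)
  qed (use p in auto)
  ultimately show False by simp
qed

text \<open>Write \<open>u\<close> as the meet of \<open>u\<close> and \<open>p\<close> plus the step from \<open>p\<close> to the join. The meet contributes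
  nonnegatively because \<open>f\<close> is monotone, and up-concavity applies to the step to the join.\<close>

lemma monotone_gradient_bound:
  fixes f :: "real^'d \<Rightarrow> real"
  assumes f: "f differentiable_on {0..1}" and mono: "mono_on {0..1} f"
    and conc: "weakly_up_concave \<gamma> f" and \<gamma>: "0 < \<gamma>"
    and p: "p \<in> {0..1}" and u: "u \<in> {0..1}"
  shows "\<gamma> * (f u - f p) \<le> grad f p \<bullet> u"
proof -
  define r where "r = (\<chi> k. max (u$k) (p$k))"
  define v where "v = (\<chi> k. min (u$k) (p$k))"
  have r: "r \<in> {0..1}" "p \<le> r" "u \<le> r"
    using p u by (auto simp: mem_cube r_def less_eq_vec_def max_def)
  have v: "0 \<le> v" "p - v \<in> {0..1}"
    using p u unfolding mem_cube by (auto simp: v_def less_eq_vec_def min_def) (smt (verit))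
  have uv: "u = v + (r - p)"
    by (simp add: vec_eq_iff v_def r_def max_def min_def)
  have "\<gamma> * (f u - f p) \<le> \<gamma> * (f r - f p)"
    using mono_onD[OF mono u r(1) r(3)] \<gamma> by simp
  also have "\<dots> \<le> grad f p \<bullet> (r - p)"
    using conc p r \<gamma> unfolding weakly_up_concave_def by (auto simp: field_simps)
  also have "\<dots> \<le> grad f p \<bullet> v + grad f p \<bullet> (r - p)"
    using grad_nonneg_if_mono[OF f mono p v(2) v(1)] by simp
  also have "\<dots> = grad f p \<bullet> u"
    by (subst uv) (simp add: inner_add_right)
  finally show ?thesis .
qed

text \<open>Without monotonicity, passing from \<open>u\<close> to the join with \<open>p\<close> can lose value, but only a fraction
  \<open>s\<close> of it: the join lies on the segment from \<open>u\<close> to a point \<open>q\<close> that is still in the cube, with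
  weight \<open>s\<close> at \<open>q\<close>, and \<open>f\<close> is concave on this nonnegative direction and nonnegative at \<open>q\<close>.\<close>

lemma join_value_bound:
  fixes f :: "real^'d \<Rightarrow> real"
  assumes conc: "up_concave f" and nonneg: "\<And>x. x \<in> {0..1} \<Longrightarrow> 0 \<le> f x"
    and p: "p \<in> {0..1}" and u: "u \<in> {0..1}"
    and s: "\<And>k. p$k \<le> s" "0 \<le> s" "s \<le> 1"
  shows "(1 - s) * f u \<le> f (\<chi> k. max (u$k) (p$k))"
proof (cases "s = 0")
  case True
  have "(\<chi> k. max (u$k) (p$k)) = u"
    using s(1) u True unfolding mem_cube by (simp add: vec_eq_iff max_def) (meson order_antisym order_trans)
  then show ?thesis using True by simp
next
  case False
  then have s0: "0 < s" using s by simp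
  define r where "r = (\<chi> k. max (u$k) (p$k))"
  \<comment> \<open>\<open>q\<close> stays below \<open>1\<close> because \<open>s\<close> dominates the coordinates of \<open>p\<close>\<close>
  define q where "q = u + (1/s) *\<^sub>R (r - u)"
  have r: "r \<in> {0..1}" "u \<le> r"
    using p u by (auto simp: mem_cube r_def less_eq_vec_def max_def)
  have "q$k \<le> 1 \<and> r$k \<le> q$k" for k
  proof (cases "u$k \<ge> p$k")
    case True
    then show ?thesis using u unfolding mem_cube by (simp add: q_def r_def)
  next
    case False
    then have rk: "r$k = p$k" by (simp add: r_def)
    have "u$k * s + (p$k - u$k) \<le> s"
    proof -
      have "0 \<le> u$k * (1 - s)" using u s unfolding mem_cube by simp
      then show ?thesis using s(1)[of k] by (simp add: algebra_simps)
    qed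
    moreover have "(p$k - u$k) * s \<le> p$k - u$k"
      using False s s0 by (intro mult_left_le) auto
    moreover have "q$k = (u$k * s + (p$k - u$k)) / s"
      using s0 by (simp add: q_def rk field_simps)
    ultimately show ?thesis using s0 by (simp add: rk pos_le_divide_eq pos_divide_le_eq algebra_simps)
  qed
  then have q: "q \<in> {0..1}" "r \<le> q"
    using r unfolding mem_cube less_eq_vec_def by (auto intro: order_trans)
  have "f q - f r \<le> grad f r \<bullet> (q - r)" and "grad f r \<bullet> (r - u) \<le> f r - f u"
    using conc q r u unfolding weakly_up_concave_def by auto
  moreover have "q - r = (1/s - 1) *\<^sub>R (r - u)"
    by (simp add: q_def algebra_simps)
  moreover have "0 \<le> 1/s - 1" using s s0 by simp
  ultimately have "f q - f r \<le> (1/s - 1) * (f r - f u)"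
    by (smt (verit) inner_scaleR_right mult_left_mono)
  then have "- f r \<le> (1/s - 1) * (f r - f u)"
    using nonneg[OF q(1)] by simp
  then have "s * - f r \<le> s * ((1/s - 1) * (f r - f u))"
    using s0 by (intro mult_left_mono) auto
  also have "s * ((1/s - 1) * (f r - f u)) = (1 - s) * (f r - f u)"
    using s0 by (simp add: algebra_simps)
  finally have "(1 - s) * f u \<le> f r"
    by (simp add: algebra_simps)
  then show ?thesis by (simp add: r_def)
qed

text \<open>Up-concavity is applied upwards from \<open>p\<close> to the join and downwards to the meet; the two steps
  add up to \<open>u - p\<close>.\<close>

lemma nonmonotone_gradient_bound:
  fixes f :: "real^'d \<Rightarrow> real"
  assumes conc: "up_concave f" and nonneg: "\<And>x. x \<in> {0..1} \<Longrightarrow> 0 \<le> f x"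
    and p: "p \<in> {0..1}" and u: "u \<in> {0..1}"
    and s: "\<And>k. p$k \<le> s" "0 \<le> s" "s \<le> 1"
  shows "(1 - s) * f u - 2 * f p \<le> grad f p \<bullet> (u - p)"
proof -
  define r where "r = (\<chi> k. max (u$k) (p$k))"
  define v where "v = (\<chi> k. min (u$k) (p$k))"
  have r: "r \<in> {0..1}" "p \<le> r" and v: "v \<in> {0..1}" "v \<le> p"
    using p u by (auto simp: mem_cube r_def v_def less_eq_vec_def max_def min_def)
  have "f r - f p \<le> grad f p \<bullet> (r - p)" and "grad f p \<bullet> (p - v) \<le> f p - f v"
    using conc p r v unfolding weakly_up_concave_def by auto
  moreover have "u - p = (r - p) - (p - v)"
    by (simp add: vec_eq_iff v_def r_def max_def min_def)
  moreover have "(1 - s) * f u \<le> f r"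
    unfolding r_def by (rule join_value_bound[OF assms])
  moreover have "0 \<le> f v" using v by (intro nonneg)
  ultimately have "(1 - s) * f u - 2 * f p \<le> grad f p \<bullet> (r - p) - grad f p \<bullet> (p - v)"
    by linarith
  then show ?thesis by (simp only: \<open>u - p = (r - p) - (p - v)\<close> inner_diff_right)
qed

lemma z_law_alt: "z_law \<sigma> = density lborel (\<lambda>s. ennreal (indicator {0..1} s * z_density \<sigma> s))"
  unfolding z_law_def by (intro arg_cong[of _ _ "density lborel"] ext) (auto split: split_indicator)

text \<open>The total mass is computed from an antiderivative \<open>\<Phi>\<close> of the density.\<close>

lemma prob_space_z_law:
  assumes cont: "continuous_on {0..1} (z_density \<sigma>)"
    and nonneg: "\<And>z. z \<in> {0..1} \<Longrightarrow> 0 \<le> z_density \<sigma> z"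
    and deriv: "\<And>z. z \<in> {0..1} \<Longrightarrow> (\<Phi> has_real_derivative z_density \<sigma> z) (at z within {0..1})"
    and mass: "\<Phi> 1 - \<Phi> 0 = 1"
  shows "prob_space (z_law \<sigma>)"
proof -
  have "has_bochner_integral lborel (\<lambda>z. indicator {0..1} z *\<^sub>R z_density \<sigma> z) (\<Phi> 1 - \<Phi> 0)"
    using cont deriv by (intro has_bochner_integral_FTC_Icc) (auto simp: has_real_derivative_iff_has_vector_derivative)
  then have "(\<integral>\<^sup>+z. ennreal (indicator {0..1} z * z_density \<sigma> z) \<partial>lborel) = 1"
    using nonneg mass
    by (subst nn_integral_eq_integral) (auto simp: has_bochner_integral_iff split: split_indicator)
  moreover have "(\<lambda>z. indicator {0..1} z * z_density \<sigma> z) \<in> borel_measurable borel"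
    using borel_measurable_continuous_on_indicator[OF _ cont] by simp
  ultimately have "emeasure (z_law \<sigma>) (space (z_law \<sigma>)) = 1"
    by (simp add: z_law_alt emeasure_density cong: nn_integral_cong)
  then show ?thesis by (rule prob_spaceI)
qed

text \<open>The bridge from pointwise gradient inequalities to the averaged one: the integrand is compared with
  an exact derivative \<open>\<psi>\<close>, whose integral is the increment of \<open>\<Psi>\<close>.\<close>

lemma z_law_integral_ge:
  assumes cont: "continuous_on {0..1} (z_density \<sigma>)"
    and nonneg: "\<And>z. z \<in> {0..1} \<Longrightarrow> 0 \<le> z_density \<sigma> z"
    and \<phi>: "continuous_on UNIV \<phi>"
    and deriv: "\<And>z. z \<in> {0..1} \<Longrightarrow> (\<Psi> has_real_derivative \<psi> z) (at z within {0..1})"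
    and \<psi>: "continuous_on {0..1} \<psi>"
    and le: "\<And>z. z \<in> {0..1} \<Longrightarrow> \<psi> z \<le> z_density \<sigma> z * \<phi> z"
  shows "\<Psi> 1 - \<Psi> 0 \<le> (\<integral>z. \<phi> z \<partial>z_law \<sigma>)"
proof -
  have FTC: "has_bochner_integral lborel (\<lambda>z. indicator {0..1} z *\<^sub>R \<psi> z) (\<Psi> 1 - \<Psi> 0)"
    using deriv \<psi> by (intro has_bochner_integral_FTC_Icc) (auto simp: has_real_derivative_iff_has_vector_derivative)
  have meas: "(\<lambda>z. indicator {0..1} z * z_density \<sigma> z) \<in> borel_measurable borel"
    using borel_measurable_continuous_on_indicator[OF _ cont] by simp
  have "continuous_on {0..1} (\<lambda>z. z_density \<sigma> z * \<phi> z)"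
    using cont continuous_on_subset[OF \<phi>] by (intro continuous_intros) auto
  then have int: "integrable lborel (\<lambda>z. indicator {0..1} z *\<^sub>R (z_density \<sigma> z * \<phi> z))"
    by (intro borel_integrable_compact) auto
  have "(\<integral>z. \<phi> z \<partial>z_law \<sigma>) = (\<integral>z. (indicator {0..1} z * z_density \<sigma> z) *\<^sub>R \<phi> z \<partial>lborel)"
    unfolding z_law_alt using meas borel_measurable_continuous_onI[OF \<phi>] nonneg
    by (intro integral_density) (auto split: split_indicator)
  also have "\<dots> = (\<integral>z. indicator {0..1} z *\<^sub>R (z_density \<sigma> z * \<phi> z) \<partial>lborel)"
    by (simp add: mult.assoc)
  also have "\<dots> \<ge> (\<integral>z. indicator {0..1} z *\<^sub>R \<psi> z \<partial>lborel)"
    using FTC int le by (intro integral_mono) (auto simp: has_bochner_integral_iff split: split_indicator)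
  finally show ?thesis using FTC by (simp add: has_bochner_integral_iff)
qed

text \<open>The gradient is controlled on the cube only. Composing with the projection onto the cube gives a
  continuous function on the whole space with the same values at all query points, which settles
  measurability.\<close>

lemma continuous_clamped_grad:
  assumes "continuous_on {0..1} (grad f)"
  shows "continuous_on S (\<lambda>p. grad f (clamp 0 1 p))"
  using assms unfolding cube_cbox by (rule clamp_continuous_on)

lemma continuous_grad_segment:
  fixes f :: "real^'d \<Rightarrow> real"
  assumes "continuous_on {0..1} (grad f)" and p: "p \<in> {0..1}" "p + v \<in> {0..1}"
  shows "continuous_on {0..1::real} (\<lambda>z. grad f (p + z *\<^sub>R v))"
  by (rule continuous_on_compose2[OF assms(1)], intro continuous_intros)
     (use segment_in_cube[OF p] in blast)

lemma continuous_differentiable_segment: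
  fixes f :: "real^'d \<Rightarrow> real"
  assumes "f differentiable_on {0..1}" and p: "p \<in> {0..1}" "p + v \<in> {0..1}"
  shows "continuous_on {0..1::real} (\<lambda>z. f (p + z *\<^sub>R v))"
  by (rule continuous_on_compose2[OF differentiable_imp_continuous_on[OF assms(1)]], intro continuous_intros)
     (use segment_in_cube[OF p] in blast)

lemma monotone_scheme_simps [simp]:
  "ratio (monotone_scheme \<gamma>) = 1 - exp (-\<gamma>)"
  "out_map (monotone_scheme \<gamma>) x = x"
  "query_map (monotone_scheme \<gamma>) x z = z *\<^sub>R x"
  "z_density (monotone_scheme \<gamma>) z = \<gamma> * exp (\<gamma> * (z - 1)) / (1 - exp (-\<gamma>))"
  by (simp_all add: monotone_scheme_def)

lemma nonmonotone_scheme_simps [simp]: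
  "ratio (nonmonotone_scheme l) = (1 - infnorm l) / 4"
  "out_map (nonmonotone_scheme l) x = (1/2) *\<^sub>R (x + l)"
  "query_map (nonmonotone_scheme l) x z = (z/2) *\<^sub>R (x - l) + l"
  "z_density (nonmonotone_scheme l) z = 1 / (3 * (1 - z/2)^3)"
  by (simp_all add: nonmonotone_scheme_def)

lemma monotone_z_density:
  fixes \<gamma> :: real
  assumes "0 < \<gamma>"
  shows "continuous_on {0..1} (z_density (monotone_scheme \<gamma> :: 'd::finite scheme))"
    and "0 \<le> z_density (monotone_scheme \<gamma> :: 'd scheme) z"
    and "prob_space (z_law (monotone_scheme \<gamma> :: 'd scheme))"
proof -
  have pos: "0 < 1 - exp (-\<gamma>)" using assms by simp
  have fn: "z_density (monotone_scheme \<gamma> :: 'd scheme) = (\<lambda>z. \<gamma> * exp (\<gamma> * (z - 1)) / (1 - exp (-\<gamma>)))"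
    by (rule ext) simp
  show c: "continuous_on {0..1} (z_density (monotone_scheme \<gamma> :: 'd::finite scheme))"
    unfolding fn by (intro continuous_intros) (use pos in auto)
  show nn: "0 \<le> z_density (monotone_scheme \<gamma> :: 'd scheme) z" for z
    using pos assms by simp
  show "prob_space (z_law (monotone_scheme \<gamma> :: 'd scheme))"
  proof (rule prob_space_z_law[OF c nn])
    show "((\<lambda>z. exp (\<gamma> * (z - 1)) / (1 - exp (-\<gamma>))) has_real_derivative
        z_density (monotone_scheme \<gamma> :: 'd scheme) z) (at z within {0..1})" for z
      using pos by (auto intro!: derivative_eq_intros)
    show "exp (\<gamma> * (1 - 1)) / (1 - exp (-\<gamma>)) - exp (\<gamma> * (0 - 1)) / (1 - exp (-\<gamma>)) = 1"
      using pos by (simp add: divide_simps)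
  qed
qed

lemma half_pos: "z \<in> {0..1::real} \<Longrightarrow> 0 < 1 - z/2" by simp

lemma nonmonotone_z_density:
  shows "continuous_on {0..1} (z_density (nonmonotone_scheme l))"
    and "z \<in> {0..1} \<Longrightarrow> 0 \<le> z_density (nonmonotone_scheme l) z"
    and "prob_space (z_law (nonmonotone_scheme l))"
proof -
  have fn: "z_density (nonmonotone_scheme l) = (\<lambda>z. 1 / (3 * (1 - z/2)^3))"
    by (rule ext) simp
  show c: "continuous_on {0..1} (z_density (nonmonotone_scheme l))"
    unfolding fn by (intro continuous_intros) auto
  show nn: "0 \<le> z_density (nonmonotone_scheme l) z" if "z \<in> {0..1}" for z
    using that by simp
  show "prob_space (z_law (nonmonotone_scheme l))"
  proof (rule prob_space_z_law[OF c nn])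
    show "((\<lambda>z. 1 / (3 * (1 - z/2)^2)) has_real_derivative
        z_density (nonmonotone_scheme l) z) (at z within {0..1})" if "z \<in> {0..1}" for z
      using half_pos[OF that]
      by (auto intro!: derivative_eq_intros simp: divide_simps power2_eq_square power3_eq_cube)
         (simp add: algebra_simps)
  qed (auto simp: power2_eq_square)
qed

text \<open>Along the segment \<open>z *\<^sub>R x\<close> the gradient bound reads
  \<open>\<gamma> * (f u - f p) - d \<le> \<nabla>f p \<bullet> (u - x)\<close>, where \<open>d\<close> is the derivative of \<open>f\<close> along the segment. The
  integrating factor of the left-hand side is \<open>exp (\<gamma> * z)\<close>, which is the density up to a constant.\<close>

lemma monotone_scheme_linearizable:
  fixes f :: "real^'d \<Rightarrow> real"
  assumes f: "f differentiable_on {0..1}" "continuous_on {0..1} (grad f)"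
    and nonneg: "0 \<le> f 0" and mono: "mono_on {0..1} f"
    and conc: "weakly_up_concave \<gamma> f" and \<gamma>: "0 < \<gamma>"
    and x: "x \<in> {0..1}" and u: "u \<in> {0..1}"
  defines "\<sigma> \<equiv> monotone_scheme \<gamma>"
  shows "ratio \<sigma> * f u - f (out_map \<sigma> x)
    \<le> (1 - exp (-\<gamma>)) / \<gamma> * (\<integral>z. grad f (clamp 0 1 (query_map \<sigma> x z)) \<bullet> (u - x) \<partial>z_law \<sigma>)"
proof -
  define c where "c = \<gamma> / (1 - exp (-\<gamma>))"
  have c: "0 < c" using \<gamma> by (simp add: c_def)
  define \<phi> where "\<phi> z = grad f (clamp 0 1 (query_map \<sigma> x z)) \<bullet> (u - x)" for z
  define \<Psi> where "\<Psi> z = c * (exp (\<gamma> * (z - 1)) * (f u - f (0 + z *\<^sub>R x)))" for z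
  define \<psi> where "\<psi> z = c * (\<gamma> * exp (\<gamma> * (z - 1)) * (f u - f (0 + z *\<^sub>R x))
      - exp (\<gamma> * (z - 1)) * (grad f (0 + z *\<^sub>R x) \<bullet> x))" for z
  have seg: "(0::real^'d) \<in> {0..1}" "0 + x \<in> {0..1}"
    using x by (auto simp: mem_cube)
  have "\<Psi> 1 - \<Psi> 0 \<le> (\<integral>z. \<phi> z \<partial>z_law \<sigma>)"
  proof (rule z_law_integral_ge)
    show "continuous_on {0..1} (z_density \<sigma>)" "\<And>z. 0 \<le> z_density \<sigma> z"
      unfolding \<sigma>_def by (rule monotone_z_density[OF \<gamma>])+
    have "continuous_on UNIV (\<lambda>z. grad f (clamp 0 1 (z *\<^sub>R x)))"
      by (rule continuous_on_compose2[OF continuous_clamped_grad[OF f(2), of UNIV]])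
         (auto intro!: continuous_intros)
    then show "continuous_on UNIV \<phi>"
      unfolding \<phi>_def \<sigma>_def monotone_scheme_simps by (intro continuous_intros)
    show "(\<Psi> has_real_derivative \<psi> z) (at z within {0..1})" if "z \<in> {0..1}" for z
      unfolding \<Psi>_def \<psi>_def
      by (rule derivative_eq_intros has_derivative_along_segment[OF f(1) seg that] refl)+ (simp add: algebra_simps)
    show "continuous_on {0..1} \<psi>"
      unfolding \<psi>_def
      by (intro continuous_intros continuous_grad_segment[OF f(2) seg] continuous_differentiable_segment[OF f(1) seg])
    show "\<psi> z \<le> z_density \<sigma> z * \<phi> z" if "z \<in> {0..1}" for z
    proof -
      have p: "z *\<^sub>R x \<in> {0..1}" using segment_in_cube[OF seg that] by simp
      have "c * exp (\<gamma> * (z - 1)) * (\<gamma> * (f u - f (z *\<^sub>R x)) - grad f (z *\<^sub>R x) \<bullet> x)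
          \<le> c * exp (\<gamma> * (z - 1)) * (grad f (z *\<^sub>R x) \<bullet> u - grad f (z *\<^sub>R x) \<bullet> x)"
        using monotone_gradient_bound[OF f(1) mono conc \<gamma> p u] c
        by (intro mult_left_mono) auto
      then show ?thesis
        by (simp add: \<psi>_def \<phi>_def \<sigma>_def clamp_cube[OF p] inner_diff_right c_def)
           (simp add: algebra_simps diff_divide_distrib add_divide_distrib)
    qed
  qed
  moreover have "c * (ratio \<sigma> * f u - f (out_map \<sigma> x)) \<le> \<Psi> 1 - \<Psi> 0"
  proof -
    have "0 \<le> c * exp (-\<gamma>) * f 0" using c nonneg by simp
    then show ?thesis by (simp add: \<Psi>_def \<sigma>_def algebra_simps)
  qed
  ultimately have "c * (ratio \<sigma> * f u - f (out_map \<sigma> x)) \<le> (\<integral>z. \<phi> z \<partial>z_law \<sigma>)"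
    by linarith
  then have "ratio \<sigma> * f u - f (out_map \<sigma> x) \<le> (1/c) * (\<integral>z. \<phi> z \<partial>z_law \<sigma>)"
    using c by (simp add: field_simps)
  then show ?thesis by (simp add: \<phi>_def c_def)
qed

lemma infnorm_cube_le: "l \<in> {0..1::real^'d} \<Longrightarrow> infnorm l \<le> 1"
  unfolding infnorm_cart mem_cube by (rule cSup_least) auto

text \<open>The query points are \<open>p = l + z *\<^sub>R v\<close> with \<open>v = (x - l) / 2\<close>. Since \<open>x - p\<close> equals
  \<open>(2 - z) *\<^sub>R v\<close>, the gradient bound becomes
  \<open>t * b * f u - 2 * f p - 2 * t * (\<nabla>f p \<bullet> v) \<le> \<nabla>f p \<bullet> (u - x)\<close> with \<open>t = 1 - z/2\<close> and
  \<open>b = 1 - infnorm l\<close>. Its integrating factor is \<open>1 / t^3\<close>: the last two terms combine to a multiple of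
  the derivative of \<open>f p / t^2\<close>. Evaluated between \<open>0\<close> and \<open>1\<close> this gives the weight \<open>8/3\<close> of
  \<open>f (out_map x)\<close> and the weight \<open>2/3 * b = 8/3 * (b / 4)\<close> of \<open>f u\<close>.\<close>

lemma nonmonotone_scheme_linearizable:
  fixes f :: "real^'d \<Rightarrow> real"
  assumes f: "f differentiable_on {0..1}" "continuous_on {0..1} (grad f)"
    and nonneg: "\<And>x. x \<in> {0..1} \<Longrightarrow> 0 \<le> f x"
    and conc: "up_concave f"
    and l: "l \<in> {0..1}" and x: "x \<in> {0..1}" and u: "u \<in> {0..1}"
  defines "\<sigma> \<equiv> nonmonotone_scheme l"
  shows "ratio \<sigma> * f u - f (out_map \<sigma> x)
    \<le> 3/8 * (\<integral>z. grad f (clamp 0 1 (query_map \<sigma> x z)) \<bullet> (u - x) \<partial>z_law \<sigma>)"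
proof -
  define b where "b = 1 - infnorm l"
  have b: "0 \<le> b" using infnorm_cube_le[OF l] by (simp add: b_def)
  define v where "v = (1/2) *\<^sub>R (x - l)"
  define \<phi> where "\<phi> z = grad f (clamp 0 1 (query_map \<sigma> x z)) \<bullet> (u - x)" for z
  define \<Psi> where "\<Psi> z = (2/3) * b * f u / (1 - z/2) - (2/3) * f (l + z *\<^sub>R v) / (1 - z/2)^2" for z
  define \<psi> where "\<psi> z = (1/3) * b * f u / (1 - z/2)^2 - (2/3) * f (l + z *\<^sub>R v) / (1 - z/2)^3
      - (2/3) * (grad f (l + z *\<^sub>R v) \<bullet> v) / (1 - z/2)^2" for z
  have q: "query_map \<sigma> x z = l + z *\<^sub>R v" for z
    by (simp add: \<sigma>_def v_def)
  have lv: "l + v = (1/2) *\<^sub>R (x + l)"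
    by (simp add: v_def vec_eq_iff algebra_simps)
  have seg: "l \<in> {0..1}" "l + v \<in> {0..1}"
    using segment_in_cube[of l "x - l" "1/2"] x l by (simp_all add: v_def)
  have "\<Psi> 1 - \<Psi> 0 \<le> (\<integral>z. \<phi> z \<partial>z_law \<sigma>)"
  proof (rule z_law_integral_ge)
    show "continuous_on {0..1} (z_density \<sigma>)" "\<And>z. z \<in> {0..1} \<Longrightarrow> 0 \<le> z_density \<sigma> z"
      unfolding \<sigma>_def by (rule nonmonotone_z_density; assumption)+
    have "continuous_on UNIV (\<lambda>z. grad f (clamp 0 1 (l + z *\<^sub>R v)))"
      by (rule continuous_on_compose2[OF continuous_clamped_grad[OF f(2), of UNIV]])
         (auto intro!: continuous_intros)
    then show "continuous_on UNIV \<phi>"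
      unfolding \<phi>_def q by (intro continuous_intros)
    show "(\<Psi> has_real_derivative \<psi> z) (at z within {0..1})" if "z \<in> {0..1}" for z
    proof -
      have h: "0 < 1 - z/2" using that by (rule half_pos)
      define t where "t = 1 - z/2"
      have t: "t \<noteq> 0" using h by (simp add: t_def)
      have dt: "((\<lambda>z. 1 - z/2) has_real_derivative - (1/2)) (at z within {0..1})"
        by (auto intro!: derivative_eq_intros)
      have "((\<lambda>z. (2/3) * b * f u / (1 - z/2)) has_real_derivative
          (0 * (1 - z/2) - (2/3) * b * f u * - (1/2)) / ((1 - z/2) * (1 - z/2))) (at z within {0..1})"
        by (rule DERIV_divide[OF DERIV_const dt]) (use h in simp)
      moreover have "((\<lambda>z. (2/3) * f (l + z *\<^sub>R v) / (1 - z/2)^2) has_real_derivative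
          ((2/3) * (grad f (l + z *\<^sub>R v) \<bullet> v) * (1 - z/2)^2
            - (2/3) * f (l + z *\<^sub>R v) * (of_nat 2 * (- (1/2) * (1 - z/2)^(2 - Suc 0))))
          / ((1 - z/2)^2 * (1 - z/2)^2)) (at z within {0..1})"
        by (rule DERIV_divide[OF DERIV_cmult[OF has_derivative_along_segment[OF f(1) seg that]] DERIV_power[OF dt]])
           (use h in simp)
      ultimately have "(\<Psi> has_real_derivative
          (0 * t - (2/3) * b * f u * - (1/2)) / (t * t)
          - ((2/3) * (grad f (l + z *\<^sub>R v) \<bullet> v) * t^2
            - (2/3) * f (l + z *\<^sub>R v) * (of_nat 2 * (- (1/2) * t^(2 - Suc 0)))) / (t^2 * t^2)) (at z within {0..1})"
        unfolding \<Psi>_def t_def by (rule DERIV_diff)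
      moreover have "(0 * t - (2/3) * b * f u * - (1/2)) / (t * t)
          - ((2/3) * (grad f (l + z *\<^sub>R v) \<bullet> v) * t^2
            - (2/3) * f (l + z *\<^sub>R v) * (of_nat 2 * (- (1/2) * t^(2 - Suc 0)))) / (t^2 * t^2) = \<psi> z"
        unfolding \<psi>_def t_def[symmetric] using t
        by (simp add: divide_simps power2_eq_square power3_eq_cube) (simp add: algebra_simps)
      ultimately show ?thesis by simp
    qed
    show "continuous_on {0..1} \<psi>"
      unfolding \<psi>_def
      by (intro continuous_intros continuous_grad_segment[OF f(2) seg] continuous_differentiable_segment[OF f(1) seg])
         auto
    show "\<psi> z \<le> z_density \<sigma> z * \<phi> z" if z: "z \<in> {0..1}" for z
    proof -
      define p where "p = l + z *\<^sub>R v"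
      define t where "t = 1 - z/2"
      have t: "0 < t" "t \<le> 1" using z by (auto simp: t_def)
      have p: "p \<in> {0..1}" using segment_in_cube[OF seg z] by (simp add: p_def)
      have "p$k \<le> 1 - t * b" for k
      proof -
        have "l$k \<le> 1 - b" using component_le_infnorm_cart[of l k] by (simp add: b_def)
        moreover have "x$k \<le> 1" using x unfolding mem_cube by simp
        ultimately have "t * l$k + (1 - t) * x$k \<le> t * (1 - b) + (1 - t) * 1"
          using t by (intro add_mono mult_left_mono) auto
        then show ?thesis by (simp add: p_def v_def t_def algebra_simps diff_divide_distrib)
      qed
      moreover have "t * b \<le> 1" "0 \<le> t * b"
        using t b infnorm_pos_le[of l] by (auto simp: b_def intro!: mult_le_one)
      ultimately have "(1 - (1 - t * b)) * f u - 2 * f p \<le> grad f p \<bullet> (u - p)"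
        by (intro nonmonotone_gradient_bound[OF conc nonneg p u]) auto
      moreover have "u - x = (u - p) - (2 * t) *\<^sub>R v"
        by (simp add: p_def v_def t_def vec_eq_iff field_simps)
      then have "grad f p \<bullet> (u - x) = grad f p \<bullet> (u - p) - 2 * t * (grad f p \<bullet> v)"
        by (simp only: inner_diff_right inner_scaleR_right)
      ultimately have "t * b * f u - 2 * f p - 2 * t * (grad f p \<bullet> v) \<le> grad f p \<bullet> (u - x)"
        by simp
      then have "(t * b * f u - 2 * f p - 2 * t * (grad f p \<bullet> v)) / (3 * t^3) \<le> (grad f p \<bullet> (u - x)) / (3 * t^3)"
        using t by (intro divide_right_mono) auto
      also have "(t * b * f u - 2 * f p - 2 * t * (grad f p \<bullet> v)) / (3 * t^3) = \<psi> z"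
        unfolding \<psi>_def p_def[symmetric] t_def[symmetric]
        using t by (simp add: divide_simps power2_eq_square power3_eq_cube)
      also have "(grad f p \<bullet> (u - x)) / (3 * t^3) = z_density \<sigma> z * \<phi> z"
      proof -
        have "\<phi> z = grad f p \<bullet> (u - x)"
          by (simp only: \<phi>_def q p_def[symmetric] clamp_cube[OF p])
        moreover have "z_density \<sigma> z = 1 / (3 * t^3)"
          by (simp add: \<sigma>_def t_def)
        ultimately show ?thesis by simp
      qed
      finally show ?thesis .
    qed
  qed
  moreover have "8/3 * (ratio \<sigma> * f u - f (out_map \<sigma> x)) \<le> \<Psi> 1 - \<Psi> 0"
    using nonneg[OF l] lv by (simp add: \<Psi>_def \<sigma>_def b_def power2_eq_square field_simps)
  ultimately show ?thesis by (simp add: \<phi>_def)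
qed

text \<open>What the analysis of the algorithm needs to know about the maps of a scheme, apart from
  the linear bound.\<close>

definition admissible_scheme :: "(real^'d) set \<Rightarrow> 'd scheme \<Rightarrow> bool" where
  "admissible_scheme \<K> \<sigma> \<longleftrightarrow>
     prob_space (z_law \<sigma>) \<and> 0 \<le> ratio \<sigma> \<and>
     (\<forall>x\<in>\<K>. out_map \<sigma> x \<in> \<K>) \<and> (\<forall>x\<in>\<K>. \<forall>z\<in>{0..1}. query_map \<sigma> x z \<in> \<K>) \<and>
     (\<forall>x y. norm (out_map \<sigma> x - out_map \<sigma> y) \<le> norm (x - y)) \<and>
     continuous_on UNIV (out_map \<sigma>) \<and> continuous_on UNIV (\<lambda>(x, z). query_map \<sigma> x z)"

text \<open>The gradient is evaluated at the clamped query point so that the integrand is defined and continuous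
  for all real \<open>z\<close>. For \<open>x \<in> \<K>\<close> and \<open>z \<in> {0..1}\<close> the clamping has no effect.\<close>

definition linearizable :: "real \<Rightarrow> (real^'d) set \<Rightarrow> 'd scheme \<Rightarrow> (real^'d \<Rightarrow> real) \<Rightarrow> bool" where
  "linearizable \<beta> \<K> \<sigma> f \<longleftrightarrow>
     (\<forall>x\<in>\<K>. \<forall>u\<in>\<K>. ratio \<sigma> * f u - f (out_map \<sigma> x)
        \<le> \<beta> * (\<integral>z. grad f (clamp 0 1 (query_map \<sigma> x z)) \<bullet> (u - x) \<partial>z_law \<sigma>))"

lemma monotone_case_linearizable:
  fixes \<K> :: "(real^'d) set"
  assumes K: "convex \<K>" "\<K> \<subseteq> {0..1}" and \<gamma>: "0 < \<gamma>" "\<gamma> \<le> 1"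
    and reg: "\<forall>t<T. \<forall>i. regular_objective M1 M2 (f t i)"
    and m: "monotone_case \<gamma> \<K> T f \<sigma>"
  obtains \<beta> where "0 \<le> \<beta>" "\<beta> \<le> 1" "admissible_scheme \<K> \<sigma>" "\<And>t i. t < T \<Longrightarrow> linearizable \<beta> \<K> \<sigma> (f t i)"
proof
  have \<sigma>: "\<sigma> = monotone_scheme \<gamma>" and 0: "0 \<in> \<K>" using m by (auto simp: monotone_case_def)
  show "0 \<le> (1 - exp (-\<gamma>)) / \<gamma>" using \<gamma> by simp
  have "1 - \<gamma> \<le> exp (-\<gamma>)" using exp_ge_add_one_self[of "-\<gamma>"] by simp
  then show "(1 - exp (-\<gamma>)) / \<gamma> \<le> 1" using \<gamma> by (simp add: divide_simps)
  have "z *\<^sub>R x \<in> \<K>" if "x \<in> \<K>" "z \<in> {0..1}" for x z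
    using convexD_alt[OF K(1) 0 that(1), of z] that(2) by simp
  then show "admissible_scheme \<K> \<sigma>"
    using \<gamma> monotone_z_density(3)[OF \<gamma>(1)] unfolding admissible_scheme_def \<sigma>
    by (auto simp: split_beta intro!: continuous_intros)
  show "linearizable ((1 - exp (-\<gamma>)) / \<gamma>) \<K> \<sigma> (f t i)" if t: "t < T" for t i
    unfolding linearizable_def
  proof (intro ballI)
    fix x u assume "x \<in> \<K>" "u \<in> \<K>"
    then have xu: "x \<in> {0..1}" "u \<in> {0..1}" and z: "0 \<in> {0..1::real^'d}"
      using K 0 by blast+
    have r: "regular_objective M1 M2 (f t i)" using reg t by blast
    show "ratio \<sigma> * f t i u - f t i (out_map \<sigma> x)
        \<le> (1 - exp (-\<gamma>)) / \<gamma> * (\<integral>z. grad (f t i) (clamp 0 1 (query_map \<sigma> x z)) \<bullet> (u - x) \<partial>z_law \<sigma>)"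
      unfolding \<sigma>
    proof (rule monotone_scheme_linearizable)
      show "f t i differentiable_on {0..1}" "continuous_on {0..1} (grad (f t i))"
        using r by (auto simp: regular_objective_def intro: lipschitz_on_continuous_on)
      show "0 \<le> f t i 0" "mono_on {0..1} (f t i)" "weakly_up_concave \<gamma> (f t i)"
        using m t z unfolding monotone_case_def by blast+
    qed (use \<gamma> xu in blast)+
  qed
qed

lemma nonmonotone_case_linearizable:
  assumes K: "convex \<K>" "\<K> \<subseteq> {0..1}"
    and reg: "\<forall>t<T. \<forall>i. regular_objective M1 M2 (f t i)"
    and m: "nonmonotone_case \<K> T f \<sigma>"
  shows "admissible_scheme \<K> \<sigma>" and "t < T \<Longrightarrow> linearizable (3/8) \<K> \<sigma> (f t i)"
proof -
  obtain l where \<sigma>: "\<sigma> = nonmonotone_scheme l" and l: "l \<in> \<K>"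
    using m by (auto simp: nonmonotone_case_def)
  then have lc: "l \<in> {0..1}" using K by blast
  have q: "(z/2) *\<^sub>R (x - l) + l \<in> \<K>" if "x \<in> \<K>" "z \<in> {0..1}" for x z
    using convexD_alt[OF K(1) l that(1), of "z/2"] that(2) by (simp add: algebra_simps)
  have o: "(1/2) *\<^sub>R (x + l) \<in> \<K>" if "x \<in> \<K>" for x
    using convexD_alt[OF K(1) l that, of "1/2"] by (simp add: algebra_simps)
  have n: "norm ((1/2) *\<^sub>R (x + l) - (1/2) *\<^sub>R (y + l)) \<le> norm (x - y)" for x y
    unfolding scaleR_diff_right[symmetric] norm_scaleR by simp
  show "admissible_scheme \<K> \<sigma>"
    using q o n infnorm_cube_le[OF lc] nonmonotone_z_density(3)[of l]
    unfolding admissible_scheme_def \<sigma> nonmonotone_scheme_simps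
    by (auto simp: split_beta intro!: continuous_intros)
  show "linearizable (3/8) \<K> \<sigma> (f t i)" if t: "t < T"
    unfolding linearizable_def
  proof (intro ballI)
    fix x u assume "x \<in> \<K>" "u \<in> \<K>"
    then have xu: "x \<in> {0..1}" "u \<in> {0..1}"
      using K by blast+
    have r: "regular_objective M1 M2 (f t i)" using reg t by blast
    show "ratio \<sigma> * f t i u - f t i (out_map \<sigma> x)
        \<le> 3/8 * (\<integral>z. grad (f t i) (clamp 0 1 (query_map \<sigma> x z)) \<bullet> (u - x) \<partial>z_law \<sigma>)"
      unfolding \<sigma>
    proof (rule nonmonotone_scheme_linearizable)
      show "f t i differentiable_on {0..1}" "continuous_on {0..1} (grad (f t i))"
        using r by (auto simp: regular_objective_def intro: lipschitz_on_continuous_on)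
      show "up_concave (f t i)" "\<And>x. x \<in> {0..1} \<Longrightarrow> 0 \<le> f t i x"
        using m t unfolding nonmonotone_case_def by blast+
    qed (use lc xu in blast)+
  qed
qed

lemma scheme_linearizable:
  assumes "convex \<K>" "\<K> \<subseteq> {0..1}" and "0 < \<gamma>" "\<gamma> \<le> 1"
    and "\<forall>t<T. \<forall>i. regular_objective M1 M2 (f t i)"
    and "monotone_case \<gamma> \<K> T f \<sigma> \<or> nonmonotone_case \<K> T f \<sigma>"
  obtains \<beta> where "0 \<le> \<beta>" "\<beta> \<le> 1" "admissible_scheme \<K> \<sigma>" "\<And>t i. t < T \<Longrightarrow> linearizable \<beta> \<K> \<sigma> (f t i)"
  using assms(6)
proof
  assume "monotone_case \<gamma> \<K> T f \<sigma>"
  from monotone_case_linearizable[OF assms(1-5) this] that show thesis by metis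
next
  assume "nonmonotone_case \<K> T f \<sigma>"
  from nonmonotone_case_linearizable[OF assms(1,2,5) this] show thesis
    by (intro that[of "3/8"]) auto
qed

section \<open>Consensus and online gradient ascent along a run\<close>

text \<open>A run together with the regularity assumptions of the regret bound. The two cases enter only
  through an admissible scheme that is linearizable with a factor \<open>\<beta> \<le> 1\<close>.\<close>

locale regular_semi_bandit_run =
  semi_bandit_run M F H \<K> G T f E A \<sigma> lo P K L \<eta> c Z S resp x y y_tilde play n_loo n_comm
  for M :: "'w measure" and F H \<K> G T and f :: "nat \<Rightarrow> 'n::finite \<Rightarrow> real^'d \<Rightarrow> real"
    and E and A :: "real^'n^'n" and \<sigma> lo P K L \<eta> c Z S resp x y y_tilde play n_loo n_comm +
  fixes R \<epsilon> lam2 M1 M2 \<beta> :: real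
  assumes domain: "convex \<K>" "compact \<K>" "\<K> \<subseteq> {0..1}" "R = (SUP u\<in>\<K>. norm u)"
    and objectives: "\<And>t i. t < T \<Longrightarrow> regular_objective M1 M2 (f t i)"
    and scheme: "admissible_scheme \<K> \<sigma>"
    and linear_bound: "\<And>t i. t < T \<Longrightarrow> linearizable \<beta> \<K> \<sigma> (f t i)" "0 \<le> \<beta>" "\<beta> \<le> 1"
    and weights: "weight_matrix E A" "transpose A = A" "doubly_stochastic A"
      "second_eigenvalue A lam2" "lam2 < 1"
    and params: "0 < K" "0 < L" "K * L dvd T" "0 < \<eta>" "0 < G" "\<epsilon> = (real K)\<^sup>2 * \<eta>\<^sup>2 * G\<^sup>2"
    and projection: "implements_projection \<K> R \<epsilon> lo P"
begin

definition phases :: nat where "phases = T div (L * K)"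

text \<open>The scale on which the states change in one phase; the error tolerance is its square.\<close>

definition step_size :: real where "step_size = real K * \<eta> * G"

definition gossip :: "('n \<Rightarrow> real^'d) \<Rightarrow> 'n \<Rightarrow> real^'d" where
  "gossip v i = (\<Sum>j\<in>UNIV. A$i$j *\<^sub>R v j)"

definition phase_gradient :: "nat \<Rightarrow> 'n \<Rightarrow> 'w \<Rightarrow> real^'d" where
  "phase_gradient m i \<omega> = (\<Sum>q\<in>{m * K..<Suc m * K}. resp q i \<omega>)"

text \<open>Twice the sum of the geometric series in \<open>gossip_consensus\<close> for perturbations of size \<open>5\<close>, in units
  of the step size.\<close>

definition consensus_factor :: real where
  "consensus_factor = 10 * sqrt (real CARD('n)) / (1 - lam2)"

text \<open>The divisibility of \<open>T\<close> makes all divisions of the horizon exact.\<close>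

lemma horizon: "T = phases * K * L" "T div L = phases * K"
proof -
  obtain k where k: "T = K * L * k" using params(3) by (elim dvdE)
  then have "phases = k" using params(1,2) unfolding phases_def by (simp add: mult.commute[of L K])
  then show "T = phases * K * L" using k by simp
  then show "T div L = phases * K" using params(2) by (metis nonzero_mult_div_cancel_right not_gr_zero)
qed

lemma block_less: "m < phases \<Longrightarrow> q \<in> {m * K..<Suc m * K} \<Longrightarrow> q < T div L"
  using mult_le_mono1[of "Suc m" phases K] by (auto simp: horizon(2))

lemma step_size_pos: "0 < step_size" "\<epsilon> = step_size\<^sup>2" "0 < \<epsilon>"
  using params by (simp_all add: step_size_def power_mult_distrib)

text \<open>The weights vanish outside the neighbourhood, so the sum may run over all agents.\<close>

lemma received_gossip: "received E A v i = gossip v i"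
  unfolding received_def gossip_def
proof (rule sum.mono_neutral_left)
  show "\<forall>j\<in>UNIV - neighbours E i. A$i$j *\<^sub>R v j = 0"
  proof
    fix j assume "j \<in> UNIV - neighbours E i"
    then have "\<not> 0 < A$i$j" "0 \<le> A$i$j"
      using weights(1) unfolding weight_matrix_def neighbours_def by auto
    then show "A$i$j *\<^sub>R v j = 0" by simp
  qed
qed auto

lemma A_rows: "0 \<le> A$i$j" "(\<Sum>j\<in>UNIV. A$i$j) = 1"
  using weights(3) by (auto simp: doubly_stochastic_def)

lemma norm_gossip_le:
  assumes "\<And>j. norm (v j) \<le> D"
  shows "norm (gossip v i) \<le> D"
proof -
  have "norm (gossip v i) \<le> (\<Sum>j\<in>UNIV. norm (A$i$j *\<^sub>R v j))"
    unfolding gossip_def by (rule norm_sum)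
  also have "\<dots> \<le> (\<Sum>j\<in>UNIV. A$i$j * D)"
    using A_rows assms by (intro sum_mono) (auto intro: mult_left_mono)
  also have "\<dots> = D" by (simp add: A_rows flip: sum_distrib_right)
  finally show ?thesis .
qed

lemma gossip_const: "gossip (\<lambda>j. u) i = u"
  by (simp add: gossip_def A_rows flip: scaleR_left.sum)

lemma gossip_diff: "gossip (\<lambda>j. v j - w j) i = gossip v i - gossip w i"
  by (simp add: gossip_def scaleR_diff_right sum_subtractf)

lemma gossip_mem: "(\<And>j. v j \<in> \<K>) \<Longrightarrow> gossip v i \<in> \<K>"
  unfolding gossip_def using A_rows domain(1) by (intro convex_sum) auto

lemma norm_le_R: "u \<in> \<K> \<Longrightarrow> norm u \<le> R"
  unfolding domain(4)
  using compact_imp_bounded[OF domain(2)] by (intro cSUP_upper) (simp_all add: bdd_above_norm)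

lemma R_nonneg: "0 \<le> R"
  using norm_le_R[OF start(1)] norm_ge_zero order_trans by blast

lemma iterate_mem: "m \<le> phases \<Longrightarrow> \<omega> \<in> space M \<Longrightarrow> x m i \<omega> \<in> \<K>"
proof (induction m arbitrary: i)
  case 0
  then show ?case by (simp add: start)
next
  case (Suc m)
  then have "gossip (\<lambda>j. x m j \<omega>) i \<in> \<K>" by (intro gossip_mem) simp
  then have "infeasible_projection \<K> R \<epsilon> (y (Suc m) i \<omega>) (x (Suc m) i \<omega>, y_tilde (Suc m) i \<omega>)"
    using projection projection_step[of m \<omega> i] Suc.prems
    unfolding implements_projection_def received_gossip phases_def by auto
  then show ?case by (simp add: infeasible_projection_def)
qed

lemma projection_properties:
  assumes "m < phases" "\<omega> \<in> space M"
  shows "infeasible_projection \<K> R \<epsilon> (y (Suc m) i \<omega>) (x (Suc m) i \<omega>, y_tilde (Suc m) i \<omega>)"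
    and "n_loo (Suc m) i \<omega> \<le> n_loo m i \<omega> + projection_budget R \<epsilon> (gossip (\<lambda>j. x m j \<omega>) i) (y (Suc m) i \<omega>)"
proof -
  have "gossip (\<lambda>j. x m j \<omega>) i \<in> \<K>" using assms by (intro gossip_mem iterate_mem) auto
  then show "infeasible_projection \<K> R \<epsilon> (y (Suc m) i \<omega>) (x (Suc m) i \<omega>, y_tilde (Suc m) i \<omega>)"
    "n_loo (Suc m) i \<omega> \<le> n_loo m i \<omega> + projection_budget R \<epsilon> (gossip (\<lambda>j. x m j \<omega>) i) (y (Suc m) i \<omega>)"
    using projection projection_step[of m \<omega> i] loo_count(2)[of m \<omega> i] assms
    unfolding implements_projection_def received_gossip phases_def by auto
qed

lemma feasibility_gap:
  assumes "m \<le> phases" "\<omega> \<in> space M"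
  shows "norm (x m i \<omega> - y_tilde m i \<omega>) \<le> 2 * step_size"
proof (cases m)
  case 0
  then show ?thesis using assms step_size_pos(1) by (simp add: start)
next
  case (Suc k)
  have "(norm (x m i \<omega> - y_tilde m i \<omega>))\<^sup>2 \<le> 3 * \<epsilon>"
    using projection_properties(1)[of k \<omega> i] assms Suc by (simp add: infeasible_projection_def)
  also have "\<dots> \<le> (2 * step_size)\<^sup>2"
    by (simp add: step_size_pos(2))
  finally show ?thesis
    by (rule power2_le_imp_le) (use step_size_pos(1) in simp)
qed

lemma norm_phase_gradient:
  assumes "m < phases" "\<omega> \<in> space M"
  shows "norm (phase_gradient m i \<omega>) \<le> real K * G"
proof -
  have "norm (phase_gradient m i \<omega>) \<le> (\<Sum>q\<in>{m * K..<Suc m * K}. norm (resp q i \<omega>))"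
    unfolding phase_gradient_def by (rule norm_sum)
  also have "\<dots> \<le> (\<Sum>q\<in>{m * K..<Suc m * K}. G)"
    by (intro sum_mono oracle_bound block_less[OF assms(1)] assms(2))
  finally show ?thesis by simp
qed

lemma y_update:
  assumes "m < phases" "\<omega> \<in> space M"
  shows "y (Suc m) i \<omega> = gossip (\<lambda>j. y_tilde m j \<omega>) i + \<eta> *\<^sub>R phase_gradient m i \<omega>"
  using y_step[of m \<omega> i] assms by (simp add: phases_def received_gossip phase_gradient_def)

text \<open>Both the gossip average of the feasibility gaps and the gradient step are of the order of the step
  size. This one estimate controls the cost of the projection and, by the projection inequality, its
  displacement.\<close>

lemma projection_input_gap:
  assumes "m < phases" "\<omega> \<in> space M"
  shows "norm (y (Suc m) i \<omega> - gossip (\<lambda>j. x m j \<omega>) i) \<le> 3 * step_size"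
proof -
  have "y (Suc m) i \<omega> - gossip (\<lambda>j. x m j \<omega>) i
      = \<eta> *\<^sub>R phase_gradient m i \<omega> - gossip (\<lambda>j. x m j \<omega> - y_tilde m j \<omega>) i"
    by (simp add: y_update[OF assms] gossip_diff)
  also have "norm \<dots> \<le> norm (\<eta> *\<^sub>R phase_gradient m i \<omega>) + norm (gossip (\<lambda>j. x m j \<omega> - y_tilde m j \<omega>) i)"
    by (rule norm_triangle_ineq4)
  also have "norm (gossip (\<lambda>j. x m j \<omega> - y_tilde m j \<omega>) i) \<le> 2 * step_size"
    using assms by (intro norm_gossip_le feasibility_gap) auto
  also have "norm (\<eta> *\<^sub>R phase_gradient m i \<omega>) \<le> step_size"
    using mult_left_mono[OF norm_phase_gradient[OF assms, of i], of \<eta>] params(4)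
    by (simp add: step_size_def mult_ac)
  finally show ?thesis by simp
qed

text \<open>The defining inequality of an infeasible projection does not bound the distance to its input. It
  does so indirectly when it is tested at the point \<open>gossip x\<close> of the domain, which is close to the input.\<close>

lemma gossip_step_gap:
  assumes "m < phases" "\<omega> \<in> space M"
  shows "norm (y_tilde (Suc m) i \<omega> - gossip (\<lambda>j. y_tilde m j \<omega>) i) \<le> 5 * step_size"
proof -
  have mem: "gossip (\<lambda>j. x m j \<omega>) i \<in> \<K>" using assms by (intro gossip_mem iterate_mem) auto
  have "(norm (y_tilde (Suc m) i \<omega> - gossip (\<lambda>j. x m j \<omega>) i))\<^sup>2
      \<le> (norm (y (Suc m) i \<omega> - gossip (\<lambda>j. x m j \<omega>) i))\<^sup>2"
    using projection_properties(1)[OF assms, of i] mem by (simp add: infeasible_projection_def)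
  then have "norm (y_tilde (Suc m) i \<omega> - gossip (\<lambda>j. x m j \<omega>) i)
      \<le> norm (y (Suc m) i \<omega> - gossip (\<lambda>j. x m j \<omega>) i)"
    by (rule power2_le_imp_le) simp
  also have "\<dots> \<le> 3 * step_size" by (rule projection_input_gap[OF assms])
  finally have 1: "norm (y_tilde (Suc m) i \<omega> - gossip (\<lambda>j. x m j \<omega>) i) \<le> 3 * step_size" .
  have 2: "norm (gossip (\<lambda>j. x m j \<omega> - y_tilde m j \<omega>) i) \<le> 2 * step_size"
    using assms by (intro norm_gossip_le feasibility_gap) auto
  have eq: "y_tilde (Suc m) i \<omega> - gossip (\<lambda>j. y_tilde m j \<omega>) i
      = (y_tilde (Suc m) i \<omega> - gossip (\<lambda>j. x m j \<omega>) i) + gossip (\<lambda>j. x m j \<omega> - y_tilde m j \<omega>) i"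
    by (simp add: gossip_diff)
  show ?thesis
    unfolding eq
    using 1 2 norm_triangle_ineq[of "y_tilde (Suc m) i \<omega> - gossip (\<lambda>j. x m j \<omega>) i"
        "gossip (\<lambda>j. x m j \<omega> - y_tilde m j \<omega>) i"] by linarith
qed

lemma auxiliary_consensus:
  assumes "m \<le> phases" "\<omega> \<in> space M"
  shows "norm (y_tilde m i \<omega> - y_tilde m j \<omega>) \<le> consensus_factor * step_size"
proof -
  have "norm (y_tilde m i \<omega> - y_tilde m j \<omega>) \<le> 2 * (sqrt (real CARD('n)) * (5 * step_size) / (1 - lam2))"
  proof (rule gossip_consensus[OF weights(2-5), of "\<lambda>m i. y_tilde m i \<omega>" c phases])
    show "norm (y_tilde (Suc m) i \<omega> - (\<Sum>j\<in>UNIV. A $ i $ j *\<^sub>R y_tilde m j \<omega>)) \<le> 5 * step_size"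
      if "m < phases" for m i
      using gossip_step_gap[OF that assms(2)] by (simp add: gossip_def)
  qed (use assms step_size_pos(1) in \<open>auto simp: start\<close>)
  then show ?thesis by (simp add: consensus_factor_def)
qed

lemma consensus_factor_nonneg: "0 \<le> consensus_factor"
  using weights(5) by (simp add: consensus_factor_def)

lemma iterate_consensus:
  assumes "m \<le> phases" "\<omega> \<in> space M"
  shows "norm (x m i \<omega> - x m j \<omega>) \<le> (consensus_factor + 4) * step_size"
proof -
  have "x m i \<omega> - x m j \<omega> = (x m i \<omega> - y_tilde m i \<omega>) + (y_tilde m i \<omega> - y_tilde m j \<omega>)
      - (x m j \<omega> - y_tilde m j \<omega>)" by simp
  then have "norm (x m i \<omega> - x m j \<omega>) \<le> norm (x m i \<omega> - y_tilde m i \<omega>)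
      + norm (y_tilde m i \<omega> - y_tilde m j \<omega>) + norm (x m j \<omega> - y_tilde m j \<omega>)"
    using norm_triangle_ineq4[of "(x m i \<omega> - y_tilde m i \<omega>) + (y_tilde m i \<omega> - y_tilde m j \<omega>)" "x m j \<omega> - y_tilde m j \<omega>"]
      norm_triangle_ineq[of "x m i \<omega> - y_tilde m i \<omega>" "y_tilde m i \<omega> - y_tilde m j \<omega>"]
    by simp
  then show ?thesis
    using feasibility_gap[OF assms, of i] feasibility_gap[OF assms, of j] auxiliary_consensus[OF assms, of i j]
    by (simp add: algebra_simps)
qed

lemma gossip_iterate_gap:
  assumes "m \<le> phases" "\<omega> \<in> space M"
  shows "norm (gossip (\<lambda>j. y_tilde m j \<omega>) i - x m i \<omega>) \<le> (consensus_factor + 2) * step_size"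
proof -
  have "gossip (\<lambda>j. y_tilde m j \<omega>) i - x m i \<omega> =
      gossip (\<lambda>j. y_tilde m j \<omega> - y_tilde m i \<omega>) i - (x m i \<omega> - y_tilde m i \<omega>)"
    by (simp add: gossip_diff gossip_const)
  also have "norm \<dots> \<le> norm (gossip (\<lambda>j. y_tilde m j \<omega> - y_tilde m i \<omega>) i) + norm (x m i \<omega> - y_tilde m i \<omega>)"
    by (rule norm_triangle_ineq4)
  also have "\<dots> \<le> consensus_factor * step_size + 2 * step_size"
    using assms by (intro add_mono norm_gossip_le auxiliary_consensus feasibility_gap)
  finally show ?thesis by (simp add: algebra_simps)
qed

text \<open>With \<open>v \<le> 9 * \<epsilon>\<close> the quadratic factor is at most \<open>9 * 8 / 4 + 1 = 19\<close>, and
  \<open>19 * 27 = 513\<close>.\<close>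

lemma projection_budget_bound:
  assumes "m < phases" "\<omega> \<in> space M"
  shows "projection_budget R \<epsilon> (gossip (\<lambda>j. x m j \<omega>) i) (y (Suc m) i \<omega>) \<le> 513 * R\<^sup>2 / \<epsilon>"
proof -
  define v where "v = (norm (gossip (\<lambda>j. x m j \<omega>) i - y (Suc m) i \<omega>))\<^sup>2"
  have "v \<le> (3 * step_size)\<^sup>2"
    unfolding v_def using projection_input_gap[OF assms, of i]
    by (intro power_mono) (auto simp: norm_minus_commute)
  then have v: "0 \<le> v" "v \<le> 9 * \<epsilon>"
    by (auto simp: v_def step_size_pos(2) power_mult_distrib)
  have "v * (v - \<epsilon>) \<le> 72 * \<epsilon>\<^sup>2"
  proof (cases "v \<le> \<epsilon>")
    case True
    then have "v * (v - \<epsilon>) \<le> 0" using v by (intro mult_nonneg_nonpos) auto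
    then show ?thesis by (smt (verit) zero_le_power2)
  next
    case False
    then have "v * (v - \<epsilon>) \<le> (9 * \<epsilon>) * (8 * \<epsilon>)" using v step_size_pos(3) by (intro mult_mono) auto
    then show ?thesis by (simp add: power2_eq_square)
  qed
  then have "v * (v - \<epsilon>) / (4 * \<epsilon>\<^sup>2) \<le> 18"
    using step_size_pos(3) by (simp add: divide_simps)
  then have 1: "max 1 (v * (v - \<epsilon>) / (4 * \<epsilon>\<^sup>2) + 1) \<le> 19" by simp
  have 2: "real (nat \<lceil>27 * R\<^sup>2 / \<epsilon> - 2\<rceil>) \<le> 27 * R\<^sup>2 / \<epsilon>"
  proof -
    have "0 \<le> 27 * R\<^sup>2 / \<epsilon>" using step_size_pos(3) by simp
    then show ?thesis by linarith
  qed
  have "projection_budget R \<epsilon> (gossip (\<lambda>j. x m j \<omega>) i) (y (Suc m) i \<omega>) \<le> (27 * R\<^sup>2 / \<epsilon>) * 19"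
    unfolding projection_budget_def v_def[symmetric]
    using 1 2 step_size_pos(3) by (intro mult_mono) auto
  then show ?thesis by simp
qed

lemma loo_calls_bound:
  assumes "\<omega> \<in> space M" "m \<le> phases"
  shows "real (n_loo m i \<omega>) \<le> real m * (513 * R\<^sup>2 / \<epsilon>)"
  using assms(2)
proof (induction m)
  case 0
  then show ?case using assms by (simp add: loo_count)
next
  case (Suc m)
  then show ?case
    using projection_properties(2)[of m \<omega> i] projection_budget_bound[of m \<omega> i] assms(1)
    by (simp add: algebra_simps add_divide_distrib)
qed

lemma communication_count: "m \<le> phases \<Longrightarrow> n_comm m i = m"
  by (induction m) (auto simp: comm_count phases_def)

text \<open>The usual one-step inequality of gradient ascent, summed over the agents: gossiping does not
  increase the sum of the squared distances to \<open>u\<close>, and neither does the projection. The inner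
  products are first obtained at the gossip averages and then moved to the iterates.\<close>

lemma online_gradient_step:
  assumes m: "m < phases" and \<omega>: "\<omega> \<in> space M" and u: "u \<in> \<K>"
  shows "(\<Sum>i\<in>UNIV. phase_gradient m i \<omega> \<bullet> (u - x m i \<omega>))
    \<le> ((\<Sum>i\<in>UNIV. (norm (y_tilde m i \<omega> - u))\<^sup>2) - (\<Sum>i\<in>UNIV. (norm (y_tilde (Suc m) i \<omega> - u))\<^sup>2)) / (2 * \<eta>)
      + real CARD('n) * (\<eta> * (real K)\<^sup>2 * G\<^sup>2 * (consensus_factor + 5/2))"
proof -
  define g where "g i = phase_gradient m i \<omega>" for i
  define a where "a i = gossip (\<lambda>j. y_tilde m j \<omega>) i" for i
  have gK: "norm (g i) \<le> real K * G" for i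
    unfolding g_def by (rule norm_phase_gradient[OF m \<omega>])
  have KG: "0 \<le> real K * G" using params by simp
  have each: "(norm (y_tilde (Suc m) i \<omega> - u))\<^sup>2
      \<le> (norm (a i - u))\<^sup>2 - 2 * \<eta> * (g i \<bullet> (u - a i)) + \<eta>\<^sup>2 * (real K * G)\<^sup>2" for i
  proof -
    have "(norm (y_tilde (Suc m) i \<omega> - u))\<^sup>2 \<le> (norm (y (Suc m) i \<omega> - u))\<^sup>2"
      using projection_properties(1)[OF m \<omega>, of i] u by (simp add: infeasible_projection_def)
    also have "y (Suc m) i \<omega> - u = (a i - u) + \<eta> *\<^sub>R g i"
      by (simp add: y_update[OF m \<omega>] a_def g_def)
    also have "(norm \<dots>)\<^sup>2 = (norm (a i - u))\<^sup>2 - 2 * \<eta> * (g i \<bullet> (u - a i)) + \<eta>\<^sup>2 * (norm (g i))\<^sup>2"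
      unfolding power2_norm_eq_inner
      by (simp add: inner_add_left inner_add_right inner_diff_left inner_diff_right
          inner_commute algebra_simps power2_eq_square)
    also have "(norm (g i))\<^sup>2 \<le> (real K * G)\<^sup>2"
      by (intro power_mono gK) simp
    finally show ?thesis by (simp add: mult_left_mono)
  qed
  have "(\<Sum>i\<in>UNIV. (norm (a i - u))\<^sup>2) \<le> (\<Sum>i\<in>UNIV. (norm (y_tilde m i \<omega> - u))\<^sup>2)"
  proof -
    have "a i - u = (\<Sum>j\<in>UNIV. A$i$j *\<^sub>R (y_tilde m j \<omega> - u))" for i
      using gossip_diff[of "\<lambda>j. y_tilde m j \<omega>" "\<lambda>j. u" i] by (simp add: a_def gossip_const) (simp add: gossip_def)
    then show ?thesis
      using doubly_stochastic_sum_norm_le[OF weights(3), of "\<lambda>j. y_tilde m j \<omega> - u"] by simp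
  qed
  moreover have "(\<Sum>i\<in>UNIV. (norm (y_tilde (Suc m) i \<omega> - u))\<^sup>2)
      \<le> (\<Sum>i\<in>UNIV. (norm (a i - u))\<^sup>2 - 2 * \<eta> * (g i \<bullet> (u - a i)) + \<eta>\<^sup>2 * (real K * G)\<^sup>2)"
    by (intro sum_mono each)
  ultimately have "2 * \<eta> * (\<Sum>i\<in>UNIV. g i \<bullet> (u - a i))
      \<le> (\<Sum>i\<in>UNIV. (norm (y_tilde m i \<omega> - u))\<^sup>2) - (\<Sum>i\<in>UNIV. (norm (y_tilde (Suc m) i \<omega> - u))\<^sup>2)
        + real CARD('n) * (\<eta>\<^sup>2 * (real K * G)\<^sup>2)"
    by (simp add: sum.distrib sum_subtractf sum_distrib_left)
  then have 1: "(\<Sum>i\<in>UNIV. g i \<bullet> (u - a i))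
      \<le> ((\<Sum>i\<in>UNIV. (norm (y_tilde m i \<omega> - u))\<^sup>2) - (\<Sum>i\<in>UNIV. (norm (y_tilde (Suc m) i \<omega> - u))\<^sup>2)) / (2 * \<eta>)
        + real CARD('n) * (\<eta> * (real K)\<^sup>2 * G\<^sup>2 / 2)"
    using params(4) by (simp add: field_simps power2_eq_square)
  have "(\<Sum>i\<in>UNIV. g i \<bullet> (a i - x m i \<omega>)) \<le> (\<Sum>i\<in>(UNIV::'n set). (real K * G) * ((consensus_factor + 2) * step_size))"
  proof (rule sum_mono)
    fix i
    have "g i \<bullet> (a i - x m i \<omega>) \<le> norm (g i) * norm (a i - x m i \<omega>)" by (rule norm_cauchy_schwarz)
    also have "\<dots> \<le> (real K * G) * ((consensus_factor + 2) * step_size)"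
      using gossip_iterate_gap[of m \<omega> i] m \<omega> KG by (intro mult_mono gK) (auto simp: a_def)
    finally show "g i \<bullet> (a i - x m i \<omega>) \<le> (real K * G) * ((consensus_factor + 2) * step_size)" .
  qed
  also have "\<dots> = real CARD('n) * (\<eta> * (real K)\<^sup>2 * G\<^sup>2 * (consensus_factor + 2))"
    by (simp add: step_size_def power2_eq_square)
  finally have 2: "(\<Sum>i\<in>UNIV. g i \<bullet> (a i - x m i \<omega>)) \<le> \<dots>" .
  have "(\<Sum>i\<in>UNIV. g i \<bullet> (u - x m i \<omega>)) = (\<Sum>i\<in>UNIV. g i \<bullet> (u - a i)) + (\<Sum>i\<in>UNIV. g i \<bullet> (a i - x m i \<omega>))"
    by (simp add: inner_diff_right flip: sum.distrib)
  with 1 2 show ?thesis by (simp add: g_def algebra_simps)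
qed

lemma online_gradient_regret:
  assumes \<omega>: "\<omega> \<in> space M" and u: "u \<in> \<K>"
  shows "(\<Sum>m<phases. \<Sum>i\<in>UNIV. phase_gradient m i \<omega> \<bullet> (u - x m i \<omega>))
    \<le> real CARD('n) * (2 * R\<^sup>2 / \<eta> + real phases * (\<eta> * (real K)\<^sup>2 * G\<^sup>2 * (consensus_factor + 5/2)))"
proof -
  define \<Phi> where "\<Phi> m = (\<Sum>i\<in>UNIV. (norm (y_tilde m i \<omega> - u))\<^sup>2)" for m
  define D where "D = real CARD('n) * (\<eta> * (real K)\<^sup>2 * G\<^sup>2 * (consensus_factor + 5/2))"
  have "(\<Sum>m<phases. \<Sum>i\<in>UNIV. phase_gradient m i \<omega> \<bullet> (u - x m i \<omega>))
      \<le> (\<Sum>m<phases. (\<Phi> m - \<Phi> (Suc m)) / (2 * \<eta>) + D)"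
    unfolding \<Phi>_def D_def by (intro sum_mono online_gradient_step[OF _ \<omega> u]) simp
  also have "\<dots> = (\<Phi> 0 - \<Phi> phases) / (2 * \<eta>) + real phases * D"
    by (simp add: sum.distrib sum_lessThan_telescope' flip: sum_divide_distrib)
  also have "\<dots> \<le> (real CARD('n) * (4 * R\<^sup>2)) / (2 * \<eta>) + real phases * D"
  proof -
    have "norm (c - u) \<le> 2 * R"
      using norm_triangle_ineq4[of c u] norm_le_R[OF start(1)] norm_le_R[OF u] by linarith
    then have "(norm (c - u))\<^sup>2 \<le> (2 * R)\<^sup>2" by (intro power_mono) auto
    then have "\<Phi> 0 \<le> real CARD('n) * (4 * R\<^sup>2)"
      using \<omega> by (simp add: \<Phi>_def start power_mult_distrib)
    moreover have "0 \<le> \<Phi> phases" by (simp add: \<Phi>_def sum_nonneg)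
    ultimately show ?thesis using params(4) by (intro add_mono divide_right_mono) auto
  qed
  finally show ?thesis by (simp add: D_def algebra_simps)
qed

end

section \<open>Conditional expectations of the gradient estimates\<close>

context regular_semi_bandit_run
begin

lemma space_F [simp]: "space (F q) = space M" and space_H [simp]: "space (H q) = space M"
  using subalgebras by (auto simp: subalgebra_def)

lemma F_le_F: "q \<le> q' \<Longrightarrow> sets (F q) \<subseteq> sets (F q')"
  by (rule lift_Suc_mono_le[of "\<lambda>q. sets (F q)"]) (use filtration in blast)+

lemma F_measurable_mono: "q \<le> q' \<Longrightarrow> h \<in> measurable (F q) N \<Longrightarrow> h \<in> measurable (F q') N"
  by (rule measurable_from_subalg[of "F q'" "F q"]) (auto simp: subalgebra_def dest: F_le_F)

lemma F_measurable_H: "h \<in> measurable (F q) N \<Longrightarrow> h \<in> measurable (H q) N"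
  by (rule measurable_from_subalg[of "H q" "F q"]) (use filtration in \<open>auto simp: subalgebra_def\<close>)

lemma H_measurable_M: "h \<in> measurable (H q) N \<Longrightarrow> h \<in> measurable M N"
  by (rule measurable_from_subalg[OF subalgebras(2)])

lemma F_measurable_M: "h \<in> measurable (F q) N \<Longrightarrow> h \<in> measurable M N"
  by (rule measurable_from_subalg[OF subalgebras(1)])

text \<open>The iterates of phase \<open>m\<close> are determined before its first block, which has number \<open>m * K\<close>. The
  projection is only known to be measurable on \<open>\<K> \<times> UNIV\<close>, hence the appeal to feasibility.\<close>

lemma iterates_measurable:
  "m \<le> phases \<Longrightarrow> x m i \<in> borel_measurable (F (m * K)) \<and> y_tilde m i \<in> borel_measurable (F (m * K))"
proof (induction m arbitrary: i)
  case 0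
  have "x 0 i \<in> borel_measurable (F 0) \<longleftrightarrow> (\<lambda>\<omega>. c) \<in> borel_measurable (F 0)"
    "y_tilde 0 i \<in> borel_measurable (F 0) \<longleftrightarrow> (\<lambda>\<omega>. c) \<in> borel_measurable (F 0)"
    by (rule measurable_cong; simp add: start)+
  then show ?case by simp
next
  case (Suc m)
  let ?F = "F (Suc m * K)"
  have m: "m < phases" using Suc.prems by simp
  have IH: "x m j \<in> borel_measurable ?F" "y_tilde m j \<in> borel_measurable ?F" for j
    using F_measurable_mono[of "m * K" "Suc m * K"] Suc.IH[of j] m by auto
  have r: "resp q j \<in> borel_measurable ?F" if "q \<in> {m * K..<Suc m * K}" for q j
    using that by (intro F_measurable_mono[OF _ resp_measurable[OF block_less[OF m that]]]) simp
  have gx: "(\<lambda>\<omega>. gossip (\<lambda>j. x m j \<omega>) i) \<in> borel_measurable ?F"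
    unfolding gossip_def using IH by measurable
  have "(\<lambda>\<omega>. gossip (\<lambda>j. y_tilde m j \<omega>) i + \<eta> *\<^sub>R phase_gradient m i \<omega>) \<in> borel_measurable ?F"
    unfolding gossip_def phase_gradient_def
    by (intro borel_measurable_add borel_measurable_sum borel_measurable_scaleR borel_measurable_const IH r)
  moreover have "y (Suc m) i \<in> borel_measurable ?F
      \<longleftrightarrow> (\<lambda>\<omega>. gossip (\<lambda>j. y_tilde m j \<omega>) i + \<eta> *\<^sub>R phase_gradient m i \<omega>) \<in> borel_measurable ?F"
    by (rule measurable_cong) (simp add: y_update[OF m])
  ultimately have yS: "y (Suc m) i \<in> borel_measurable ?F" by simp
  have "(\<lambda>\<omega>. (gossip (\<lambda>j. x m j \<omega>) i, y (Suc m) i \<omega>)) \<in> measurable ?F (restrict_space borel (\<K> \<times> UNIV))"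
    using gx yS m by (intro measurable_restrict_space2 borel_measurable_Pair) (auto intro!: gossip_mem iterate_mem)
  moreover have "(\<lambda>(x0, y0). loo_result lo (P x0 y0)) \<in> borel_measurable (restrict_space borel (\<K> \<times> UNIV))"
    using projection by (simp add: implements_projection_def)
  ultimately have "(\<lambda>\<omega>. loo_result lo (P (gossip (\<lambda>j. x m j \<omega>) i) (y (Suc m) i \<omega>))) \<in> borel_measurable ?F"
    by (auto dest: measurable_compose)
  moreover have "(\<lambda>\<omega>. (x (Suc m) i \<omega>, y_tilde (Suc m) i \<omega>)) \<in> borel_measurable ?F \<longleftrightarrow>
      (\<lambda>\<omega>. loo_result lo (P (gossip (\<lambda>j. x m j \<omega>) i) (y (Suc m) i \<omega>))) \<in> borel_measurable ?F"
    using m by (intro measurable_cong) (simp add: projection_step phases_def flip: received_gossip)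
  ultimately have "(\<lambda>\<omega>. (x (Suc m) i \<omega>, y_tilde (Suc m) i \<omega>)) \<in> borel_measurable ?F" by simp
  moreover have "fst \<in> borel_measurable (borel :: ((real^'d) \<times> (real^'d)) measure)"
    "snd \<in> borel_measurable (borel :: ((real^'d) \<times> (real^'d)) measure)"
    by (auto intro!: borel_measurable_continuous_onI continuous_on_fst continuous_on_snd continuous_on_id)
  ultimately show ?case
    by (auto dest: measurable_compose)
qed

lemma phase_of_block: "q < T div L \<Longrightarrow> q div K < phases" "q < T div L \<Longrightarrow> q div K * K \<le> q"
  using params(1) by (simp_all add: horizon(2) less_mult_imp_div_less)

lemma iterate_block_measurable:
  assumes "q < T div L"
  shows "x (q div K) i \<in> borel_measurable (F q)"
  using iterates_measurable[of "q div K" i] phase_of_block(1)[OF assms]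
  by (intro F_measurable_mono[OF phase_of_block(2)[OF assms]]) auto

lemma iterate_block_mem: "q < T div L \<Longrightarrow> \<omega> \<in> space M \<Longrightarrow> x (q div K) i \<omega> \<in> \<K>"
  by (intro iterate_mem less_imp_le phase_of_block)

lemma block_round:
  assumes "q < T div L" "t \<in> {q * L..<Suc q * L}"
  shows "t < T" "t div L = q"
proof -
  have "Suc q * L \<le> T div L * L" using assms(1) by (intro mult_le_mono1) simp
  also have "\<dots> \<le> T" by (rule div_times_less_eq_dividend)
  finally have "Suc q * L \<le> T" .
  with assms(2) show "t < T" by simp
  show "t div L = q" using assms(2) by (intro div_nat_eqI) (auto simp: mult.commute)
qed

lemma round_block: "t < T \<Longrightarrow> t div L < T div L"
  using horizon params(2) by (metis less_mult_imp_div_less)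

definition clamped_grad :: "nat \<Rightarrow> 'n \<Rightarrow> real^'d \<Rightarrow> real^'d" where
  "clamped_grad t i p = grad (f t i) (clamp 0 1 p)"

lemma continuous_clamped_grad':
  "t < T \<Longrightarrow> continuous_on UNIV (clamped_grad t i)"
  using objectives[of t i] unfolding clamped_grad_def regular_objective_def
  by (intro continuous_clamped_grad lipschitz_on_continuous_on) auto

lemma clamped_grad_bounded:
  assumes "t < T"
  obtains B where "0 \<le> B" "\<And>p. norm (clamped_grad t i p) \<le> B"
proof -
  have "continuous_on {0..1} (grad (f t i))"
    using objectives[OF assms, of i] unfolding regular_objective_def by (intro lipschitz_on_continuous_on) auto
  then have "bounded (grad (f t i) ` cbox 0 1)"
    by (intro compact_imp_bounded compact_continuous_image) (auto simp: cube_cbox)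
  then have "bounded (range (clamped_grad t i))"
    unfolding clamped_grad_def by (rule clamp_bounded)
  then obtain B where "\<And>p. norm (clamped_grad t i p) \<le> B"
    unfolding bounded_iff by blast
  then show thesis using that[of B] norm_ge_zero order_trans by blast
qed

lemma scheme_facts:
  shows "prob_space (z_law \<sigma>)" "0 \<le> ratio \<sigma>" "p \<in> \<K> \<Longrightarrow> out_map \<sigma> p \<in> \<K>"
    "p \<in> \<K> \<Longrightarrow> z \<in> {0..1} \<Longrightarrow> query_map \<sigma> p z \<in> \<K>"
    "norm (out_map \<sigma> p - out_map \<sigma> p') \<le> norm (p - p')"
    "continuous_on UNIV (out_map \<sigma>)" "continuous_on UNIV (\<lambda>(p, z). query_map \<sigma> p z)"
  using scheme by (auto simp: admissible_scheme_def)

lemma sets_z_law [simp]: "sets (z_law \<sigma>) = sets borel" and space_z_law [simp]: "space (z_law \<sigma>) = UNIV"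
  by (simp_all add: z_law_def)

text \<open>The joint law of the draws of all agents, with no constraint on the draws of the agents other
  than \<open>j\<close>.\<close>

lemma sampling_single:
  assumes q: "q < T div L" and s: "s \<in> {q * L..<Suc q * L}" and D: "D \<in> sets (F q)" and U: "U \<in> sets borel"
  shows "prob (D \<inter> {\<omega> \<in> space M. Z q j \<omega> \<in> U \<and> S q j \<omega> = s}) = prob D * measure (z_law \<sigma>) U / real L"
proof -
  interpret z: prob_space "z_law \<sigma>" by (rule scheme_facts)
  \<comment> \<open>the factors of all other agents are total masses\<close>
  define U' where "U' i = (if i = j then U else UNIV)" for i
  define V where "V i = (if i = j then {s} else UNIV)" for i
  let ?w = "\<lambda>i. measure (z_law \<sigma>) (U' i) * measure_pmf.prob (pmf_of_set {q * L..<Suc q * L}) (V i)"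
  have ne: "{q * L..<Suc q * L} \<noteq> {}" using params(2) by simp
  have "{\<omega> \<in> space M. \<forall>i. Z q i \<omega> \<in> U' i \<and> S q i \<omega> \<in> V i} = {\<omega> \<in> space M. Z q j \<omega> \<in> U \<and> S q j \<omega> = s}"
    by (auto simp: U'_def V_def)
  then have "prob (D \<inter> {\<omega> \<in> space M. Z q j \<omega> \<in> U \<and> S q j \<omega> = s}) = prob D * (\<Prod>i\<in>UNIV. ?w i)"
    using sampling[OF q D, of U' V] U by (simp add: U'_def)
  also have "(\<Prod>i\<in>UNIV. ?w i) = ?w j * (\<Prod>i\<in>UNIV - {j}. ?w i)"
    by (rule prod.remove) auto
  also have "(\<Prod>i\<in>UNIV - {j}. ?w i) = 1"
    using z.prob_space measure_pmf.prob_space[of "pmf_of_set {q * L..<Suc q * L}"]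
    by (intro prod.neutral) (auto simp: U'_def V_def)
  also have "?w j = measure (z_law \<sigma>) U / real L"
    using s ne by (simp add: U'_def V_def measure_pmf_single pmf_of_set)
  finally show ?thesis by simp
qed

text \<open>Reweighting \<open>M\<close> by \<open>L\<close> on the event that round \<open>s\<close> is drawn gives a measure under which \<open>X\<close> keeps
  its law and \<open>Z\<close> is an independent sample of \<open>z_law\<close>. So the joint law of \<open>(X, Z)\<close> is a product measure,
  and the claim is Fubini's theorem. Only rectangles have to be checked.\<close>

lemma sample_expectation:
  fixes \<phi> :: "(real^'d) \<times> real \<Rightarrow> real"
  assumes q: "q < T div L" and s: "s \<in> {q * L..<Suc q * L}"
    and X: "X \<in> borel_measurable (F q)"
    and \<phi>: "\<phi> \<in> borel_measurable borel" and bound: "\<And>p. \<bar>\<phi> p\<bar> \<le> B"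
  shows "real L * (\<integral>\<omega>. indicator {s} (S q j \<omega>) * \<phi> (X \<omega>, Z q j \<omega>) \<partial>M)
       = (\<integral>\<omega>. (\<integral>z. \<phi> (X \<omega>, z) \<partial>z_law \<sigma>) \<partial>M)"
    and "integrable M (\<lambda>\<omega>. \<integral>z. \<phi> (X \<omega>, z) \<partial>z_law \<sigma>)"
proof -
  interpret z: prob_space "z_law \<sigma>" by (rule scheme_facts)
  have XM [measurable]: "X \<in> borel_measurable M" by (rule F_measurable_M[OF X])
  have ZM [measurable]: "Z q j \<in> borel_measurable M" by (rule H_measurable_M[OF Z_measurable[OF q]])
  have SM [measurable]: "S q j \<in> measurable M (count_space UNIV)" by (rule H_measurable_M[OF S_measurable[OF q]])
  have \<phi>' [measurable]: "\<phi> \<in> borel_measurable (borel \<Otimes>\<^sub>M borel)" using \<phi> by (simp add: borel_prod)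
  interpret X: prob_space "distr M borel X" by (rule prob_space_distr) simp
  interpret XZ: pair_prob_space "distr M borel X" "z_law \<sigma>" ..
  define ind where "ind \<omega> = real L * indicator {s} (S q j \<omega>)" for \<omega>
  have "(\<lambda>\<omega>. indicator {s} (S q j \<omega>) :: real) \<in> borel_measurable M"
    by (rule measurable_compose[OF SM]) simp
  then have ind_m [measurable]: "ind \<in> borel_measurable M"
    unfolding ind_def by measurable
  define N where "N = density M (\<lambda>\<omega>. ennreal (ind \<omega>))"
  have sN: "sets N = sets M" by (simp add: N_def)
  have XZ_m [measurable]: "(\<lambda>\<omega>. (X \<omega>, Z q j \<omega>)) \<in> measurable M (borel \<Otimes>\<^sub>M borel)" by measurable
  then have XZ_N: "(\<lambda>\<omega>. (X \<omega>, Z q j \<omega>)) \<in> measurable N (borel \<Otimes>\<^sub>M borel)"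
    by (simp add: measurable_cong_sets[OF sN refl])
  have joint: "distr M borel X \<Otimes>\<^sub>M z_law \<sigma> = distr N (borel \<Otimes>\<^sub>M borel) (\<lambda>\<omega>. (X \<omega>, Z q j \<omega>))"
  proof (rule pair_measure_eqI)
    show "sigma_finite_measure (distr M borel X)" "sigma_finite_measure (z_law \<sigma>)"
      by unfold_locales
    show "sets (distr M borel X \<Otimes>\<^sub>M z_law \<sigma>) = sets (distr N (borel \<Otimes>\<^sub>M borel) (\<lambda>\<omega>. (X \<omega>, Z q j \<omega>)))"
      by (simp cong: sets_pair_measure_cong)
    fix V U assume "V \<in> sets (distr M borel X)" "U \<in> sets (z_law \<sigma>)"
    then have V [measurable]: "V \<in> sets borel" and U [measurable]: "U \<in> sets borel" by auto
    define D where "D = X -` V \<inter> space M"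
    have D: "D \<in> sets (F q)" using measurable_sets[OF X V] by (simp add: D_def)
    have W: "{\<omega> \<in> space M. Z q j \<omega> \<in> U \<and> S q j \<omega> = s} \<in> sets M" by measurable
    have DM: "D \<in> sets M" using D subalgebras(1) by (auto simp: subalgebra_def)
    let ?W = "D \<inter> {\<omega> \<in> space M. Z q j \<omega> \<in> U \<and> S q j \<omega> = s}"
    have "emeasure (distr N (borel \<Otimes>\<^sub>M borel) (\<lambda>\<omega>. (X \<omega>, Z q j \<omega>))) (V \<times> U)
        = emeasure N ((\<lambda>\<omega>. (X \<omega>, Z q j \<omega>)) -` (V \<times> U) \<inter> space N)"
      using XZ_N by (intro emeasure_distr) auto
    also have "\<dots> = (\<integral>\<^sup>+\<omega>. ennreal (ind \<omega>) * indicator ((\<lambda>\<omega>. (X \<omega>, Z q j \<omega>)) -` (V \<times> U) \<inter> space M) \<omega> \<partial>M)"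
      unfolding N_def by (subst emeasure_density) (auto intro!: measurable_sets[OF XZ_m])
    also have "\<dots> = (\<integral>\<^sup>+\<omega>. ennreal (real L) * indicator ?W \<omega> \<partial>M)"
      by (intro nn_integral_cong) (auto simp: ind_def D_def split: split_indicator)
    also have "\<dots> = ennreal (real L) * emeasure M ?W"
      using W DM by (intro nn_integral_cmult_indicator) auto
    also have "\<dots> = ennreal (real L * (prob D * measure (z_law \<sigma>) U / real L))"
      by (simp add: emeasure_eq_measure sampling_single[OF q s D U] ennreal_mult' flip: ennreal_mult)
    also have "\<dots> = emeasure M D * emeasure (z_law \<sigma>) U"
      using params(2) by (simp add: emeasure_eq_measure z.emeasure_eq_measure ennreal_mult')
    also have "emeasure M D = emeasure (distr M borel X) V"
      by (simp add: emeasure_distr D_def)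
    finally show "emeasure (distr M borel X) V * emeasure (z_law \<sigma>) U
        = emeasure (distr N (borel \<Otimes>\<^sub>M borel) (\<lambda>\<omega>. (X \<omega>, Z q j \<omega>))) (V \<times> U)" by simp
  qed
  have \<phi>_int: "integrable (distr M borel X \<Otimes>\<^sub>M z_law \<sigma>) \<phi>"
  proof (rule XZ.integrable_const_bound)
    show "AE p in distr M borel X \<Otimes>\<^sub>M z_law \<sigma>. norm (\<phi> p) \<le> B" using bound by simp
    show "\<phi> \<in> borel_measurable (distr M borel X \<Otimes>\<^sub>M z_law \<sigma>)"
      by (subst measurable_cong_sets[of _ "borel \<Otimes>\<^sub>M borel"]) (auto cong: sets_pair_measure_cong)
  qed
  have inner_m: "(\<lambda>p. \<integral>z. \<phi> (p, z) \<partial>z_law \<sigma>) \<in> borel_measurable (distr M borel X)"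
    using XZ.integrable_fst'[OF \<phi>_int] by (rule borel_measurable_integrable)
  have "real L * (\<integral>\<omega>. indicator {s} (S q j \<omega>) * \<phi> (X \<omega>, Z q j \<omega>) \<partial>M)
      = (\<integral>\<omega>. ind \<omega> *\<^sub>R \<phi> (X \<omega>, Z q j \<omega>) \<partial>M)"
    by (simp add: ind_def mult.assoc)
  also have "\<dots> = (\<integral>\<omega>. \<phi> (X \<omega>, Z q j \<omega>) \<partial>N)"
    unfolding N_def by (rule integral_density[symmetric, OF _ ind_m]) (measurable, simp add: ind_def)
  also have "\<dots> = (\<integral>p. \<phi> p \<partial>distr N (borel \<Otimes>\<^sub>M borel) (\<lambda>\<omega>. (X \<omega>, Z q j \<omega>)))"
    using XZ_N by (intro integral_distr[symmetric]) auto
  also have "\<dots> = (\<integral>p. (\<integral>z. \<phi> (p, z) \<partial>z_law \<sigma>) \<partial>distr M borel X)"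
    unfolding joint[symmetric] by (rule XZ.integral_fst'[OF \<phi>_int, symmetric])
  also have "\<dots> = (\<integral>\<omega>. (\<integral>z. \<phi> (X \<omega>, z) \<partial>z_law \<sigma>) \<partial>M)"
    using inner_m by (intro integral_distr) auto
  finally show "real L * (\<integral>\<omega>. indicator {s} (S q j \<omega>) * \<phi> (X \<omega>, Z q j \<omega>) \<partial>M)
       = (\<integral>\<omega>. (\<integral>z. \<phi> (X \<omega>, z) \<partial>z_law \<sigma>) \<partial>M)" .
  show "integrable M (\<lambda>\<omega>. \<integral>z. \<phi> (X \<omega>, z) \<partial>z_law \<sigma>)"
    using XZ.integrable_fst'[OF \<phi>_int] inner_m by (subst (asm) integrable_distr_eq) auto
qed

lemma resp_integrable:
  assumes q: "q < T div L" and u: "u \<in> \<K>"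
  shows "integrable M (\<lambda>\<omega>. resp q j \<omega> \<bullet> (u - x (q div K) j \<omega>))"
proof (rule integrable_const_bound)
  show "AE \<omega> in M. norm (resp q j \<omega> \<bullet> (u - x (q div K) j \<omega>)) \<le> G * (2 * R)"
  proof (rule AE_I2)
    fix \<omega> assume \<omega>: "\<omega> \<in> space M"
    have "norm (u - x (q div K) j \<omega>) \<le> 2 * R"
      using norm_triangle_ineq4[of u "x (q div K) j \<omega>"] norm_le_R[OF u] norm_le_R[OF iterate_block_mem[OF q \<omega>, of j]]
      by linarith
    then show "norm (resp q j \<omega> \<bullet> (u - x (q div K) j \<omega>)) \<le> G * (2 * R)"
      using Cauchy_Schwarz_ineq2[of "resp q j \<omega>" "u - x (q div K) j \<omega>"] oracle_bound[OF q \<omega>, of j] params(5)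
      by (smt (verit) mult_mono norm_ge_zero real_norm_def)
  qed
  show "(\<lambda>\<omega>. resp q j \<omega> \<bullet> (u - x (q div K) j \<omega>)) \<in> borel_measurable M"
    using F_measurable_M[OF resp_measurable[OF q]] F_measurable_M[OF iterate_block_measurable[OF q]]
    by (intro borel_measurable_inner borel_measurable_diff borel_measurable_const) auto
qed

lemma measurable_component: "h \<in> borel_measurable N \<Longrightarrow> (\<lambda>\<omega>. (h \<omega> :: real^'d) $ k) \<in> borel_measurable N"
  by (rule measurable_compose[OF _ borel_measurable_continuous_onI]) (auto intro!: continuous_intros)

text \<open>The response is replaced coordinate by coordinate by its conditional expectation given the draws of
  the block, since \<open>u - X\<close> is known at that time. The sum over \<open>s\<close> has a single nonzero term; it
  displays the random query round as a finite case distinction.\<close>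

lemma query_gradient_expectation:
  fixes j :: 'n
  assumes q: "q < T div L" and u: "u \<in> \<K>"
  defines "X \<equiv> x (q div K) j"
  shows "(\<integral>\<omega>. resp q j \<omega> \<bullet> (u - X \<omega>) \<partial>M)
    = (\<integral>\<omega>. (\<Sum>s\<in>{q * L..<Suc q * L}. indicator {s} (S q j \<omega>) *
         (clamped_grad s j (query_map \<sigma> (X \<omega>) (Z q j \<omega>)) \<bullet> (u - X \<omega>))) \<partial>M)"
proof -
  let ?B = "{q * L..<Suc q * L}"
  interpret H: sigma_finite_subalgebra M "H q"
    by (intro finite_measure_subalgebra_is_sigma_finite)
       (simp add: finite_measure_subalgebra_def finite_measure_subalgebra_axioms_def subalgebras finite_measure_axioms)
  define g where "g \<omega> = (\<Sum>s\<in>?B. indicator {s} (S q j \<omega>) *\<^sub>R clamped_grad s j (query_map \<sigma> (X \<omega>) (Z q j \<omega>)))" for \<omega>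
  have XH: "X \<in> borel_measurable (H q)"
    unfolding X_def by (intro F_measurable_H iterate_block_measurable q)
  have rM: "resp q j \<in> borel_measurable M" by (rule F_measurable_M[OF resp_measurable[OF q]])
  have Xmem: "X \<omega> \<in> \<K>" if "\<omega> \<in> space M" for \<omega>
    unfolding X_def by (rule iterate_block_mem[OF q that])
  have gH: "g \<in> borel_measurable (H q)"
  proof -
    have "(\<lambda>\<omega>. query_map \<sigma> (X \<omega>) (Z q j \<omega>)) \<in> borel_measurable (H q)"
      using measurable_compose[OF borel_measurable_Pair[OF XH Z_measurable[OF q, of j]]
          borel_measurable_continuous_onI[OF scheme_facts(7)]] by simp
    then have "(\<lambda>\<omega>. clamped_grad s j (query_map \<sigma> (X \<omega>) (Z q j \<omega>))) \<in> borel_measurable (H q)" if "s \<in> ?B" for s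
      using borel_measurable_continuous_onI[OF continuous_clamped_grad'[OF block_round(1)[OF q that]]]
      by (rule measurable_compose)
    moreover have "(\<lambda>\<omega>. indicator {s} (S q j \<omega>) :: real) \<in> borel_measurable (H q)" for s
      by (rule measurable_compose[OF S_measurable[OF q]]) simp
    ultimately show ?thesis
      unfolding g_def by (intro borel_measurable_sum borel_measurable_scaleR)
  qed
  have g_eq: "grad (f (S q j \<omega>) j) (play (S q j \<omega>) j \<omega>) = g \<omega>" if \<omega>: "\<omega> \<in> space M" for \<omega>
  proof -
    have s: "S q j \<omega> \<in> ?B" by (rule S_range[OF q \<omega>])
    have z: "Z q j \<omega> \<in> {0..1}" by (rule Z_range[OF q \<omega>])
    have "play (S q j \<omega>) j \<omega> = query_map \<sigma> (X \<omega>) (Z q j \<omega>)"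
      using play[OF block_round(1)[OF q s] \<omega>, of j] block_round(2)[OF q s] by (simp add: X_def Let_def)
    moreover have "query_map \<sigma> (X \<omega>) (Z q j \<omega>) \<in> {0..1}"
      using scheme_facts(4)[OF Xmem[OF \<omega>] z] domain(3) by blast
    moreover have "g \<omega> = clamped_grad (S q j \<omega>) j (query_map \<sigma> (X \<omega>) (Z q j \<omega>))"
    proof -
      have "g \<omega> = (\<Sum>s\<in>?B. if s = S q j \<omega> then clamped_grad s j (query_map \<sigma> (X \<omega>) (Z q j \<omega>)) else 0)"
        unfolding g_def by (intro sum.cong) auto
      then show ?thesis using s by simp
    qed
    ultimately show ?thesis by (simp only: clamped_grad_def clamp_cube)
  qed
  have comp: "(\<integral>\<omega>. (u - X \<omega>) $ k * resp q j \<omega> $ k \<partial>M) = (\<integral>\<omega>. (u - X \<omega>) $ k * g \<omega> $ k \<partial>M)"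
    and int1: "integrable M (\<lambda>\<omega>. (u - X \<omega>) $ k * resp q j \<omega> $ k)"
    and int2: "integrable M (\<lambda>\<omega>. (u - X \<omega>) $ k * g \<omega> $ k)" for k
  proof -
    have wH: "(\<lambda>\<omega>. (u - X \<omega>) $ k) \<in> borel_measurable (H q)"
      using XH by (intro measurable_component borel_measurable_diff) auto
    have rkM: "(\<lambda>\<omega>. resp q j \<omega> $ k) \<in> borel_measurable M"
      using rM by (rule measurable_component)
    have wM: "(\<lambda>\<omega>. (u - X \<omega>) $ k) \<in> borel_measurable M" by (rule H_measurable_M[OF wH])
    show int1: "integrable M (\<lambda>\<omega>. (u - X \<omega>) $ k * resp q j \<omega> $ k)"
    proof (rule integrable_const_bound)
      show "AE \<omega> in M. norm ((u - X \<omega>) $ k * resp q j \<omega> $ k) \<le> (2 * R) * G"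
      proof (rule AE_I2)
        fix \<omega> assume \<omega>: "\<omega> \<in> space M"
        have "\<bar>(u - X \<omega>) $ k\<bar> \<le> 2 * R"
          using norm_triangle_ineq4[of u "X \<omega>"] norm_le_R[OF u] norm_le_R[OF Xmem[OF \<omega>]]
            component_le_norm_cart[of "u - X \<omega>" k] by linarith
        moreover have "\<bar>resp q j \<omega> $ k\<bar> \<le> G"
          using component_le_norm_cart[of "resp q j \<omega>" k] oracle_bound[OF q \<omega>, of j] by linarith
        ultimately show "norm ((u - X \<omega>) $ k * resp q j \<omega> $ k) \<le> (2 * R) * G"
          unfolding real_norm_def abs_mult using R_nonneg by (intro mult_mono) auto
      qed
      show "(\<lambda>\<omega>. (u - X \<omega>) $ k * resp q j \<omega> $ k) \<in> borel_measurable M"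
        by (intro borel_measurable_times wM rkM)
    qed
    have ae: "AE \<omega> in M. (u - X \<omega>) $ k * real_cond_exp M (H q) (\<lambda>\<omega>. resp q j \<omega> $ k) \<omega> = (u - X \<omega>) $ k * g \<omega> $ k"
      using oracle_mean[OF q, of j k] by (rule AE_mp) (auto intro!: AE_I2 simp: g_eq)
    have gM: "(\<lambda>\<omega>. (u - X \<omega>) $ k * g \<omega> $ k) \<in> borel_measurable M"
      by (intro borel_measurable_times wM measurable_component H_measurable_M[OF gH])
    have i: "integrable M (\<lambda>\<omega>. (u - X \<omega>) $ k * real_cond_exp M (H q) (\<lambda>\<omega>. resp q j \<omega> $ k) \<omega>)"
      by (rule H.real_cond_exp_intg(1)[OF int1 wH rkM])
    have "(\<integral>\<omega>. (u - X \<omega>) $ k * resp q j \<omega> $ k \<partial>M)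
        = (\<integral>\<omega>. (u - X \<omega>) $ k * real_cond_exp M (H q) (\<lambda>\<omega>. resp q j \<omega> $ k) \<omega> \<partial>M)"
      by (rule H.real_cond_exp_intg(2)[OF int1 wH rkM, symmetric])
    also have "\<dots> = (\<integral>\<omega>. (u - X \<omega>) $ k * g \<omega> $ k \<partial>M)"
      using ae gM i by (intro integral_cong_AE) auto
    finally show "(\<integral>\<omega>. (u - X \<omega>) $ k * resp q j \<omega> $ k \<partial>M) = (\<integral>\<omega>. (u - X \<omega>) $ k * g \<omega> $ k \<partial>M)" .
    show "integrable M (\<lambda>\<omega>. (u - X \<omega>) $ k * g \<omega> $ k)"
      using integrable_cong_AE_imp[OF i gM] ae by auto
  qed
  have "(\<integral>\<omega>. resp q j \<omega> \<bullet> (u - X \<omega>) \<partial>M) = (\<Sum>k\<in>UNIV. \<integral>\<omega>. (u - X \<omega>) $ k * resp q j \<omega> $ k \<partial>M)"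
    using int1 by (subst Bochner_Integration.integral_sum[symmetric]) (auto simp: inner_vec_def mult.commute)
  also have "\<dots> = (\<integral>\<omega>. g \<omega> \<bullet> (u - X \<omega>) \<partial>M)"
    unfolding comp
    using int2 by (subst Bochner_Integration.integral_sum[symmetric]) (auto simp: inner_vec_def mult.commute)
  finally show ?thesis by (simp add: g_def inner_sum_left)
qed

lemma integrable_cube_function:
  fixes h :: "real^'d \<Rightarrow> real"
  assumes h: "continuous_on {0..1} h" and X: "X \<in> borel_measurable M"
    and mem: "\<And>\<omega>. \<omega> \<in> space M \<Longrightarrow> X \<omega> \<in> {0..1}"
  shows "integrable M (\<lambda>\<omega>. h (X \<omega>))"
proof -
  have "bounded (h ` cbox 0 1)"
    using h by (intro compact_imp_bounded compact_continuous_image) (auto simp: cube_cbox)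
  then obtain B where B: "\<And>p. norm (h (clamp 0 1 p)) \<le> B"
    using clamp_bounded[of h 0 1] unfolding bounded_iff by blast
  have "continuous_on UNIV (\<lambda>p. h (clamp 0 1 p))"
    using h unfolding cube_cbox by (rule clamp_continuous_on)
  then have "(\<lambda>\<omega>. h (clamp 0 1 (X \<omega>))) \<in> borel_measurable M"
    by (rule measurable_compose[OF X borel_measurable_continuous_onI])
  then have "integrable M (\<lambda>\<omega>. h (clamp 0 1 (X \<omega>)))"
    using B by (intro integrable_const_bound) auto
  moreover have "integrable M (\<lambda>\<omega>. h (clamp 0 1 (X \<omega>))) \<longleftrightarrow> integrable M (\<lambda>\<omega>. h (X \<omega>))"
    using mem by (intro Bochner_Integration.integrable_cong) (simp_all only: clamp_cube)
  ultimately show ?thesis by simp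
qed

lemma objective_continuous: "t < T \<Longrightarrow> continuous_on {0..1} (f t i)"
  using objectives by (auto simp: regular_objective_def)

lemma out_value_integrable:
  assumes "q < T div L" "t < T"
  shows "integrable M (\<lambda>\<omega>. f t j (out_map \<sigma> (x (q div K) j \<omega>)))"
proof (rule integrable_cube_function[OF objective_continuous[OF assms(2)]])
  show "(\<lambda>\<omega>. out_map \<sigma> (x (q div K) j \<omega>)) \<in> borel_measurable M"
    by (rule measurable_compose[OF F_measurable_M[OF iterate_block_measurable[OF assms(1)]]
        borel_measurable_continuous_onI[OF scheme_facts(6)]])
  show "out_map \<sigma> (x (q div K) j \<omega>) \<in> {0..1}" if "\<omega> \<in> space M" for \<omega>
    using scheme_facts(3)[OF iterate_block_mem[OF assms(1) that]] domain(3) by blast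
qed

text \<open>Conditioning on the draws, and then averaging over them, turns the response into the uniform average
  of the surrogate gradients over the block, to which the linear bounds of the objectives apply.
  The factor \<open>L\<close> compensates the uniform choice of the query round.\<close>

lemma block_linearization:
  assumes q: "q < T div L" and u: "u \<in> \<K>"
  shows "(\<Sum>s\<in>{q * L..<Suc q * L}. \<integral>\<omega>. ratio \<sigma> * f s j u - f s j (out_map \<sigma> (x (q div K) j \<omega>)) \<partial>M)
    \<le> \<beta> * real L * (\<integral>\<omega>. resp q j \<omega> \<bullet> (u - x (q div K) j \<omega>) \<partial>M)"
proof -
  let ?B = "{q * L..<Suc q * L}"
  define X where "X = x (q div K) j"
  have XF: "X \<in> borel_measurable (F q)" unfolding X_def by (rule iterate_block_measurable[OF q])
  have Xmem: "X \<omega> \<in> \<K>" if "\<omega> \<in> space M" for \<omega>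
    unfolding X_def by (rule iterate_block_mem[OF q that])
  have Kb: "\<K> \<in> sets borel" using domain(2) by (simp add: borel_compact)
  \<comment> \<open>the indicator makes the function bounded and is \<open>1\<close> at the iterates\<close>
  define \<phi> where "\<phi> s = (\<lambda>(p, z). indicator \<K> p * (clamped_grad s j (query_map \<sigma> p z) \<bullet> (u - p)))" for s
  have \<phi>m: "\<phi> s \<in> borel_measurable borel" if "s \<in> ?B" for s
  proof -
    have "continuous_on UNIV (\<lambda>r. clamped_grad s j ((\<lambda>(p, z). query_map \<sigma> p z) r) \<bullet> (u - fst r))"
      by (intro continuous_intros continuous_on_compose2[OF continuous_clamped_grad'[OF block_round(1)[OF q that]]]
          scheme_facts(7)) auto
    then have "(\<lambda>r. clamped_grad s j (query_map \<sigma> (fst r) (snd r)) \<bullet> (u - fst r)) \<in> borel_measurable borel"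
      by (intro borel_measurable_continuous_onI) (simp add: split_beta)
    moreover have "(\<lambda>r :: (real^'d) \<times> real. indicator \<K> (fst r) :: real) \<in> borel_measurable borel"
      using Kb by (intro measurable_compose[OF borel_measurable_continuous_onI borel_measurable_indicator])
         (auto intro!: continuous_intros)
    ultimately show ?thesis unfolding \<phi>_def split_beta by (rule borel_measurable_times[rotated])
  qed
  have \<phi>b: "\<exists>B. \<forall>r. \<bar>\<phi> s r\<bar> \<le> B" if s: "s \<in> ?B" for s
  proof -
    obtain B where B: "0 \<le> B" "\<And>p. norm (clamped_grad s j p) \<le> B"
      using clamped_grad_bounded[OF block_round(1)[OF q s]] by blast
    have "\<bar>\<phi> s (p, z)\<bar> \<le> B * (2 * R)" for p z
    proof (cases "p \<in> \<K>")
      case True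
      have "norm (u - p) \<le> 2 * R"
        using norm_triangle_ineq4[of u p] norm_le_R[OF u] norm_le_R[OF True] by linarith
      then have "norm (clamped_grad s j (query_map \<sigma> p z)) * norm (u - p) \<le> B * (2 * R)"
        using B by (intro mult_mono) auto
      then show ?thesis
        using True Cauchy_Schwarz_ineq2[of "clamped_grad s j (query_map \<sigma> p z)" "u - p"] by (simp add: \<phi>_def)
    next
      case False
      then show ?thesis using B R_nonneg by (simp add: \<phi>_def)
    qed
    then show ?thesis by auto
  qed
  have lin: "(\<integral>\<omega>. ratio \<sigma> * f s j u - f s j (out_map \<sigma> (X \<omega>)) \<partial>M)
      \<le> \<beta> * (real L * (\<integral>\<omega>. indicator {s} (S q j \<omega>) * \<phi> s (X \<omega>, Z q j \<omega>) \<partial>M))" if s: "s \<in> ?B" for s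
  proof -
    obtain B where B: "\<And>r. \<bar>\<phi> s r\<bar> \<le> B" using \<phi>b[OF s] by blast
    note se = sample_expectation[OF q s XF \<phi>m[OF s] B]
    have "(\<integral>\<omega>. ratio \<sigma> * f s j u - f s j (out_map \<sigma> (X \<omega>)) \<partial>M)
        \<le> (\<integral>\<omega>. \<beta> * (\<integral>z. \<phi> s (X \<omega>, z) \<partial>z_law \<sigma>) \<partial>M)"
    proof (rule integral_mono)
      show "integrable M (\<lambda>\<omega>. ratio \<sigma> * f s j u - f s j (out_map \<sigma> (X \<omega>)))"
        unfolding X_def by (intro Bochner_Integration.integrable_diff out_value_integrable q block_round(1)[OF q s]) auto
      show "integrable M (\<lambda>\<omega>. \<beta> * (\<integral>z. \<phi> s (X \<omega>, z) \<partial>z_law \<sigma>))"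
        using se(2) by simp
      show "ratio \<sigma> * f s j u - f s j (out_map \<sigma> (X \<omega>)) \<le> \<beta> * (\<integral>z. \<phi> s (X \<omega>, z) \<partial>z_law \<sigma>)"
        if "\<omega> \<in> space M" for \<omega>
        using linear_bound(1)[OF block_round(1)[OF q s], of j] Xmem[OF that] u
        by (simp add: linearizable_def \<phi>_def clamped_grad_def)
    qed
    then show ?thesis using se(1) by simp
  qed
  have int: "integrable M (\<lambda>\<omega>. indicator {s} (S q j \<omega>) * \<phi> s (X \<omega>, Z q j \<omega>))" if s: "s \<in> ?B" for s
  proof -
    obtain B where B: "\<And>r. \<bar>\<phi> s r\<bar> \<le> B" using \<phi>b[OF s] by blast
    have "0 \<le> B" using B[of undefined] by linarith
    show ?thesis
    proof (rule integrable_const_bound)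
      show "AE \<omega> in M. norm (indicator {s} (S q j \<omega>) * \<phi> s (X \<omega>, Z q j \<omega>)) \<le> B"
        using B \<open>0 \<le> B\<close> by (auto simp: indicator_def)
      have "(\<lambda>\<omega>. indicator {s} (S q j \<omega>) :: real) \<in> borel_measurable M"
        by (rule measurable_compose[OF H_measurable_M[OF S_measurable[OF q]]]) simp
      moreover have "(\<lambda>\<omega>. \<phi> s (X \<omega>, Z q j \<omega>)) \<in> borel_measurable M"
        using \<phi>m[OF s]
        by (rule measurable_compose[rotated])
           (intro borel_measurable_Pair F_measurable_M[OF XF] H_measurable_M[OF Z_measurable[OF q]])
      ultimately show "(\<lambda>\<omega>. indicator {s} (S q j \<omega>) * \<phi> s (X \<omega>, Z q j \<omega>)) \<in> borel_measurable M"
        by (rule borel_measurable_times)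
    qed
  qed
  have "(\<Sum>s\<in>?B. \<integral>\<omega>. ratio \<sigma> * f s j u - f s j (out_map \<sigma> (X \<omega>)) \<partial>M)
      \<le> (\<Sum>s\<in>?B. \<beta> * (real L * (\<integral>\<omega>. indicator {s} (S q j \<omega>) * \<phi> s (X \<omega>, Z q j \<omega>) \<partial>M)))"
    by (intro sum_mono lin)
  also have "\<dots> = \<beta> * real L * (\<Sum>s\<in>?B. \<integral>\<omega>. indicator {s} (S q j \<omega>) * \<phi> s (X \<omega>, Z q j \<omega>) \<partial>M)"
    by (simp only: sum_distrib_left mult.assoc)
  also have "(\<Sum>s\<in>?B. \<integral>\<omega>. indicator {s} (S q j \<omega>) * \<phi> s (X \<omega>, Z q j \<omega>) \<partial>M)
      = (\<integral>\<omega>. (\<Sum>s\<in>?B. indicator {s} (S q j \<omega>) * \<phi> s (X \<omega>, Z q j \<omega>)) \<partial>M)"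
    by (rule Bochner_Integration.integral_sum[symmetric]) (rule int)
  also have "(\<integral>\<omega>. (\<Sum>s\<in>?B. indicator {s} (S q j \<omega>) * \<phi> s (X \<omega>, Z q j \<omega>)) \<partial>M)
      = (\<integral>\<omega>. resp q j \<omega> \<bullet> (u - X \<omega>) \<partial>M)"
    unfolding X_def query_gradient_expectation[OF q u]
  proof (rule Bochner_Integration.integral_cong[OF refl])
    fix \<omega> assume "\<omega> \<in> space M"
    then have "x (q div K) j \<omega> \<in> \<K>" using Xmem by (simp add: X_def)
    then show "(\<Sum>s\<in>?B. indicator {s} (S q j \<omega>) * \<phi> s (x (q div K) j \<omega>, Z q j \<omega>))
        = (\<Sum>s\<in>?B. indicator {s} (S q j \<omega>) *
            (clamped_grad s j (query_map \<sigma> (x (q div K) j \<omega>) (Z q j \<omega>)) \<bullet> (u - x (q div K) j \<omega>)))"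
      by (simp add: \<phi>_def)
  qed
  finally show ?thesis by (simp add: X_def)
qed

end

section \<open>Regret and complexity\<close>

text \<open>All quantities are powers of \<open>T\<close>; the identities compare their exponents.\<close>

lemma tuned_parameters:
  fixes T K L :: nat and \<eta> G \<theta> :: real
  assumes T: "0 < T" and K: "real K = real T powr (1 - 3 * \<theta> / 2)"
    and L: "real L = real T powr (\<theta> / 2)" and \<eta>: "\<eta> = real T powr (\<theta> - 1)"
  shows "real L / \<eta> = real T powr (1 - \<theta> / 2)"
    and "\<eta> * real T * real K * G\<^sup>2 = G\<^sup>2 * real T powr (1 - \<theta> / 2)"
    and "real T / real L = real T powr (1 - \<theta> / 2)"
    and "real T / ((real K)\<^sup>2 * \<eta>\<^sup>2 * G\<^sup>2 * real K * real L) = real T powr (2 * \<theta>) / G\<^sup>2"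
    and "real T / (real K * real L) = real T powr \<theta>"
proof -
  define l where "l = ln (real T)"
  have pw: "real T powr a = exp (a * l)" for a using T by (simp add: powr_def l_def)
  have T1: "real T = exp l" using T by (simp add: l_def)
  have K': "real K = exp ((1 - 3 * \<theta> / 2) * l)" and L': "real L = exp (\<theta> / 2 * l)" and \<eta>': "\<eta> = exp ((\<theta> - 1) * l)"
    using K L \<eta> pw by auto
  show "real L / \<eta> = real T powr (1 - \<theta> / 2)"
    unfolding pw L' \<eta>' by (simp add: exp_diff[symmetric] algebra_simps)
  have "\<eta> * real T * real K = exp ((\<theta> - 1) * l + l + (1 - 3 * \<theta> / 2) * l)"
    unfolding T1 K' \<eta>' by (simp only: exp_add)
  also have "(\<theta> - 1) * l + l + (1 - 3 * \<theta> / 2) * l = (1 - \<theta> / 2) * l" by (simp add: field_simps)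
  finally show "\<eta> * real T * real K * G\<^sup>2 = G\<^sup>2 * real T powr (1 - \<theta> / 2)"
    by (simp add: pw)
  have "real T / real L = exp (l - \<theta> / 2 * l)" unfolding T1 L' by (simp only: exp_diff)
  then show "real T / real L = real T powr (1 - \<theta> / 2)" unfolding pw by (simp add: algebra_simps)
  have "real T / (real K * real L) = exp (l - ((1 - 3 * \<theta> / 2) * l + \<theta> / 2 * l))"
    unfolding T1 L' K' by (simp only: exp_diff exp_add)
  also have "l - ((1 - 3 * \<theta> / 2) * l + \<theta> / 2 * l) = \<theta> * l" by (simp add: field_simps)
  finally show "real T / (real K * real L) = real T powr \<theta>" by (simp add: pw)
  have "real T / ((real K)\<^sup>2 * \<eta>\<^sup>2 * real K * real L)
      = exp (l - ((1 - 3 * \<theta> / 2) * l + (1 - 3 * \<theta> / 2) * l + ((\<theta> - 1) * l + (\<theta> - 1) * l) + (1 - 3 * \<theta> / 2) * l + \<theta> / 2 * l))"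
    unfolding T1 L' K' \<eta>' by (simp only: exp_diff exp_add power2_eq_square)
  also have "l - ((1 - 3 * \<theta> / 2) * l + (1 - 3 * \<theta> / 2) * l + ((\<theta> - 1) * l + (\<theta> - 1) * l) + (1 - 3 * \<theta> / 2) * l + \<theta> / 2 * l)
      = 2 * \<theta> * l" by (simp add: field_simps)
  finally have "real T / ((real K)\<^sup>2 * \<eta>\<^sup>2 * real K * real L) = real T powr (2 * \<theta>)" by (simp add: pw)
  moreover have "real T / ((real K)\<^sup>2 * \<eta>\<^sup>2 * G\<^sup>2 * real K * real L) = real T / ((real K)\<^sup>2 * \<eta>\<^sup>2 * real K * real L) / G\<^sup>2"
    by (simp add: mult_ac)
  ultimately show "real T / ((real K)\<^sup>2 * \<eta>\<^sup>2 * G\<^sup>2 * real K * real L) = real T powr (2 * \<theta>) / G\<^sup>2"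
    by simp
qed

context regular_semi_bandit_run
begin

lemma play_round:
  assumes t: "t < T" and \<omega>: "\<omega> \<in> space M"
  defines "q \<equiv> t div L"
  shows "play t i \<omega> = (if t = S q i \<omega> then query_map \<sigma> (x (q div K) i \<omega>) (Z q i \<omega>)
      else out_map \<sigma> (x (q div K) i \<omega>))"
  using play[OF t \<omega>, of i] by (simp add: q_def Let_def)

lemma play_mem:
  assumes t: "t < T" and \<omega>: "\<omega> \<in> space M"
  shows "play t i \<omega> \<in> \<K>"
  using scheme_facts(3,4) iterate_block_mem[OF round_block[OF t] \<omega>] Z_range[OF round_block[OF t] \<omega>]
  unfolding play_round[OF t \<omega>] by auto

lemma play_measurable:
  assumes t: "t < T"
  shows "play t i \<in> borel_measurable M"
proof -
  let ?q = "t div L"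
  have q: "?q < T div L" by (rule round_block[OF t])
  have xM: "x (?q div K) i \<in> borel_measurable M"
    by (rule F_measurable_M[OF iterate_block_measurable[OF q]])
  have "(\<lambda>\<omega>. query_map \<sigma> (x (?q div K) i \<omega>) (Z ?q i \<omega>)) \<in> borel_measurable M"
    using measurable_compose[OF borel_measurable_Pair[OF xM H_measurable_M[OF Z_measurable[OF q, of i]]]
        borel_measurable_continuous_onI[OF scheme_facts(7)]] by simp
  moreover have "(\<lambda>\<omega>. out_map \<sigma> (x (?q div K) i \<omega>)) \<in> borel_measurable M"
    by (rule measurable_compose[OF xM borel_measurable_continuous_onI[OF scheme_facts(6)]])
  moreover have "{\<omega> \<in> space M. t = S ?q i \<omega>} \<in> sets M"
  proof -
    have "S ?q i -` {t} \<inter> space M \<in> sets M"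
      by (rule measurable_sets[OF H_measurable_M[OF S_measurable[OF q]]]) simp
    moreover have "S ?q i -` {t} \<inter> space M = {\<omega> \<in> space M. t = S ?q i \<omega>}" by auto
    ultimately show ?thesis by simp
  qed
  ultimately have "(\<lambda>\<omega>. if t = S ?q i \<omega> then query_map \<sigma> (x (?q div K) i \<omega>) (Z ?q i \<omega>)
      else out_map \<sigma> (x (?q div K) i \<omega>)) \<in> borel_measurable M"
    by (rule measurable_If[rotated 2, rotated])
  moreover have "play t i \<in> borel_measurable M \<longleftrightarrow> (\<lambda>\<omega>. if t = S ?q i \<omega>
      then query_map \<sigma> (x (?q div K) i \<omega>) (Z ?q i \<omega>) else out_map \<sigma> (x (?q div K) i \<omega>)) \<in> borel_measurable M"
    by (rule measurable_cong) (rule play_round[OF t])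
  ultimately show ?thesis by simp
qed

lemma play_value_integrable: "t < T \<Longrightarrow> integrable M (\<lambda>\<omega>. f t j (play t i \<omega>))"
  using play_mem domain(3) by (intro integrable_cube_function objective_continuous play_measurable) blast+

text \<open>The supremum in the regret is attained by compactness, so the regret is a comparison with one
  deterministic point.\<close>

lemma best_fixed_point:
  obtains u where "u \<in> \<K>"
    "\<And>\<alpha> z i. regret \<alpha> \<K> T f z i
       = 1 / real CARD('n) * (\<Sum>t<T. \<Sum>j\<in>UNIV. \<alpha> * f t j u - f t j (z t i))"
proof -
  define V where "V u = 1 / real CARD('n) * (\<Sum>t<T. \<Sum>j\<in>UNIV. f t j u)" for u
  have "continuous_on \<K> V"
    unfolding V_def using domain(3) objective_continuous
    by (intro continuous_intros) (meson continuous_on_subset lessThan_iff)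
  then obtain u where u: "u \<in> \<K>" "\<And>w. w \<in> \<K> \<Longrightarrow> V w \<le> V u"
    using continuous_attains_sup[OF domain(2)] start(1) by blast
  have sup: "(SUP w\<in>\<K>. V w) = V u"
    using u by (intro cSup_eq_maximum) auto
  have "regret \<alpha> \<K> T f z i = 1 / real CARD('n) * (\<Sum>t<T. \<Sum>j\<in>UNIV. \<alpha> * f t j u - f t j (z t i))" for \<alpha> z i
    unfolding regret_def V_def[symmetric] sup
    by (simp add: V_def sum_subtractf algebra_simps flip: sum_distrib_left)
  then show thesis using u(1) that by blast
qed

lemma regret_integrable: "integrable M (\<lambda>\<omega>. regret \<alpha> \<K> T f (\<lambda>t j. play t j \<omega>) i)"
proof -
  obtain u where "u \<in> \<K>" and u: "\<And>\<alpha> z i. regret \<alpha> \<K> T f z i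
       = 1 / real CARD('n) * (\<Sum>t<T. \<Sum>j\<in>UNIV. \<alpha> * f t j u - f t j (z t i))"
    by (rule best_fixed_point) blast
  show ?thesis
    unfolding u
    by (intro integrable_mult_right Bochner_Integration.integrable_sum Bochner_Integration.integrable_diff
        play_value_integrable integrable_const) auto
qed

lemma sum_blocks: "(\<Sum>t<T. h t) = (\<Sum>q<T div L. \<Sum>t\<in>{q * L..<Suc q * L}. h t)" for h :: "nat \<Rightarrow> real"
  using sum.nat_group[of h L "T div L"] horizon by (simp add: add.commute)

lemma sum_phases: "(\<Sum>q<T div L. h q) = (\<Sum>m<phases. \<Sum>q\<in>{m * K..<Suc m * K}. h q)" for h :: "nat \<Rightarrow> real"
  using sum.nat_group[of h K phases] horizon by (simp add: add.commute)

text \<open>Agent \<open>i\<close> pays for the objective of agent \<open>j\<close>: the disagreement of the two agents enters in every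
  round, and the exploratory query only in the drawn round of the block.\<close>

lemma round_loss:
  assumes q: "q < T div L" and t: "t \<in> {q * L..<Suc q * L}" and \<omega>: "\<omega> \<in> space M"
  shows "f t j (out_map \<sigma> (x (q div K) j \<omega>)) - f t j (play t i \<omega>)
    \<le> \<bar>M1\<bar> * ((consensus_factor + 4) * step_size) + (if t = S q i \<omega> then \<bar>M1\<bar> * (2 * R) else 0)"
proof -
  have tT: "t < T" "t div L = q" using block_round[OF q t] by auto
  let ?o = "\<lambda>j. out_map \<sigma> (x (q div K) j \<omega>)"
  have oK: "?o j \<in> \<K>" for j by (intro scheme_facts iterate_block_mem q \<omega>)
  have pK: "play t i \<omega> \<in> \<K>" by (rule play_mem[OF tT(1) \<omega>])
  have lip: "\<bar>f t j p - f t j p'\<bar> \<le> \<bar>M1\<bar> * norm (p - p')" if "p \<in> \<K>" "p' \<in> \<K>" for p p'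
  proof -
    have "M1-lipschitz_on {0..1} (f t j)" using objectives[OF tT(1), of j] by (simp add: regular_objective_def)
    then have "dist (f t j p) (f t j p') \<le> M1 * dist p p'"
      using that domain(3) by (intro lipschitz_onD) blast+
    also have "\<dots> \<le> \<bar>M1\<bar> * dist p p'" by (intro mult_right_mono) auto
    finally show ?thesis by (simp add: dist_norm)
  qed
  have "norm (?o j - ?o i) \<le> norm (x (q div K) j \<omega> - x (q div K) i \<omega>)" by (rule scheme_facts(5))
  also have "\<dots> \<le> (consensus_factor + 4) * step_size"
    using phase_of_block(1)[OF q] by (intro iterate_consensus \<omega>) simp
  finally have "\<bar>M1\<bar> * norm (?o j - ?o i) \<le> \<bar>M1\<bar> * ((consensus_factor + 4) * step_size)"
    by (intro mult_left_mono) auto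
  then have 1: "f t j (?o j) - f t j (?o i) \<le> \<bar>M1\<bar> * ((consensus_factor + 4) * step_size)"
    using lip[OF oK oK, of j i] by linarith
  have 2: "f t j (?o i) - f t j (play t i \<omega>) \<le> (if t = S q i \<omega> then \<bar>M1\<bar> * (2 * R) else 0)"
  proof (cases "t = S q i \<omega>")
    case True
    have "norm (?o i - play t i \<omega>) \<le> 2 * R"
      using norm_triangle_ineq4[of "?o i" "play t i \<omega>"] norm_le_R[OF oK[of i]] norm_le_R[OF pK] by linarith
    then have "\<bar>M1\<bar> * norm (?o i - play t i \<omega>) \<le> \<bar>M1\<bar> * (2 * R)" by (intro mult_left_mono) auto
    then show ?thesis using lip[OF oK pK, of i] True by simp
  next
    case False
    then show ?thesis using play_round[OF tT(1) \<omega>, of i] tT(2) by simp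
  qed
  from 1 2 show ?thesis by linarith
qed

lemma total_loss:
  assumes \<omega>: "\<omega> \<in> space M"
  shows "(\<Sum>t<T. \<Sum>j\<in>UNIV. \<alpha> * f t j u - f t j (play t i \<omega>))
    \<le> (\<Sum>q<T div L. \<Sum>j\<in>UNIV. \<Sum>t\<in>{q * L..<Suc q * L}. \<alpha> * f t j u - f t j (out_map \<sigma> (x (q div K) j \<omega>)))
      + real CARD('n) * (real T * (\<bar>M1\<bar> * ((consensus_factor + 4) * step_size))
          + real (T div L) * (\<bar>M1\<bar> * (2 * R)))"
proof -
  define D where "D = \<bar>M1\<bar> * ((consensus_factor + 4) * step_size)"
  have "(\<Sum>t<T. \<Sum>j\<in>UNIV. \<alpha> * f t j u - f t j (play t i \<omega>))
      = (\<Sum>q<T div L. \<Sum>j\<in>UNIV. \<Sum>t\<in>{q * L..<Suc q * L}. \<alpha> * f t j u - f t j (play t i \<omega>))"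
    unfolding sum_blocks by (intro sum.cong refl) (rule sum.swap)
  also have "\<dots> \<le> (\<Sum>q<T div L. \<Sum>j\<in>(UNIV::'n set). \<Sum>t\<in>{q * L..<Suc q * L}.
      (\<alpha> * f t j u - f t j (out_map \<sigma> (x (q div K) j \<omega>))) + (D + (if t = S q i \<omega> then \<bar>M1\<bar> * (2 * R) else 0)))"
  proof (intro sum_mono)
    fix q j t assume "q \<in> {..<T div L}" "t \<in> {q * L..<Suc q * L}"
    then show "\<alpha> * f t j u - f t j (play t i \<omega>)
      \<le> (\<alpha> * f t j u - f t j (out_map \<sigma> (x (q div K) j \<omega>))) + (D + (if t = S q i \<omega> then \<bar>M1\<bar> * (2 * R) else 0))"
      using round_loss[of q t \<omega> j i] \<omega> by (simp add: D_def)
  qed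
  also have "\<dots> = (\<Sum>q<T div L. (\<Sum>j\<in>UNIV. \<Sum>t\<in>{q * L..<Suc q * L}.
      \<alpha> * f t j u - f t j (out_map \<sigma> (x (q div K) j \<omega>))) + real CARD('n) * (real L * D + \<bar>M1\<bar> * (2 * R)))"
  proof (intro sum.cong refl)
    fix q assume "q \<in> {..<T div L}"
    then have "S q i \<omega> \<in> {q * L..<Suc q * L}" using S_range \<omega> by simp
    then have "(\<Sum>t\<in>{q * L..<Suc q * L}. D + (if t = S q i \<omega> then \<bar>M1\<bar> * (2 * R) else 0)) = real L * D + \<bar>M1\<bar> * (2 * R)"
      unfolding sum.distrib by simp
    then show "(\<Sum>j\<in>(UNIV::'n set). \<Sum>t\<in>{q * L..<Suc q * L}.
        (\<alpha> * f t j u - f t j (out_map \<sigma> (x (q div K) j \<omega>))) + (D + (if t = S q i \<omega> then \<bar>M1\<bar> * (2 * R) else 0)))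
      = (\<Sum>j\<in>UNIV. \<Sum>t\<in>{q * L..<Suc q * L}. \<alpha> * f t j u - f t j (out_map \<sigma> (x (q div K) j \<omega>)))
        + real CARD('n) * (real L * D + \<bar>M1\<bar> * (2 * R))"
      by (simp only: sum.distrib[of _ "\<lambda>t. D + _ t"] sum.distrib[of _ "\<lambda>j. real L * D + \<bar>M1\<bar> * (2 * R)"] sum.distrib sum_constant)
         (simp add: algebra_simps)
  qed
  also have "\<dots> = (\<Sum>q<T div L. \<Sum>j\<in>UNIV. \<Sum>t\<in>{q * L..<Suc q * L}. \<alpha> * f t j u - f t j (out_map \<sigma> (x (q div K) j \<omega>)))
      + real CARD('n) * (real (T div L * L) * D + real (T div L) * (\<bar>M1\<bar> * (2 * R)))"
    by (simp only: sum.distrib sum_constant) (simp add: algebra_simps)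
  also have "T div L * L = T" using horizon by simp
  finally show ?thesis by (simp add: D_def)
qed

definition regret_constant :: real where
  "regret_constant = 2 * R\<^sup>2 + (consensus_factor + 5/2) + \<bar>M1\<bar> * (consensus_factor + 4) / G + 2 * \<bar>M1\<bar> * R"

text \<open>The iterate is constant during a phase, so the responses of its blocks add up to the gradient
  that is used in the update.\<close>

lemma gradient_sum_expectation:
  assumes u: "u \<in> \<K>"
  shows "(\<Sum>q<T div L. \<Sum>j\<in>UNIV. \<integral>\<omega>. resp q j \<omega> \<bullet> (u - x (q div K) j \<omega>) \<partial>M)
    \<le> real CARD('n) * (2 * R\<^sup>2 / \<eta> + real phases * (\<eta> * (real K)\<^sup>2 * G\<^sup>2 * (consensus_factor + 5/2)))"
proof -
  let ?B = "real CARD('n) * (2 * R\<^sup>2 / \<eta> + real phases * (\<eta> * (real K)\<^sup>2 * G\<^sup>2 * (consensus_factor + 5/2)))"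
  have int: "integrable M (\<lambda>\<omega>. \<Sum>j\<in>UNIV. resp q j \<omega> \<bullet> (u - x (q div K) j \<omega>))" if "q < T div L" for q
    by (intro Bochner_Integration.integrable_sum resp_integrable that u)
  have "(\<Sum>q<T div L. \<Sum>j\<in>UNIV. \<integral>\<omega>. resp q j \<omega> \<bullet> (u - x (q div K) j \<omega>) \<partial>M)
      = (\<Sum>q<T div L. \<integral>\<omega>. (\<Sum>j\<in>UNIV. resp q j \<omega> \<bullet> (u - x (q div K) j \<omega>)) \<partial>M)"
    by (intro sum.cong refl Bochner_Integration.integral_sum[symmetric] resp_integrable u) simp
  also have "\<dots> = (\<integral>\<omega>. (\<Sum>q<T div L. \<Sum>j\<in>UNIV. resp q j \<omega> \<bullet> (u - x (q div K) j \<omega>)) \<partial>M)"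
    by (intro Bochner_Integration.integral_sum[symmetric] int) simp
  also have "\<dots> \<le> (\<integral>\<omega>. ?B \<partial>M)"
  proof (rule integral_mono)
    show "integrable M (\<lambda>\<omega>. \<Sum>q<T div L. \<Sum>j\<in>UNIV. resp q j \<omega> \<bullet> (u - x (q div K) j \<omega>))"
      by (intro Bochner_Integration.integrable_sum resp_integrable u) simp
    fix \<omega> assume \<omega>: "\<omega> \<in> space M"
    have "(\<Sum>q<T div L. \<Sum>j\<in>UNIV. resp q j \<omega> \<bullet> (u - x (q div K) j \<omega>))
        = (\<Sum>m<phases. \<Sum>j\<in>UNIV. phase_gradient m j \<omega> \<bullet> (u - x m j \<omega>))"
      unfolding sum_phases
    proof (rule sum.cong[OF refl])
      fix m
      have "q div K = m" if "q \<in> {m * K..<Suc m * K}" for q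
        using that by (intro div_nat_eqI) (auto simp: mult.commute)
      then have "(\<Sum>q\<in>{m * K..<Suc m * K}. \<Sum>j\<in>UNIV. resp q j \<omega> \<bullet> (u - x (q div K) j \<omega>))
          = (\<Sum>q\<in>{m * K..<Suc m * K}. \<Sum>j\<in>UNIV. resp q j \<omega> \<bullet> (u - x m j \<omega>))"
        by (intro sum.cong) auto
      also have "\<dots> = (\<Sum>j\<in>UNIV. phase_gradient m j \<omega> \<bullet> (u - x m j \<omega>))"
        by (subst sum.swap) (simp only: phase_gradient_def inner_sum_left)
      finally show "(\<Sum>q\<in>{m * K..<Suc m * K}. \<Sum>j\<in>UNIV. resp q j \<omega> \<bullet> (u - x (q div K) j \<omega>))
          = (\<Sum>j\<in>UNIV. phase_gradient m j \<omega> \<bullet> (u - x m j \<omega>))" .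
    qed
    also have "\<dots> \<le> ?B" by (rule online_gradient_regret[OF \<omega> u])
    finally show "(\<Sum>q<T div L. \<Sum>j\<in>UNIV. resp q j \<omega> \<bullet> (u - x (q div K) j \<omega>)) \<le> ?B" .
  qed simp
  also have "\<dots> = ?B" by (simp add: prob_space)
  finally show ?thesis .
qed

text \<open>The factor \<open>L\<close> of the linearization multiplies the regret of gradient ascent, and
  \<open>phases * K * L = T\<close>. The disagreement costs \<open>T * K * \<eta> * G\<close> times a constant; writing it as a multiple
  of \<open>\<eta> * T * K * G\<^sup>2\<close> puts \<open>G\<close> into a denominator.\<close>

lemma expected_regret_explicit:
  "(\<integral>\<omega>. regret (ratio \<sigma>) \<K> T f (\<lambda>t j. play t j \<omega>) i \<partial>M)
    \<le> 2 * R\<^sup>2 * (real L / \<eta>) + (consensus_factor + 5/2) * (\<eta> * real T * real K * G\<^sup>2)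
      + \<bar>M1\<bar> * (consensus_factor + 4) / G * (\<eta> * real T * real K * G\<^sup>2) + 2 * \<bar>M1\<bar> * R * (real T / real L)"
proof -
  obtain u where u: "u \<in> \<K>" and reg: "\<And>\<alpha> z i. regret \<alpha> \<K> T f z i
       = 1 / real CARD('n) * (\<Sum>t<T. \<Sum>j\<in>UNIV. \<alpha> * f t j u - f t j (z t i))"
    by (rule best_fixed_point) blast
  let ?n = "real CARD('n)"
  let ?lin = "\<lambda>\<omega>. \<Sum>q<T div L. \<Sum>j\<in>UNIV. \<Sum>t\<in>{q * L..<Suc q * L}.
      ratio \<sigma> * f t j u - f t j (out_map \<sigma> (x (q div K) j \<omega>))"
  define W where "W = 2 * R\<^sup>2 / \<eta> + real phases * (\<eta> * (real K)\<^sup>2 * G\<^sup>2 * (consensus_factor + 5/2))"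
  define D where "D = real T * (\<bar>M1\<bar> * ((consensus_factor + 4) * step_size)) + real (T div L) * (\<bar>M1\<bar> * (2 * R))"
  have W0: "0 \<le> W"
    unfolding W_def using params consensus_factor_nonneg by (intro add_nonneg_nonneg) auto
  have int1: "integrable M (\<lambda>\<omega>. ratio \<sigma> * f t j u - f t j (out_map \<sigma> (x (q div K) j \<omega>)))"
    if "q < T div L" "t \<in> {q * L..<Suc q * L}" for q t j
    using that by (intro Bochner_Integration.integrable_diff out_value_integrable integrable_const block_round(1))
  have int: "integrable M ?lin"
    by (intro Bochner_Integration.integrable_sum int1) auto
  have "(\<integral>\<omega>. ?lin \<omega> \<partial>M) = (\<Sum>q<T div L. \<integral>\<omega>. (\<Sum>j\<in>UNIV. \<Sum>t\<in>{q * L..<Suc q * L}.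
      ratio \<sigma> * f t j u - f t j (out_map \<sigma> (x (q div K) j \<omega>))) \<partial>M)"
    by (intro Bochner_Integration.integral_sum Bochner_Integration.integrable_sum int1) auto
  also have "\<dots> = (\<Sum>q<T div L. \<Sum>j\<in>UNIV. \<integral>\<omega>. (\<Sum>t\<in>{q * L..<Suc q * L}.
      ratio \<sigma> * f t j u - f t j (out_map \<sigma> (x (q div K) j \<omega>))) \<partial>M)"
    by (intro sum.cong refl Bochner_Integration.integral_sum Bochner_Integration.integrable_sum int1) auto
  also have "\<dots> = (\<Sum>q<T div L. \<Sum>j\<in>UNIV. \<Sum>t\<in>{q * L..<Suc q * L}.
      \<integral>\<omega>. ratio \<sigma> * f t j u - f t j (out_map \<sigma> (x (q div K) j \<omega>)) \<partial>M)"
    by (intro sum.cong refl Bochner_Integration.integral_sum int1) auto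
  also have "\<dots> \<le> (\<Sum>q<T div L. \<Sum>j\<in>UNIV. \<beta> * real L * (\<integral>\<omega>. resp q j \<omega> \<bullet> (u - x (q div K) j \<omega>) \<partial>M))"
    by (intro sum_mono block_linearization u) simp
  also have "\<dots> = \<beta> * real L * (\<Sum>q<T div L. \<Sum>j\<in>UNIV. \<integral>\<omega>. resp q j \<omega> \<bullet> (u - x (q div K) j \<omega>) \<partial>M)"
    by (simp only: sum_distrib_left)
  also have "\<dots> \<le> \<beta> * real L * (?n * W)"
    unfolding W_def using linear_bound(2) by (intro mult_left_mono gradient_sum_expectation[OF u]) auto
  also have "\<dots> \<le> 1 * real L * (?n * W)"
    using linear_bound(3) W0 by (intro mult_right_mono) auto
  finally have lin: "(\<integral>\<omega>. ?lin \<omega> \<partial>M) \<le> ?n * (real L * W)" by (simp add: mult_ac)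
  have "(\<integral>\<omega>. regret (ratio \<sigma>) \<K> T f (\<lambda>t j. play t j \<omega>) i \<partial>M) \<le> (\<integral>\<omega>. 1 / ?n * (?lin \<omega> + ?n * D) \<partial>M)"
  proof (rule integral_mono[OF regret_integrable])
    show "integrable M (\<lambda>\<omega>. 1 / ?n * (?lin \<omega> + ?n * D))"
      by (intro integrable_mult_right Bochner_Integration.integrable_add int integrable_const)
    show "regret (ratio \<sigma>) \<K> T f (\<lambda>t j. play t j \<omega>) i \<le> 1 / ?n * (?lin \<omega> + ?n * D)" if "\<omega> \<in> space M" for \<omega>
      unfolding reg D_def by (intro mult_left_mono total_loss[OF that]) simp
  qed
  also have "\<dots> = 1 / ?n * ((\<integral>\<omega>. ?lin \<omega> \<partial>M) + ?n * D)"
    using int by (simp add: prob_space)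
  also have "\<dots> \<le> 1 / ?n * (?n * (real L * W) + ?n * D)"
    by (intro mult_left_mono add_right_mono lin) simp
  also have "\<dots> = real L * W + D"
    by (simp add: field_simps)
  also have "real L * W = 2 * R\<^sup>2 * (real L / \<eta>)
      + real (phases * K * L) * (\<eta> * real K * G\<^sup>2 * (consensus_factor + 5/2))"
    by (simp add: W_def algebra_simps power2_eq_square)
  also have "phases * K * L = T" using horizon by simp
  also have "D = \<bar>M1\<bar> * (consensus_factor + 4) / G * (\<eta> * real T * real K * G\<^sup>2) + 2 * \<bar>M1\<bar> * R * (real T / real L)"
  proof -
    have "real (T div L) = real T / real L"
      using params(2) horizon by (metis nonzero_mult_div_cancel_right of_nat_0_eq_iff of_nat_mult not_gr_zero)
    then show ?thesis using params(5) by (simp add: D_def step_size_def power2_eq_square)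
  qed
  finally show ?thesis by (simp add: algebra_simps)
qed

lemma expected_regret:
  "(\<integral>\<omega>. regret (ratio \<sigma>) \<K> T f (\<lambda>t j. play t j \<omega>) i \<partial>M)
    \<le> regret_constant * (real L / \<eta> + \<eta> * real T * real K * G\<^sup>2 + real T / real L)"
proof -
  define a where "a = real L / \<eta>"
  define b where "b = \<eta> * real T * real K * G\<^sup>2"
  define d where "d = real T / real L"
  have nn: "0 \<le> a" "0 \<le> b" "0 \<le> d" using params by (auto simp: a_def b_def d_def)
  define k1 where "k1 = 2 * R\<^sup>2"
  define k2 where "k2 = consensus_factor + 5/2"
  define k3 where "k3 = \<bar>M1\<bar> * (consensus_factor + 4) / G"
  define k4 where "k4 = 2 * \<bar>M1\<bar> * R"
  have kk: "0 \<le> k1" "0 \<le> k2" "0 \<le> k3" "0 \<le> k4"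
    using consensus_factor_nonneg R_nonneg params(5) by (auto simp: k1_def k2_def k3_def k4_def)
  have "k1 * a + k2 * b + k3 * b + k4 * d \<le> (k1 + k2 + k3 + k4) * (a + b + d)"
  proof -
    have "0 \<le> k1 * (b + d) + k2 * (a + d) + k3 * (a + d) + k4 * (a + b)"
      using nn kk by (intro add_nonneg_nonneg mult_nonneg_nonneg) auto
    then show ?thesis by (simp add: algebra_simps)
  qed
  then show ?thesis
    using expected_regret_explicit[of i]
    unfolding regret_constant_def a_def b_def d_def k1_def k2_def k3_def k4_def by linarith
qed

lemma regret_constant_nonneg: "0 \<le> regret_constant"
  unfolding regret_constant_def using consensus_factor_nonneg R_nonneg params(5) by (intro add_nonneg_nonneg) auto

lemma real_phases: "real phases = real T / (real K * real L)"
  using horizon(1) params(1,2) by (metis (no_types, lifting) mult.assoc mult_eq_0_iff nonzero_mult_div_cancel_right of_nat_0_eq_iff of_nat_mult not_gr_zero)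

lemma loo_complexity:
  assumes "\<omega> \<in> space M"
  shows "real (n_loo phases i \<omega>) \<le> 513 * R\<^sup>2 * (real T / (\<epsilon> * real K * real L))"
  using loo_calls_bound[OF assms, of phases i] by (simp add: real_phases mult_ac)

lemma communication_complexity:
  "real (\<Sum>i\<in>UNIV. n_comm phases i) = real CARD('n) * (real T / (real K * real L))"
  by (simp add: communication_count real_phases)

text \<open>The second factor makes one constant serve all bounds: with tuned parameters the three terms of the
  regret add up to \<open>2 + G\<^sup>2\<close> times a power of \<open>T\<close>, and \<open>1 / \<epsilon>\<close> leaves a factor \<open>1 / G\<^sup>2\<close> in the number
  of oracle calls.\<close>

definition overall_constant :: real where
  "overall_constant = (regret_constant + 513 * R\<^sup>2 + real CARD('n)) * (2 + G\<^sup>2 + 1 / G\<^sup>2)"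

lemma overall_constant_ge:
  "regret_constant \<le> overall_constant" "513 * R\<^sup>2 \<le> overall_constant" "real CARD('n) \<le> overall_constant"
  "regret_constant * (2 + G\<^sup>2) \<le> overall_constant" "513 * R\<^sup>2 / G\<^sup>2 \<le> overall_constant"
proof -
  define r where "r = 513 * R\<^sup>2"
  define n where "n = real CARD('n)"
  define g where "g = 1 / G\<^sup>2"
  note nn = regret_constant_nonneg
  have r: "0 \<le> r" and n: "0 \<le> n" and g: "0 \<le> g" by (auto simp: r_def n_def g_def)
  have bound: "a * b \<le> (regret_constant + r + n) * (2 + G\<^sup>2 + g)"
    if "0 \<le> b" "a \<le> regret_constant + r + n" "b \<le> 2 + G\<^sup>2 + g" for a b
    using that nn r n g by (intro mult_mono) auto
  have oc: "overall_constant = (regret_constant + r + n) * (2 + G\<^sup>2 + g)"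
    by (simp add: overall_constant_def r_def n_def g_def)
  have G2: "0 \<le> G\<^sup>2" by simp
  show "regret_constant \<le> overall_constant" "513 * R\<^sup>2 \<le> overall_constant" "real CARD('n) \<le> overall_constant"
    using bound[of 1 regret_constant] bound[of 1 r] bound[of 1 n] nn r n g G2 by (auto simp: oc r_def n_def)
  show "regret_constant * (2 + G\<^sup>2) \<le> overall_constant"
    using bound[of "2 + G\<^sup>2" regret_constant] nn r n g G2 by (auto simp: oc)
  show "513 * R\<^sup>2 / G\<^sup>2 \<le> overall_constant"
    using bound[of g r] nn r n g G2 by (auto simp: oc r_def g_def)
qed

lemma performance_bounds:
  "(\<integral>\<omega>. regret (ratio \<sigma>) \<K> T f (\<lambda>t j. play t j \<omega>) i \<partial>M)
    \<le> overall_constant * (real L / \<eta> + \<eta> * real T * real K * G\<^sup>2 + real T / real L)"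
  "\<omega> \<in> space M \<Longrightarrow> real (n_loo phases i \<omega>) \<le> overall_constant * (real T / (\<epsilon> * real K * real L))"
  "real (\<Sum>i\<in>UNIV. n_comm phases i) \<le> overall_constant * (real T / (real K * real L))"
proof -
  have "0 \<le> real L / \<eta> + \<eta> * real T * real K * G\<^sup>2 + real T / real L"
    using params by (intro add_nonneg_nonneg) auto
  from mult_right_mono[OF overall_constant_ge(1) this] expected_regret[of i]
  show "(\<integral>\<omega>. regret (ratio \<sigma>) \<K> T f (\<lambda>t j. play t j \<omega>) i \<partial>M)
    \<le> overall_constant * (real L / \<eta> + \<eta> * real T * real K * G\<^sup>2 + real T / real L)" by linarith
  have "0 \<le> real T / (\<epsilon> * real K * real L)" using step_size_pos(3) by simp
  from mult_right_mono[OF overall_constant_ge(2) this] loo_complexity[of \<omega> i]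
  show "real (n_loo phases i \<omega>) \<le> overall_constant * (real T / (\<epsilon> * real K * real L))" if "\<omega> \<in> space M"
    using that by linarith
  have "0 \<le> real T / (real K * real L)" by simp
  from mult_right_mono[OF overall_constant_ge(3) this]
  show "real (\<Sum>i\<in>UNIV. n_comm phases i) \<le> overall_constant * (real T / (real K * real L))"
    unfolding communication_complexity .
qed

text \<open>The equation for \<open>K\<close> excludes \<open>T = 0\<close>, as \<open>0 powr a = 0\<close> and \<open>K\<close> is positive.\<close>

lemma tuned_performance_bounds:
  assumes "real K = real T powr (1 - 3 * \<theta> / 2)" "real L = real T powr (\<theta> / 2)" "\<eta> = real T powr (\<theta> - 1)"
  shows "(\<integral>\<omega>. regret (ratio \<sigma>) \<K> T f (\<lambda>t j. play t j \<omega>) i \<partial>M) \<le> overall_constant * real T powr (1 - \<theta> / 2)"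
    and "\<omega> \<in> space M \<Longrightarrow> real (n_loo phases i \<omega>) \<le> overall_constant * real T powr (2 * \<theta>)"
    and "real (\<Sum>i\<in>UNIV. n_comm phases i) \<le> overall_constant * real T powr \<theta>"
proof -
  have "T \<noteq> 0" using assms(1) params(1) by (intro notI) simp
  then have T: "0 < T" by simp
  note tp = tuned_parameters[OF T assms]
  have "(\<integral>\<omega>. regret (ratio \<sigma>) \<K> T f (\<lambda>t j. play t j \<omega>) i \<partial>M)
      \<le> regret_constant * (real T powr (1 - \<theta> / 2) + G\<^sup>2 * real T powr (1 - \<theta> / 2) + real T powr (1 - \<theta> / 2))"
    using expected_regret[of i] unfolding tp(1-3) .
  also have "\<dots> = (regret_constant * (2 + G\<^sup>2)) * real T powr (1 - \<theta> / 2)" by (simp add: algebra_simps)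
  also have "\<dots> \<le> overall_constant * real T powr (1 - \<theta> / 2)"
    by (intro mult_right_mono overall_constant_ge) simp
  finally show "(\<integral>\<omega>. regret (ratio \<sigma>) \<K> T f (\<lambda>t j. play t j \<omega>) i \<partial>M) \<le> overall_constant * real T powr (1 - \<theta> / 2)" .
  show "real (n_loo phases i \<omega>) \<le> overall_constant * real T powr (2 * \<theta>)" if \<omega>: "\<omega> \<in> space M"
  proof -
    have "real (n_loo phases i \<omega>) \<le> (513 * R\<^sup>2 / G\<^sup>2) * real T powr (2 * \<theta>)"
      using loo_complexity[OF \<omega>, of i] unfolding params(6) tp(4) by simp
    also have "\<dots> \<le> overall_constant * real T powr (2 * \<theta>)"
      by (intro mult_right_mono overall_constant_ge) simp
    finally show ?thesis .
  qed
  show "real (\<Sum>i\<in>UNIV. n_comm phases i) \<le> overall_constant * real T powr \<theta>"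
    unfolding communication_complexity tp(5) by (intro mult_right_mono overall_constant_ge) simp
qed

end

theorem theorem4:
  fixes \<gamma> R G lam2 M1 M2 :: real
  assumes "0 < \<gamma>" and "\<gamma> \<le> 1" and "lam2 < 1" and "0 < G"
  shows "\<exists>C. \<forall>(\<K> :: (real^'d) set) T (f :: nat \<Rightarrow> 'n::finite \<Rightarrow> real^'d \<Rightarrow> real) \<sigma> E (A :: real^'n^'n)
      lo P K L \<eta> \<epsilon> c (M :: 'w measure) F H Z S resp x y y_tilde play n_loo n_comm.
    convex \<K> \<and> compact \<K> \<and> \<K> \<subseteq> {0..1} \<and> R = (SUP u\<in>\<K>. norm u) \<and>
    (\<forall>t<T. \<forall>i. regular_objective M1 M2 (f t i)) \<and>
    (monotone_case \<gamma> \<K> T f \<sigma> \<or> nonmonotone_case \<K> T f \<sigma>) \<and>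
    weight_matrix E A \<and> transpose A = A \<and> doubly_stochastic A \<and> second_eigenvalue A lam2 \<and>
    0 < K \<and> 0 < L \<and> K * L dvd T \<and> 0 < \<eta> \<and> \<epsilon> = (real K)\<^sup>2 * \<eta>\<^sup>2 * G\<^sup>2 \<and>
    linear_opt_oracle \<K> lo \<and> implements_projection \<K> R \<epsilon> lo P \<and>
    semi_bandit_run M F H \<K> G T f E A \<sigma> lo P K L \<eta> c Z S resp x y y_tilde play n_loo n_comm
    \<longrightarrow>
      (\<forall>i. integrable M (\<lambda>\<omega>. regret (ratio \<sigma>) \<K> T f (\<lambda>t j. play t j \<omega>) i) \<and>
           (\<integral>\<omega>. regret (ratio \<sigma>) \<K> T f (\<lambda>t j. play t j \<omega>) i \<partial>M)
             \<le> C * (real L / \<eta> + \<eta> * real T * real K * G\<^sup>2 + real T / real L)) \<and>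
      (\<forall>i. \<forall>\<omega>\<in>space M. real (n_loo (T div (L * K)) i \<omega>)
             \<le> C * (real T / (\<epsilon> * real K * real L))) \<and>
      real (\<Sum>i\<in>UNIV. n_comm (T div (L * K)) i) \<le> C * (real T / (real K * real L)) \<and>
      (\<forall>\<theta>. 0 \<le> \<theta> \<and> \<theta> \<le> 2/3 \<and> real K = real T powr (1 - 3 * \<theta> / 2) \<and>
            real L = real T powr (\<theta> / 2) \<and> \<eta> = real T powr (\<theta> - 1) \<longrightarrow>
         (\<forall>i. (\<integral>\<omega>. regret (ratio \<sigma>) \<K> T f (\<lambda>t j. play t j \<omega>) i \<partial>M)
                \<le> C * real T powr (1 - \<theta> / 2)) \<and>
         (\<forall>i. \<forall>\<omega>\<in>space M. real (n_loo (T div (L * K)) i \<omega>) \<le> C * real T powr (2 * \<theta>)) \<and>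
         real (\<Sum>i\<in>UNIV. n_comm (T div (L * K)) i) \<le> C * real T powr \<theta>)"
proof -
  define b where "b = 10 * sqrt (real CARD('n)) / (1 - lam2)"
  define C where "C = (2 * R\<^sup>2 + (b + 5/2) + \<bar>M1\<bar> * (b + 4) / G + 2 * \<bar>M1\<bar> * R + 513 * R\<^sup>2 + real CARD('n))
    * (2 + G\<^sup>2 + 1 / G\<^sup>2)"
  show ?thesis
  proof (intro exI[of _ C] allI impI, goal_cases)
    case (1 \<K> T f \<sigma> E A lo P K L \<eta> \<epsilon> c M F H Z S resp x y y_tilde play n_loo n_comm)
    then have h: "convex \<K>" "compact \<K>" "\<K> \<subseteq> {0..1}" "R = (SUP u\<in>\<K>. norm u)"
      "\<forall>t<T. \<forall>i. regular_objective M1 M2 (f t i)"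
      "monotone_case \<gamma> \<K> T f \<sigma> \<or> nonmonotone_case \<K> T f \<sigma>"
      "weight_matrix E A" "transpose A = A" "doubly_stochastic A" "second_eigenvalue A lam2"
      "0 < K" "0 < L" "K * L dvd T" "0 < \<eta>" "\<epsilon> = (real K)\<^sup>2 * \<eta>\<^sup>2 * G\<^sup>2"
      "implements_projection \<K> R \<epsilon> lo P"
      and run: "semi_bandit_run M F H \<K> G T f E A \<sigma> lo P K L \<eta> c Z S resp x y y_tilde play n_loo n_comm"
      by blast+
    obtain \<beta> where \<beta>: "0 \<le> \<beta>" "\<beta> \<le> 1" "admissible_scheme \<K> \<sigma>" "\<And>t i. t < T \<Longrightarrow> linearizable \<beta> \<K> \<sigma> (f t i)"
      using scheme_linearizable[OF h(1,3) assms(1,2) h(5,6)] by blast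
    interpret regular_semi_bandit_run M F H \<K> G T f E A \<sigma> lo P K L \<eta> c Z S resp x y y_tilde play n_loo n_comm
      R \<epsilon> lam2 M1 M2 \<beta>
      by (intro regular_semi_bandit_run.intro run regular_semi_bandit_run_axioms.intro)
         (use h \<beta> assms in blast)+
    have C: "C = overall_constant"
      by (simp only: C_def b_def overall_constant_def regret_constant_def consensus_factor_def)
    show ?case
      unfolding C phases_def[symmetric]
      using regret_integrable performance_bounds tuned_performance_bounds by blast
  qed
qed

end
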